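(* Let $k$ be a positive integer, $M$ an odd positive integer and $p$ a prime with $p\,\|\,M$. On $S_{k+1/2}(\Gamma_0(4M))$ we have: 1. $\widetilde W_{p^2}$ is an involution. 2. $(\widetilde Q_p-p)(\widetilde Q_p+1)=0$. 3. $\widetilde Q_p=\left(\frac{-1}p\right)^kp^{1-k}U_{p^2}\widetilde W_{p^2}$. 4. If $f\in S_{k+1/2}(\Gamma_0(4M/p))$ then $\widetilde Q_p(f)=pf$.
   Context: For $N$ divisible by $4$, $S_{k+1/2}(\Gamma_0(N))$ is the space of holomorphic cusp forms $f$ on the upper half plane with $f(\alpha z)=j(\alpha,z)^{2k+1}f(z)$ for $\alpha=\begin{pmatrix}a&b\\c&d\end{pmatrix}\in\Gamma_0(N)$, where $j(\alpha,z)=\varepsilon_d^{-1}\left(\frac cd\right)(cz+d)^{1/2}$, $\varepsilon_d=1$ or $i$ as $d\equiv1$ or $3\pmod4$, square roots have argument in $(-\pi/2,\pi/2]$, and $\left(\frac cd\right)$ is Shimura's symbol for odd $d$: the Jacobi symbol if $d>0$; $\left(\frac c{|d|}\right)$ if $d<0<c$; $-\left(\frac c{|d|}\right)$ if $c,d<0$; $\left(\frac0{\pm1}\right)=1$. For $\alpha\in\mathrm{GL}_2^+(\mathbb R)$ with lower row $(c,d)$ and holomorphic $\phi$ with $\phi(z)^2=t\det(\alpha)^{-1/2}(cz+d)$, $|t|=1$, put $f|[(\alpha,\phi)]_{k+1/2}(z)=f(\alpha z)\phi(z)^{-2k-1}$. $U_{p^2}(\sum a_nq^n)=\sum a_{p^2n}q^n$.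 Fix integers $m,n$ with $pn-4(M/p)m=1$. The operators on $S_{k+1/2}(\Gamma_0(4M))$ are $$\widetilde W_{p^2}(f)=\frac{\overline{\varepsilon_p}}{\sqrt p}\left(\frac{-1}p\right)\left(\frac{M/p}p\right)\sum_{s=0}^{p-1}f\Big|\left[\left(\begin{pmatrix}p^2n-4Mms&m\\4pM(1-s)&p\end{pmatrix},(4M(1-s)z+1)^{1/2}\right)\right]_{k+1/2},$$ $$\widetilde Q_p(f)=\sum_{s=0}^{p-1}f\Big|\left[\left(\begin{pmatrix}1&m-s\\4M/p&np-4(M/p)s\end{pmatrix},\big(4(M/p)z+np-4(M/p)s\big)^{1/2}\right)\right]_{k+1/2}.$$ (These are the classical forms of the operators $p^{-1/2}\mathcal U_1$ and $\mathcal U_0$ of a $p$-adic Hecke algebra of the double cover of $\mathrm{SL}_2(\mathbb Q_p)$.) *)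

theory Defs
  imports "HOL-Complex_Analysis.Complex_Analysis" "HOL-Number_Theory.Number_Theory"
begin

abbreviation uhp :: "complex set" where
  "uhp \<equiv> {z. Im z > 0}"

definition moebius :: "real \<Rightarrow> real \<Rightarrow> real \<Rightarrow> real \<Rightarrow> complex \<Rightarrow> complex" where
  "moebius a b c d z = (of_real a * z + of_real b) / (of_real c * z + of_real d)"


definition jacobi_symbol :: "int \<Rightarrow> nat \<Rightarrow> int" where
  "jacobi_symbol a n = (\<Prod>q\<in>#prime_factorization n. Legendre a (int q))"

text \<open>Shimura's symbol \<open>(c/d)\<close>, for odd \<open>d\<close>.  For \<open>c = 0\<close> the Jacobi symbol of
  \<open>0\<close> modulo \<open>\<bar>d\<bar>\<close> is \<open>1\<close> if \<open>\<bar>d\<bar> = 1\<close> (empty product) and \<open>0\<close> otherwise, so the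
  convention \<open>(0/\<plusminus>1) = 1\<close> is contained in the second branch.\<close>

definition shimura_symbol :: "int \<Rightarrow> int \<Rightarrow> int" where
  "shimura_symbol c d =
     (if c < 0 \<and> d < 0 then - jacobi_symbol c (nat \<bar>d\<bar>) else jacobi_symbol c (nat \<bar>d\<bar>))"

definition eps :: "int \<Rightarrow> complex" where
  "eps d = (if [d = 1] (mod 4) then 1 else \<i>)"

text \<open>\<open>csqrt\<close> is the branch with argument in \<open>(-\<pi>/2, \<pi>/2]\<close>.\<close>

definition theta_factor :: "int \<Rightarrow> int \<Rightarrow> complex \<Rightarrow> complex" where
  "theta_factor c d z =
     inverse (eps d) * of_int (shimura_symbol c d) * csqrt (of_int c * z + of_int d)"


text \<open>\<open>slash k a b c d \<phi> f\<close> is \<open>f | [(\<alpha>, \<phi>)]\<close> in weight \<open>k + 1/2\<close>, where \<open>\<alpha>\<close> has rows \<open>(a, b)\<close> and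
  \<open>(c, d)\<close>.  The normalisation by \<open>det \<alpha>\<close> is part of the choice of \<open>\<phi>\<close>, which has to satisfy
  \<open>\<phi> z ^ 2 = t * det \<alpha> powr (-1/2) * (c * z + d)\<close> with \<open>\<bar>t\<bar> = 1\<close>.\<close>

definition slash ::
  "nat \<Rightarrow> real \<Rightarrow> real \<Rightarrow> real \<Rightarrow> real \<Rightarrow> (complex \<Rightarrow> complex) \<Rightarrow> (complex \<Rightarrow> complex) \<Rightarrow> complex \<Rightarrow> complex"
where
  "slash k a b c d \<phi> f z = f (moebius a b c d z) / \<phi> z ^ (2 * k + 1)"

text \<open>Holomorphy and vanishing at \<open>\<infinity>\<close>: a Fourier expansion with positive exponents only.  In
  half-integral weight the exponents at a cusp of width \<open>w\<close> lie in \<open>(n + r) / w\<close> with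
  \<open>r \<in> {0, 1/4, 1/2, 3/4}\<close>; as \<open>h\<close> is arbitrary, these are all of the form \<open>n / h\<close>.\<close>

definition cuspidal_at_infinity :: "(complex \<Rightarrow> complex) \<Rightarrow> bool" where
  "cuspidal_at_infinity g \<longleftrightarrow>
     (\<exists>h>0. \<exists>a :: nat \<Rightarrow> complex. a 0 = 0 \<and>
        (\<forall>z\<in>uhp. (\<lambda>n. a n * exp (2 * of_real pi * \<i> * of_nat n * z / of_nat h)) sums g z))"

text \<open>Cusp forms of weight \<open>k + 1/2\<close> for \<open>\<Gamma>\<^sub>0(N)\<close>, \<open>4 dvd N\<close>.  Only the values on the upper half
  plane are meaningful; two cusp forms are equal if they agree there.  The cusps are
  the images of \<open>\<infinity>\<close> under \<open>SL\<^sub>2(\<int>)\<close>.\<close>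

definition cusp_forms :: "nat \<Rightarrow> nat \<Rightarrow> (complex \<Rightarrow> complex) set" where
  "cusp_forms k N = {f. f holomorphic_on uhp \<and>
     (\<forall>a b c d :: int. a * d - b * c = 1 \<and> int N dvd c \<longrightarrow>
        (\<forall>z\<in>uhp. f (moebius a b c d z) = theta_factor c d z ^ (2 * k + 1) * f z)) \<and>
     (\<forall>a b c d :: int. a * d - b * c = 1 \<longrightarrow>
        cuspidal_at_infinity (slash k a b c d (\<lambda>z. csqrt (of_int c * z + of_int d)) f))}"


definition fourier_coeffs :: "(complex \<Rightarrow> complex) \<Rightarrow> nat \<Rightarrow> complex" where
  "fourier_coeffs f =
     (THE a. \<forall>z\<in>uhp. (\<lambda>n. a n * exp (2 * of_real pi * \<i> * of_nat n * z)) sums f z)"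

definition U_op :: "nat \<Rightarrow> (complex \<Rightarrow> complex) \<Rightarrow> complex \<Rightarrow> complex" where
  "U_op r f z = (\<Sum>n. fourier_coeffs f (r * n) * exp (2 * of_real pi * \<i> * of_nat n * z))"

text \<open>The operators depend on integers \<open>m\<close>, \<open>n\<close> with \<open>p * n - 4 * (M / p) * m = 1\<close>.  The matrices then
  have determinant \<open>p\<^sup>2\<close> and \<open>1\<close> respectively.\<close>

definition W_op ::
  "nat \<Rightarrow> nat \<Rightarrow> nat \<Rightarrow> int \<Rightarrow> int \<Rightarrow> (complex \<Rightarrow> complex) \<Rightarrow> complex \<Rightarrow> complex"
where
  "W_op k M p m n f z =
     cnj (eps (int p)) / of_real (sqrt (real p))
       * of_int (Legendre (-1) (int p)) * of_int (Legendre (int (M div p)) (int p))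
       * (\<Sum>s\<in>{0..int p - 1}.
            slash k (of_int ((int p)\<^sup>2 * n - 4 * int M * m * s)) (of_int m)
                    (of_int (4 * int p * int M * (1 - s))) (of_int (int p))
              (\<lambda>z. csqrt (of_int (4 * int M * (1 - s)) * z + 1)) f z)"

definition Q_op ::
  "nat \<Rightarrow> nat \<Rightarrow> nat \<Rightarrow> int \<Rightarrow> int \<Rightarrow> (complex \<Rightarrow> complex) \<Rightarrow> complex \<Rightarrow> complex"
where
  "Q_op k M p m n f z =
     (\<Sum>s\<in>{0..int p - 1}.
        slash k 1 (of_int (m - s))
                (of_int (4 * int (M div p))) (of_int (n * int p - 4 * int (M div p) * s))
          (\<lambda>z. csqrt (of_int (4 * int (M div p)) * z
                     + of_int (n * int p - 4 * int (M div p) * s))) f z)"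

end

theory Submission
  imports Defs
begin

text \<open>Put \<open>L = M / p\<close>.  The matrices defining \<open>Q\<close> together with the identity represent the
  cosets of \<open>\<Gamma>\<^sub>0(4M)\<close> in \<open>\<Gamma>\<^sub>0(4L)\<close>, and their theta factors are plain square roots.
  So \<open>Q + 1\<close> is the trace from level \<open>4M\<close> to level \<open>4L\<close>, while \<open>Q\<close> multiplies forms of level
  \<open>4L\<close> by \<open>p\<close>; this gives \<open>(Q - p)(Q + 1) = 0\<close>.

  The operator \<open>W\<close> is, up to a constant, \<open>f \<mapsto> \<Sum>\<^sub>t f | (1 m/p; 0 1) (1 0; 4Mt 1)\<close> with \<open>t\<close> modulo \<open>p\<close>,
  a sum over the cosets in \<open>\<Gamma>\<^sub>0(4M)\<close> of the stabiliser of \<open>f(z + m/p)\<close>.  For \<open>t \<noteq> 1\<close> the summand is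
  \<open>(mu/p) f(z + u/p)\<close> with \<open>u (1 - t) \<equiv> m\<close>, and the summand \<open>G\<close> for \<open>t = 1\<close> satisfies
  \<open>G(z + 1/p) = G(z)\<close>.  Inserting this into \<open>W\<^sup>2\<close>, all terms except a multiple of \<open>f\<close> cancel because
  \<open>\<Sum>\<^sub>u (u(u + m)/p) = -1\<close>.  The operator \<open>U\<close> for \<open>p\<^sup>2\<close> kills the twist by the quadratic character, and
  the translates of \<open>G(z/p\<^sup>2)\<close> are the summands of \<open>Q\<close>.

  That theta factors form a cocycle on \<open>\<Gamma>\<^sub>0(4)\<close> is reduced to generators, where it expresses the
  periodicity of Shimura's symbol, that is, quadratic reciprocity.\<close>

section \<open>Quadratic symbols\<close>

text \<open>Two facts carry most of the computations. Since \<open>4 * L * m\<close> is -1 modulo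
  \<open>p\<close>, a matrix of level \<open>4 * M\<close> with upper left entry \<open>a\<close>
  acts on the summands of \<open>W\<close> through an affine substitution \<open>a^2 t + e\<close>
  of the index, and \<open>a\<close> is a unit modulo \<open>p\<close>. And the exceptional summand
  is a constant times the slash of \<open>f\<close> by the matrix (n m; 4L p) of determinant 1,
  taken at \<open>p^2 z\<close>: this is why it has period 1/p, why its translates give
  \<open>Q\<close>, and where the constants come from. \<open>W_const\<close> is the inverse of
  \<open>K_const\<close>, and \<open>K_const^2 = p (-1/p)\<close> yields the power of
  \<open>p\<close> and the symbol in the relation with \<open>U\<close>. Two obstacles come from the
  definitions. The single summands of \<open>W\<close> are not modular of level
  \<open>4 * M\<close>, so the cusp condition is separated from the transformation law and shown to
  be stable under slashing by any integral matrix of positive determinant. And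
  \<open>fourier_coeffs\<close> is a definite description, while the cusp condition only gives an
  expansion in powers of exp(2 pi i z / h) with unknown \<open>h\<close>; existence and uniqueness
  of an expansion in integral powers must come before any formula for \<open>U_op\<close>.\<close>

lemma Legendre_cong: "[a = b] (mod p) \<Longrightarrow> Legendre a p = Legendre b p"
  unfolding Legendre_def QuadRes_def by (simp add: cong_def)

lemma Legendre_values: "Legendre a p \<in> {-1, 0, 1}"
  by (auto simp: Legendre_def)

text \<open>Euler's criterion gives the equation modulo \<open>p\<close>; both sides lie in {-1, 0,
  1}, so they differ by at most 2 < \<open>p\<close>.\<close>

lemma Legendre_mult:
  assumes "prime p" "2 < p"
  shows "Legendre (a * b) (int p) = Legendre a (int p) * Legendre b (int p)"
proof -
  have eu: "[Legendre x (int p) = x ^ ((p - 1) div 2)] (mod int p)" for x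
    using euler_criterion[OF assms] by simp
  have "[Legendre (a * b) (int p) = Legendre a (int p) * Legendre b (int p)] (mod int p)"
    using cong_trans[OF eu[of "a * b"]] cong_mult[OF eu[of a] eu[of b]]
    by (simp add: power_mult_distrib cong_sym)
  then have "int p dvd Legendre (a * b) (int p) - Legendre a (int p) * Legendre b (int p)"
    by (simp add: cong_iff_dvd_diff)
  moreover have "\<bar>Legendre (a * b) (int p) - Legendre a (int p) * Legendre b (int p)\<bar> < int p"
    using Legendre_values[of "a * b" "int p"] Legendre_values[of a "int p"] Legendre_values[of b "int p"] assms(2)
    by auto
  ultimately have "Legendre (a * b) (int p) - Legendre a (int p) * Legendre b (int p) = 0"
    using dvd_imp_le_int[of "Legendre (a * b) (int p) - Legendre a (int p) * Legendre b (int p)" "int p"] by linarith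
  then show ?thesis by simp
qed

text \<open>On odd integers, negative ones included, the nontrivial character modulo 4. The value at
  even integers is a default, which is why multiplicativity asks for odd arguments.\<close>

definition chi4 :: "int \<Rightarrow> int" where
  "chi4 d = (if d mod 4 = 1 then 1 else -1)"

text \<open>The sign of quadratic reciprocity. Reading it off residues modulo 4 instead of from an
  exponent gives it a meaning for negative arguments and makes its periodicity evident.\<close>

definition qr_sign :: "int \<Rightarrow> int \<Rightarrow> int" where
  "qr_sign a b = (if a mod 4 = 1 then 1 else chi4 b)"

definition chi8 :: "int \<Rightarrow> int" where
  "chi8 d = (if d mod 8 = 1 \<or> d mod 8 = 7 then 1 else -1)"

lemma odd_mod_4:
  fixes a :: int
  assumes "odd a"
  shows "a mod 4 = 1 \<or> a mod 4 = 3"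
  using assms by presburger

lemma chi4_mult: "odd a \<Longrightarrow> odd b \<Longrightarrow> chi4 (a * b) = chi4 a * chi4 b"
  using odd_mod_4[of a] odd_mod_4[of b] mod_mult_eq[of a 4 b] by (auto simp: chi4_def)

lemma qr_sign_commute: "odd a \<Longrightarrow> odd b \<Longrightarrow> qr_sign a b = qr_sign b a"
  by (auto simp: qr_sign_def chi4_def)

lemma qr_sign_mult_right: "odd a \<Longrightarrow> odd b \<Longrightarrow> qr_sign c (a * b) = qr_sign c a * qr_sign c b"
  by (auto simp: qr_sign_def chi4_mult)

lemma qr_sign_mult_left:
  "odd a \<Longrightarrow> odd b \<Longrightarrow> odd c \<Longrightarrow> qr_sign (a * b) c = qr_sign a c * qr_sign b c"
  using qr_sign_commute[of "a * b" c] qr_sign_commute[of a c] qr_sign_commute[of b c]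
  by (simp add: qr_sign_mult_right)

section \<open>The Jacobi symbol: multiplicativity, supplementary laws, reciprocity\<close>

lemma jacobi_symbol_1 [simp]: "jacobi_symbol a (Suc 0) = 1"
  by (simp add: jacobi_symbol_def)

lemma jacobi_symbol_prime: "prime q \<Longrightarrow> jacobi_symbol a q = Legendre a (int q)"
  by (simp add: jacobi_symbol_def prime_factorization_prime)

lemma jacobi_symbol_mult_right:
  "m \<noteq> 0 \<Longrightarrow> n \<noteq> 0 \<Longrightarrow> jacobi_symbol a (m * n) = jacobi_symbol a m * jacobi_symbol a n"
  by (simp add: jacobi_symbol_def prime_factorization_mult)

text \<open>Splitting off one odd prime at a time carries each law from the Legendre to the Jacobi
  symbol.\<close>

lemma odd_prime_induct [consumes 1, case_names one mult]:
  fixes n :: nat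
  assumes "odd n"
    and one: "P 1"
    and mult: "\<And>q m. prime q \<Longrightarrow> 2 < q \<Longrightarrow> odd m \<Longrightarrow> P m \<Longrightarrow> P (q * m)"
  shows "P n"
  using assms(1)
proof (induction n rule: less_induct)
  case (less n)
  show ?case
  proof (cases "n = 1")
    case True
    then show ?thesis using one by simp
  next
    case False
    then obtain q where q: "prime q" "q dvd n"
      using prime_factor_nat by blast
    then obtain m where m: "n = q * m" by auto
    from m less.prems have odd: "odd q" "odd m" by auto
    have "q > 1" using q(1) prime_gt_1_nat by blast
    with odd have "2 < q" by (cases "q = 2") auto
    moreover have "m < n" using m odd(2) \<open>q > 1\<close> by (auto elim: oddE)
    ultimately show ?thesis using mult[OF q(1) _ odd(2)] less.IH[of m] odd m by simp
  qed
qed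

lemma jacobi_symbol_cong:
  assumes "odd n" "[a = b] (mod int n)"
  shows "jacobi_symbol a n = jacobi_symbol b n"
  using assms
proof (induction n rule: odd_prime_induct)
  case one
  then show ?case by simp
next
  case (mult q m)
  have "[a = b] (mod int q)" "[a = b] (mod int m)"
    using mult.prems by (auto intro: cong_modulus_mult simp: mult.commute)
  moreover have "m \<noteq> 0" "q \<noteq> 0" using mult.hyps by (auto intro: Nat.gr0I)
  ultimately show ?case using mult Legendre_cong[of a b "int q"]
    by (simp add: jacobi_symbol_mult_right jacobi_symbol_prime)
qed

lemma jacobi_symbol_mult_left:
  assumes "odd n"
  shows "jacobi_symbol (a * b) n = jacobi_symbol a n * jacobi_symbol b n"
  using assms
proof (induction n rule: odd_prime_induct)
  case one
  then show ?case by simp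
next
  case (mult q m)
  moreover have "m \<noteq> 0" "q \<noteq> 0" using mult.hyps by (auto intro: Nat.gr0I)
  ultimately show ?case
    by (simp add: jacobi_symbol_mult_right jacobi_symbol_prime Legendre_mult)
qed

lemma one_Legendre: "1 < p \<Longrightarrow> Legendre 1 p = 1"
  by (auto simp: Legendre_def QuadRes_def cong_def intro: exI[of _ 1])

lemma jacobi_symbol_one [simp]:
  assumes "odd n"
  shows "jacobi_symbol 1 n = 1"
  using assms
proof (induction n rule: odd_prime_induct)
  case one
  then show ?case by simp
next
  case (mult q m)
  moreover have "m \<noteq> 0" "q \<noteq> 0" using mult.hyps by (auto intro: Nat.gr0I)
  ultimately show ?case
    by (simp add: jacobi_symbol_mult_right jacobi_symbol_prime one_Legendre)
qed

lemma minus_one_power_half: "odd n \<Longrightarrow> (-1::int) ^ ((n - 1) div 2) = chi4 (int n)"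
proof -
  assume "odd n"
  then have "n mod 4 = 1 \<or> n mod 4 = 3" by presburger
  then show ?thesis
  proof
    assume "n mod 4 = 1"
    then have "even ((n - 1) div 2)" "int n mod 4 = 1" by presburger+
    then show ?thesis by (simp add: chi4_def)
  next
    assume "n mod 4 = 3"
    then have "odd ((n - 1) div 2)" "int n mod 4 = 3" by presburger+
    then show ?thesis by (simp add: chi4_def)
  qed
qed

lemma minus_one_Legendre:
  assumes "prime p" "2 < p"
  shows "Legendre (-1) (int p) = chi4 (int p)"
proof -
  have "odd p" using assms prime_odd_nat by blast
  have "[Legendre (-1) (int p) = chi4 (int p)] (mod int p)"
    using euler_criterion[OF assms, of "-1"] minus_one_power_half[OF \<open>odd p\<close>] by simp
  then have "int p dvd Legendre (-1) (int p) - chi4 (int p)"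
    by (simp add: cong_iff_dvd_diff)
  moreover have "\<bar>Legendre (-1) (int p) - chi4 (int p)\<bar> < int p"
    using Legendre_values[of "-1" "int p"] assms(2) by (auto simp: chi4_def)
  ultimately have "Legendre (-1) (int p) - chi4 (int p) = 0"
    using dvd_imp_le_int[of "Legendre (-1) (int p) - chi4 (int p)" "int p"] by linarith
  then show ?thesis by simp
qed

lemma jacobi_symbol_minus_one:
  assumes "odd n"
  shows "jacobi_symbol (-1) n = chi4 (int n)"
  using assms
proof (induction n rule: odd_prime_induct)
  case one
  then show ?case by (simp add: chi4_def)
next
  case (mult q m)
  moreover have "m \<noteq> 0" "q \<noteq> 0" using mult.hyps by (auto intro: Nat.gr0I)
  moreover have "odd q" using mult.hyps prime_odd_nat by blast
  ultimately show ?case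
    by (simp add: jacobi_symbol_mult_right jacobi_symbol_prime minus_one_Legendre chi4_mult)
qed

lemma Legendre_self: "Legendre p p = 0"
  by (simp add: Legendre_def cong_def)

lemma Legendre_square: "\<not> [a = 0] (mod p) \<Longrightarrow> Legendre a p * Legendre a p = 1"
  by (simp add: Legendre_def)

text \<open>The product form is solved for one symbol by multiplying with the square of the other,
  which is 1. For \<open>p = q\<close> both symbols vanish; admitting this case spares the Jacobi
  version any coprimality assumption.\<close>

lemma Legendre_reciprocity:
  assumes "prime p" "2 < p" "prime q" "2 < q"
  shows "Legendre (int p) (int q) = Legendre (int q) (int p) * qr_sign (int p) (int q)"
proof (cases "p = q")
  case True
  then show ?thesis by (simp add: Legendre_self)
next
  case False
  have odd: "odd p" "odd q" using assms prime_odd_nat by blast+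
  have *: "Legendre (int p) (int q) * Legendre (int q) (int p) = qr_sign (int p) (int q)"
  proof -
    have "(-1::int) ^ ((p - 1) div 2 * ((q - 1) div 2)) = chi4 (int p) ^ ((q - 1) div 2)"
      using minus_one_power_half[OF odd(1)] by (simp add: power_mult)
    also have "\<dots> = qr_sign (int p) (int q)"
      using minus_one_power_half[OF odd(2)] odd_mod_4[of "int p"] odd(1)
      by (auto simp: chi4_def qr_sign_def)
    finally show ?thesis using Quadratic_Reciprocity[OF assms False] by simp
  qed
  have "\<not> p dvd q" using assms(1,3) False by (meson primes_dvd_imp_eq)
  then have "\<not> [int q = 0] (mod int p)" by (simp add: cong_0_iff)
  then have "Legendre (int q) (int p) * Legendre (int q) (int p) = 1"
    by (rule Legendre_square)
  then have "Legendre (int p) (int q) = Legendre (int p) (int q) * (Legendre (int q) (int p) * Legendre (int q) (int p))"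
    by simp
  also have "\<dots> = (Legendre (int p) (int q) * Legendre (int q) (int p)) * Legendre (int q) (int p)"
    by (simp only: mult.assoc)
  also have "\<dots> = Legendre (int q) (int p) * qr_sign (int p) (int q)"
    using * by simp
  finally show ?thesis .
qed

lemma jacobi_symbol_reciprocity_prime:
  assumes "odd n" "prime q" "2 < q"
  shows "jacobi_symbol (int q) n = Legendre (int n) (int q) * qr_sign (int q) (int n)"
  using assms
proof (induction n rule: odd_prime_induct)
  case one
  then show ?case by (simp add: one_Legendre qr_sign_def chi4_def)
next
  case (mult r m)
  moreover have "m \<noteq> 0" "r \<noteq> 0" using mult.hyps by (auto intro: Nat.gr0I)
  moreover have "odd r" using mult.hyps prime_odd_nat by blast
  ultimately show ?case
    by (simp add: jacobi_symbol_mult_right jacobi_symbol_prime Legendre_mult qr_sign_mult_right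
        Legendre_reciprocity[of q r])
qed

text \<open>Two nested inductions on prime factors: the preceding lemma decomposes the denominator
  for a prime numerator, this one decomposes the numerator.\<close>

lemma jacobi_symbol_reciprocity:
  assumes "odd m" "odd n"
  shows "jacobi_symbol (int m) n = jacobi_symbol (int n) m * qr_sign (int m) (int n)"
  using assms
proof (induction m rule: odd_prime_induct)
  case one
  then show ?case by (simp add: qr_sign_def)
next
  case (mult q m)
  moreover have "m \<noteq> 0" "q \<noteq> 0" using mult.hyps by (auto intro: Nat.gr0I)
  moreover have "odd q" using mult.hyps prime_odd_nat by blast
  ultimately show ?case
    by (simp add: jacobi_symbol_mult_right jacobi_symbol_mult_left jacobi_symbol_prime
        qr_sign_mult_left jacobi_symbol_reciprocity_prime)
qed

text \<open>Since \<open>2 \<equiv> -(n - 2)\<close> modulo \<open>n\<close> and \<open>n \<equiv> 2\<close> modulo \<open>n - 2\<close>, reciprocity for the pair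
  \<open>n - 2\<close>, \<open>n\<close> reduces the symbol \<open>(2/n)\<close> to \<open>(2/(n - 2))\<close>.\<close>

lemma jacobi_symbol_two: "jacobi_symbol 2 (2 * j + 1) = chi8 (2 * int j + 1)"
proof (induction j)
  case 0
  then show ?case by (simp add: chi8_def)
next
  case (Suc j)
  define n where "n = 2 * j + 3"
  define l where "l = 2 * j + 1"
  have odd: "odd n" "odd l" by (auto simp: n_def l_def)
  have "jacobi_symbol 2 n = jacobi_symbol (-1 * int l) n"
    using odd by (intro jacobi_symbol_cong) (simp_all add: n_def l_def cong_iff_dvd_diff add.commute)
  also have "\<dots> = chi4 n * (jacobi_symbol n l * qr_sign l n)"
    using jacobi_symbol_mult_left[OF odd(1), of "-1" "int l"] jacobi_symbol_minus_one[OF odd(1)]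
      jacobi_symbol_reciprocity[OF odd(2,1)] by simp
  also have "jacobi_symbol n l = jacobi_symbol 2 l"
    by (rule jacobi_symbol_cong) (auto simp: n_def l_def cong_iff_dvd_diff)
  also have "\<dots> = chi8 l" using Suc.IH by (simp add: l_def add.commute)
  also have "qr_sign l n = 1"
  proof -
    have "int l mod 4 = 1 \<or> int n mod 4 = 1" unfolding l_def n_def by presburger
    then show ?thesis by (auto simp: qr_sign_def chi4_def)
  qed
  also have "chi4 n * (chi8 l * 1) = chi8 n"
  proof -
    have "int j mod 4 = 0 \<or> int j mod 4 = 1 \<or> int j mod 4 = 2 \<or> int j mod 4 = 3" by presburger
    then show ?thesis
    proof (elim disjE)
      assume "int j mod 4 = 0"
      then have "int n mod 4 = 3" "int n mod 8 = 3" "int l mod 8 = 1"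
        unfolding l_def n_def by presburger+
      then show ?thesis by (simp add: chi4_def chi8_def)
    next
      assume "int j mod 4 = 1"
      then have "int n mod 4 = 1" "int n mod 8 = 5" "int l mod 8 = 3"
        unfolding l_def n_def by presburger+
      then show ?thesis by (simp add: chi4_def chi8_def)
    next
      assume "int j mod 4 = 2"
      then have "int n mod 4 = 3" "int n mod 8 = 7" "int l mod 8 = 5"
        unfolding l_def n_def by presburger+
      then show ?thesis by (simp add: chi4_def chi8_def)
    next
      assume "int j mod 4 = 3"
      then have "int n mod 4 = 1" "int n mod 8 = 1" "int l mod 8 = 7"
        unfolding l_def n_def by presburger+
      then show ?thesis by (simp add: chi4_def chi8_def)
    qed
  qed
  finally show ?case by (simp add: n_def eval_nat_numeral algebra_simps)
qed

section \<open>Shimura's symbol and its periodicity in the lower argument\<close>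

lemma odd_nat_abs: "odd d \<Longrightarrow> odd (nat \<bar>d\<bar>)" for d :: int
  by (simp add: even_nat_iff)

lemma shimura_symbol_mult:
  assumes "odd d" "c \<noteq> 0" "c' \<noteq> 0"
  shows "shimura_symbol (c * c') d = shimura_symbol c d * shimura_symbol c' d"
proof -
  have "odd (nat \<bar>d\<bar>)" using assms(1) odd_nat_abs by blast
  then have "jacobi_symbol (c * c') (nat \<bar>d\<bar>) = jacobi_symbol c (nat \<bar>d\<bar>) * jacobi_symbol c' (nat \<bar>d\<bar>)"
    by (rule jacobi_symbol_mult_left)
  then show ?thesis using assms unfolding shimura_symbol_def
    by (cases "d < 0"; cases "c < 0"; cases "c' < 0") (simp_all add: mult_less_0_iff)
qed

text \<open>For \<open>d < 0\<close> the Jacobi symbol gives \<open>chi4 (- d) = - chi4 d\<close>,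
  and the extra sign in Shimura's definition corrects exactly this.\<close>

lemma shimura_symbol_minus_one:
  assumes "odd d"
  shows "shimura_symbol (-1) d = chi4 d"
proof -
  have "odd (nat \<bar>d\<bar>)" using assms odd_nat_abs by blast
  then have "jacobi_symbol (-1) (nat \<bar>d\<bar>) = chi4 \<bar>d\<bar>"
    by (simp add: jacobi_symbol_minus_one)
  moreover have "(-d) mod 4 = 1 \<longleftrightarrow> d mod 4 \<noteq> 1" using assms by presburger
  ultimately show ?thesis
    by (auto simp: shimura_symbol_def chi4_def)
qed

lemma shimura_symbol_two:
  assumes "odd d"
  shows "shimura_symbol 2 d = chi8 d"
proof -
  have "odd (nat \<bar>d\<bar>)" using assms odd_nat_abs by blast
  then obtain j where j: "nat \<bar>d\<bar> = 2 * j + 1" by (rule oddE)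
  have "2 * int j + 1 = \<bar>d\<bar>" using j by linarith
  moreover have "chi8 \<bar>d\<bar> = chi8 d"
  proof (cases "d \<ge> 0")
    case False
    have "((-d) mod 8 = 1 \<or> (-d) mod 8 = 7) \<longleftrightarrow> (d mod 8 = 1 \<or> d mod 8 = 7)" by presburger
    with False show ?thesis by (simp add: chi8_def)
  qed simp
  ultimately show ?thesis using jacobi_symbol_two[of j] j by (simp add: shimura_symbol_def)
qed

lemma shimura_symbol_one:
  assumes "odd d"
  shows "shimura_symbol 1 d = 1"
proof -
  have "odd (nat \<bar>d\<bar>)" using assms odd_nat_abs by blast
  then show ?thesis by (simp add: shimura_symbol_def)
qed

text \<open>Reciprocity moves \<open>d\<close> into the numerator, where it matters only modulo
  \<open>c\<close>, while the sign sees it modulo 4. For negative \<open>d\<close> the factor (-1/c)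
  = \<open>chi4 c\<close> is absorbed in passing from \<open>qr_sign c (- d)\<close> to
  \<open>qr_sign c d\<close>.\<close>

lemma shimura_symbol_odd_pos:
  assumes "odd d" "odd c" "c > 0"
  shows "shimura_symbol c d = jacobi_symbol d (nat c) * qr_sign c d"
proof -
  have odd: "odd (nat \<bar>d\<bar>)" "odd (nat c)" using assms by (simp_all add: even_nat_iff)
  have *: "shimura_symbol c d = jacobi_symbol \<bar>d\<bar> (nat c) * qr_sign c (abs d)"
    using jacobi_symbol_reciprocity[OF odd(2,1)] assms by (simp add: shimura_symbol_def)
  show ?thesis
  proof (cases "d \<ge> 0")
    case True
    then show ?thesis using * by simp
  next
    case False
    have "jacobi_symbol \<bar>d\<bar> (nat c) = jacobi_symbol (-1 * d) (nat c)" using False by simp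
    also have "\<dots> = chi4 c * jacobi_symbol d (nat c)"
      using jacobi_symbol_mult_left[OF odd(2), of "-1" d] jacobi_symbol_minus_one[OF odd(2)] assms by simp
    finally have "shimura_symbol c d = jacobi_symbol d (nat c) * (chi4 c * qr_sign c (- d))"
      using * False by simp
    also have "chi4 c * qr_sign c (- d) = qr_sign c d"
    proof -
      have "(-d) mod 4 = 1 \<longleftrightarrow> d mod 4 \<noteq> 1" using assms by presburger
      then show ?thesis by (auto simp: qr_sign_def chi4_def)
    qed
    finally show ?thesis .
  qed
qed

lemma shimura_symbol_two_power: "odd d \<Longrightarrow> shimura_symbol (2 ^ a) d = chi8 d ^ a"
  by (induction a) (simp_all add: shimura_symbol_mult shimura_symbol_two shimura_symbol_one)

lemma int_two_power_decomp:
  fixes c :: int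
  assumes "c \<noteq> 0"
  obtains a u where "c = 2 ^ a * u" "odd u"
proof -
  have "\<not> is_unit (2::int)" by simp
  with assms show ?thesis using multiplicity_decompose'[of c 2] that by blast
qed

lemma shimura_symbol_odd_cong:
  assumes "odd d" "odd u" "[d = d'] (mod 4 * u)"
  shows "shimura_symbol u d = shimura_symbol u d'"
proof -
  define w where "w = \<bar>u\<bar>"
  have w: "odd w" "w > 0" using assms(2) by (auto simp: w_def)
  have 4: "[d = d'] (mod 4)" and u: "[d = d'] (mod u)"
    using assms(3) by (auto intro: cong_modulus_mult simp: mult.commute)
  then have m4: "d mod 4 = d' mod 4" by (simp add: cong_def)
  have d': "odd d'" using m4 assms(1) by presburger
  have "[d = d'] (mod int (nat w))" using u w by (simp add: w_def cong_iff_dvd_diff)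
  then have "jacobi_symbol d (nat w) = jacobi_symbol d' (nat w)"
    using w by (intro jacobi_symbol_cong) (auto simp: even_nat_iff)
  then have pos: "shimura_symbol w d = shimura_symbol w d'"
    using shimura_symbol_odd_pos w assms(1) d' m4 by (simp add: qr_sign_def chi4_def)
  show ?thesis
  proof (cases "u > 0")
    case True
    then show ?thesis using pos by (simp add: w_def)
  next
    case False
    then have "u = -1 * w" using w_def by simp
    then show ?thesis
      using pos w shimura_symbol_mult[OF assms(1), of "-1" w] shimura_symbol_mult[OF d', of "-1" w]
        shimura_symbol_minus_one[OF assms(1)] shimura_symbol_minus_one[OF d'] m4
      by (simp add: chi4_def)
  qed
qed

text \<open>Write \<open>c = 2 ^ a * u\<close> with \<open>u\<close> odd. As 4 divides
  \<open>c\<close>, congruence modulo \<open>4 * u\<close> is available, which settles (u/d). The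
  factor (2/d)^a is 1 for even \<open>a\<close>; for odd \<open>a\<close> one has
  \<open>a \<ge> 3\<close>, so 8 divides \<open>c\<close> and (2/d) is unchanged as well.\<close>

lemma shimura_symbol_cong:
  assumes "odd d" "4 dvd c" "[d = d'] (mod c)"
  shows "shimura_symbol c d = shimura_symbol c d'"
proof (cases "c = 0")
  case True
  then show ?thesis using assms by (simp add: cong_def)
next
  case False
  then obtain a u where au: "c = 2 ^ a * u" "odd u" by (rule int_two_power_decomp)
  have "a \<ge> 2"
  proof (rule ccontr)
    assume "\<not> a \<ge> 2"
    then have "a = 0 \<or> a = 1" by auto
    then have "c = u \<or> c = 2 * u" using au by auto
    then show False using assms(2) au(2) by presburger
  qed
  then obtain b where b: "a = b + 2" by (metis add.commute le_Suc_ex)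
  have "odd d'"
  proof -
    have "even c" using assms(2) by auto
    then have "even (d - d')" using assms(3) by (meson cong_iff_dvd_diff dvd_trans)
    then show ?thesis using assms(1) by simp
  qed
  have "u \<noteq> 0" using au by auto
  have "4 * u dvd c" using au b by (simp add: power_add mult.commute)
  then have "[d = d'] (mod 4 * u)" using assms(3) by (meson cong_iff_dvd_diff dvd_trans)
  then have 1: "shimura_symbol u d = shimura_symbol u d'"
    using assms(1) au(2) by (intro shimura_symbol_odd_cong)
  have 2: "chi8 d ^ a = chi8 d' ^ a"
  proof (cases "even a")
    case True
    then show ?thesis by (auto simp: chi8_def)
  next
    case False
    then have "a \<ge> 3" using \<open>a \<ge> 2\<close> by presburger
    then obtain e where e: "a = e + 3" by (metis add.commute le_Suc_ex)
    then have "8 dvd c" using au by (simp add: power_add)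
    then have "[d = d'] (mod 8)" using assms(3) by (meson cong_iff_dvd_diff dvd_trans)
    then show ?thesis by (simp add: chi8_def cong_def)
  qed
  show ?thesis
    using au \<open>u \<noteq> 0\<close> 1 2 assms(1) \<open>odd d'\<close>
    by (simp add: shimura_symbol_mult shimura_symbol_two_power)
qed

lemma shimura_symbol_prime:
  assumes "odd d" "prime p" "2 < p"
  shows "shimura_symbol (int p) d = Legendre d (int p) * qr_sign (int p) d"
  using shimura_symbol_odd_pos[of d "int p"] assms prime_odd_nat[of p]
  by (simp add: jacobi_symbol_prime prime_gt_0_nat)

lemma jacobi_symbol_nonzero:
  assumes "odd n" "coprime a (int n)"
  shows "jacobi_symbol a n \<noteq> 0"
  using assms
proof (induction n rule: odd_prime_induct)
  case one
  then show ?case by simp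
next
  case (mult q m)
  moreover have "m \<noteq> 0" "q \<noteq> 0" using mult.hyps by (auto intro: Nat.gr0I)
  moreover have "\<not> int q dvd a"
  proof
    assume "int q dvd a"
    then have "is_unit (int q)" using mult.prems by (intro coprime_common_divisor[of a "int (q * m)"]) auto
    then show False using mult.hyps(2) by simp
  qed
  ultimately show ?case
    by (auto simp: jacobi_symbol_mult_right jacobi_symbol_prime Legendre_def cong_0_iff)
qed

lemma shimura_symbol_nonzero:
  assumes "odd d" "coprime c d"
  shows "shimura_symbol c d \<noteq> 0"
proof -
  have "jacobi_symbol c (nat \<bar>d\<bar>) \<noteq> 0"
    using assms by (intro jacobi_symbol_nonzero odd_nat_abs) auto
  then show ?thesis unfolding shimura_symbol_def by presburger
qed

section \<open>The theta multiplier\<close>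

lemma moebius_compose:
  assumes "of_real c' * z + of_real d' \<noteq> (0::complex)"
  shows "moebius a b c d (moebius a' b' c' d' z)
    = moebius (a * a' + b * c') (a * b' + b * d') (c * a' + d * c') (c * b' + d * d') z"
proof -
  let ?u = "of_real a' * z + of_real b'" and ?v = "of_real c' * z + of_real d'"
  have "x * (u / v) + y = (x * u + y * v) / v" if "v \<noteq> 0" for x y u v :: complex
    using that by (simp add: field_simps)
  note * = this[OF assms]
  have "moebius a b c d (moebius a' b' c' d' z)
    = (of_real a * ?u + of_real b * ?v) / (of_real c * ?u + of_real d * ?v)"
    using assms unfolding moebius_def * by simp
  then show ?thesis by (simp add: moebius_def algebra_simps)
qed

lemma moebius_denominator_nonzero:
  assumes "Im z > 0" "c \<noteq> 0 \<or> d \<noteq> 0"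
  shows "of_real c * z + of_real d \<noteq> (0::complex)"
  using assms by (auto simp: complex_eq_iff)

lemma moebius_denominator:
  assumes "of_real c' * z + of_real d' \<noteq> (0::complex)"
  shows "(of_real c * moebius a' b' c' d' z + of_real d) * (of_real c' * z + of_real d')
    = of_real (c * a' + d * c') * z + of_real (c * b' + d * d')"
  using assms by (simp add: moebius_def field_simps)

lemma Im_moebius_pos:
  assumes "Im z > 0" "a * d - b * c > 0"
  shows "Im (moebius a b c d z) > 0"
proof -
  have nz: "of_real c * z + of_real d \<noteq> (0::complex)"
    using assms by (intro moebius_denominator_nonzero) auto
  have "Im (moebius a b c d z)
    = (a * d - b * c) * Im z / ((Re (of_real c * z + of_real d))\<^sup>2 + (Im (of_real c * z + of_real d))\<^sup>2)"
    unfolding moebius_def Im_divide by (simp add: algebra_simps)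
  moreover have "(Re (of_real c * z + of_real d))\<^sup>2 + (Im (of_real c * z + of_real d))\<^sup>2 > 0"
    using nz by (simp only: complex_neq_0)
  ultimately show ?thesis using assms by simp
qed

lemma Im_moebius_pos_det_1:
  fixes a b c d :: int
  assumes "Im z > 0" "a * d - b * c = 1"
  shows "Im (moebius a b c d z) > 0"
proof -
  have "real_of_int a * real_of_int d - real_of_int b * real_of_int c = 1"
    using assms(2) by (simp flip: of_int_mult of_int_diff)
  then show ?thesis using assms(1) by (intro Im_moebius_pos) auto
qed

section \<open>Branches of the square root in the upper and lower half plane\<close>

lemma Im_csqrt_square: "Im y = 2 * Re (csqrt y) * Im (csqrt y)"
  using arg_cong[OF power2_csqrt[of y], of Im] by (simp only: Im_power2)

lemma csqrt_upper_half_plane: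
  assumes "Im y > 0"
  shows "Re (csqrt y) > 0" "Im (csqrt y) > 0"
proof -
  have "Re (csqrt y) * Im (csqrt y) > 0" using Im_csqrt_square[of y] assms by linarith
  with csqrt_principal[of y] show "Re (csqrt y) > 0" "Im (csqrt y) > 0"
    unfolding zero_less_mult_iff by linarith+
qed

lemma csqrt_lower_half_plane:
  assumes "Im y < 0"
  shows "Re (csqrt y) > 0" "Im (csqrt y) < 0"
proof -
  have "Re (csqrt y) * Im (csqrt y) < 0" using Im_csqrt_square[of y] assms by linarith
  with csqrt_principal[of y] show "Re (csqrt y) > 0" "Im (csqrt y) < 0"
    unfolding mult_less_0_iff by linarith+
qed

lemma csqrt_uminus_upper: "Im w > 0 \<Longrightarrow> csqrt (- w) = - \<i> * csqrt w"
  using csqrt_upper_half_plane[of w]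
  by (intro csqrt_unique) (simp_all add: power_mult_distrib del: csqrt.simps)

lemma csqrt_uminus_lower: "Im w < 0 \<Longrightarrow> csqrt (- w) = \<i> * csqrt w"
  using csqrt_lower_half_plane[of w]
  by (intro csqrt_unique) (simp_all add: power_mult_distrib del: csqrt.simps)

text \<open>Both sides have the same square, so only a sign is at stake. \<open>Y\<close> lies in
  the open first quadrant. For \<open>c < 0\<close>, \<open>X\<close> lies in the fourth, so
  \<open>X * Y\<close> has positive real part and is the principal root. For
  \<open>c \<ge> 0\<close>, \<open>X\<close> lies in the closed first quadrant, \<open>X * Y\<close>
  has positive imaginary part, and its real part has the sign of \<open>c + 4 * d\<close>. The
  exceptional case has \<open>d < 0\<close> and is the one in which Shimura's symbol acquires its
  extra sign.\<close>

lemma csqrt_denominator_shift: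
  assumes z: "Im z > 0" and cd: "c \<noteq> 0 \<or> d \<noteq> 0"
  defines "X \<equiv> csqrt (of_int c * moebius 1 0 4 1 z + of_int d)"
    and "Y \<equiv> csqrt (4 * z + 1)"
  shows "csqrt (of_int (c + 4 * d) * z + of_int d) = (if c \<ge> 0 \<and> c + 4 * d < 0 then - 1 else 1) * (X * Y)"
proof -
  have nz: "4 * z + 1 \<noteq> 0" using z by (auto simp: complex_eq_iff)
  have w: "Im (moebius 1 0 4 1 z) > 0" using z by (intro Im_moebius_pos) auto
  have XY: "(X * Y)\<^sup>2 = of_int (c + 4 * d) * z + of_int d"
    using nz by (simp add: X_def Y_def power_mult_distrib moebius_def field_simps)
  have Y: "Re Y > 0" "Im Y > 0" using z csqrt_upper_half_plane[of "4 * z + 1"] unfolding Y_def by simp_all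
  show ?thesis
  proof (cases "c < 0")
    case True
    then have "Im (of_int c * moebius 1 0 4 1 z + of_int d) < 0"
      using w by (simp add: mult_less_0_iff)
    then have "Re X > 0" "Im X < 0" unfolding X_def by (rule csqrt_lower_half_plane)+
    then have "Re X * Re Y > 0" "Im X * Im Y < 0"
      using Y by (auto intro: mult_pos_pos mult_neg_pos)
    then have "Re (X * Y) > 0" by simp
    then have "csqrt (of_int (c + 4 * d) * z + of_int d) = X * Y"
      using XY by (intro csqrt_unique) auto
    then show ?thesis using True by simp
  next
    case False
    have "X \<noteq> 0" using moebius_denominator_nonzero[of "moebius 1 0 4 1 z" c d] w cd
      by (simp add: X_def)
    moreover have "Re X \<ge> 0 \<and> Im X \<ge> 0"
    proof (cases "c = 0")
      case True
      then have "X = (if d \<ge> 0 then of_real (sqrt (of_int d)) else \<i> * of_real (sqrt (- of_int d)))"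
        using csqrt_of_real_nonneg[of "of_int d"] csqrt_of_real_nonpos[of "of_int d"]
        by (auto simp: X_def)
      then show ?thesis by (auto split: if_splits)
    next
      case c: False
      then have "Im (of_int c * moebius 1 0 4 1 z + of_int d) > 0"
        using w False by simp
      then show ?thesis unfolding X_def using csqrt_upper_half_plane less_imp_le by blast
    qed
    ultimately have "Re X > 0 \<and> Im X \<ge> 0 \<or> Re X \<ge> 0 \<and> Im X > 0"
      by (auto simp: complex_eq_iff)
    then have "Im (X * Y) > 0" using Y
      by (auto intro: add_pos_nonneg add_nonneg_pos)
    moreover have "2 * Re (X * Y) * Im (X * Y) = of_int (c + 4 * d) * Im z"
      using arg_cong[OF XY, of Im] unfolding Im_power2 by simp
    ultimately have sgn: "Re (X * Y) < 0 \<longleftrightarrow> c + 4 * d < 0"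
    proof -
      assume im: "Im (X * Y) > 0" and eq: "2 * Re (X * Y) * Im (X * Y) = of_int (c + 4 * d) * Im z"
      have "Re (X * Y) < 0 \<longleftrightarrow> 2 * Re (X * Y) * Im (X * Y) < 0"
        unfolding mult_less_0_iff using im by auto
      also have "\<dots> \<longleftrightarrow> real_of_int (c + 4 * d) < 0"
        unfolding eq mult_less_0_iff using z by auto
      finally show ?thesis by (simp only: of_int_less_0_iff)
    qed
    show ?thesis
    proof (cases "c + 4 * d < 0")
      case True
      then have "Re (X * Y) < 0" using sgn by blast
      then have "csqrt (of_int (c + 4 * d) * z + of_int d) = - (X * Y)"
        using XY by (intro csqrt_unique) auto
      then show ?thesis using True False by simp
    next
      case nonneg: False
      then have "Re (X * Y) \<ge> 0" using sgn by simp
      then have "csqrt (of_int (c + 4 * d) * z + of_int d) = X * Y"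
        using XY \<open>Im (X * Y) > 0\<close> by (intro csqrt_unique) auto
      then show ?thesis using nonneg by simp
    qed
  qed
qed

section \<open>Lower rows of Gamma_0(4) and the cocycle law for theta factors\<close>

lemma coprime_if_bezout:
  fixes x y :: int
  assumes "u * x + v * y = 1"
  shows "coprime x y"
proof (rule coprimeI)
  fix e assume "e dvd x" "e dvd y"
  then have "e dvd u * x + v * y" by simp
  then show "is_unit e" using assms by simp
qed

text \<open>These are the lower rows of matrices in Gamma_0(4). The theta factor depends on the
  lower row alone, so the left matrix of the cocycle law can be replaced by its row.\<close>

definition theta_row :: "int \<Rightarrow> int \<Rightarrow> bool" where
  "theta_row c d \<longleftrightarrow> 4 dvd c \<and> coprime c d"

lemma theta_row_odd: "theta_row c d \<Longrightarrow> odd d"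
proof
  assume c: "theta_row c d" and "even d"
  then have "even c" unfolding theta_row_def by auto
  then show False using c \<open>even d\<close> coprime_common_divisor[of c d 2] by (simp add: theta_row_def)
qed

lemma theta_row_nonzero: "theta_row c d \<Longrightarrow> c \<noteq> 0 \<or> d \<noteq> 0"
  using theta_row_odd by auto

lemma theta_row_mult:
  assumes "theta_row c d" "theta_row c' d'" "a' * d' - b' * c' = 1"
  shows "theta_row (c * a' + d * c') (c * b' + d * d')"
proof -
  obtain u v where uv: "u * c + v * d = 1"
    using assms(1) bezout_int[of c d] by (auto simp: theta_row_def)
  \<comment> \<open>The Bezout coefficients of the new row are the inverse matrix applied to the
    column (u, v).\<close>
  have "(u * d' - v * b') * (c * a' + d * c') + (v * a' - u * c') * (c * b' + d * d')
    = (u * c + v * d) * (a' * d' - b' * c')" by (simp add: algebra_simps)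
  then have "(u * d' - v * b') * (c * a' + d * c') + (v * a' - u * c') * (c * b' + d * d') = 1"
    using uv assms(3) by simp
  then have "coprime (c * a' + d * c') (c * b' + d * d')"
    by (rule coprime_if_bezout)
  then show ?thesis using assms by (simp add: theta_row_def)
qed

lemma theta_row_det: "4 dvd c \<Longrightarrow> a * d - b * c = 1 \<Longrightarrow> theta_row c d"
  unfolding theta_row_def using coprime_if_bezout[of "-b" c a d] by simp

lemma theta_factor_nonzero:
  assumes "Im z > 0" "theta_row c d"
  shows "theta_factor c d z \<noteq> 0"
  using moebius_denominator_nonzero[of z c d] theta_row_nonzero[OF assms(2)] assms
    shimura_symbol_nonzero[OF theta_row_odd[OF assms(2)]]
  by (auto simp: theta_factor_def eps_def theta_row_def)

lemma theta_factor_0_1 [simp]: "theta_factor 0 1 z = 1"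
  by (simp add: theta_factor_def eps_def shimura_symbol_def cong_def)

lemma theta_factor_0_minus_1 [simp]: "theta_factor 0 (-1) z = 1"
  by (simp add: theta_factor_def eps_def shimura_symbol_def cong_def)

lemma eps_cong: "[d = d'] (mod 4) \<Longrightarrow> eps d = eps d'"
  by (simp add: eps_def cong_def)

lemma theta_factor_shift:
  assumes "theta_row c d"
  shows "theta_factor c (d + c * b) z = theta_factor c d (z + of_int b)"
proof -
  have "shimura_symbol c d = shimura_symbol c (d + c * b)"
    using theta_row_odd[OF assms] assms
    by (intro shimura_symbol_cong) (auto simp: theta_row_def cong_iff_dvd_diff)
  moreover have "eps d = eps (d + c * b)"
    using assms by (intro eps_cong) (auto simp: theta_row_def cong_iff_dvd_diff)
  ultimately show ?thesis by (simp add: theta_factor_def algebra_simps)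
qed

text \<open>The Jacobi symbol is unchanged, as \<open>c + 4 * d\<close> and \<open>c\<close> agree
  modulo \<open>d\<close>; the sign rule for negative arguments flips exactly when the square root
  changes sign in \<open>csqrt_denominator_shift\<close>, so the two signs cancel.\<close>

lemma theta_factor_lower:
  assumes "theta_row c d" "Im z > 0"
  shows "theta_factor (c + 4 * d) d z = theta_factor c d (moebius 1 0 4 1 z) * theta_factor 4 1 z"
proof -
  let ?\<sigma> = "if c \<ge> 0 \<and> c + 4 * d < 0 then - 1 else 1"
  have "jacobi_symbol (c + 4 * d) (nat \<bar>d\<bar>) = jacobi_symbol c (nat \<bar>d\<bar>)"
    using theta_row_odd[OF assms(1)] odd_nat_abs
    by (intro jacobi_symbol_cong) (auto simp: cong_iff_dvd_diff)
  then have "shimura_symbol (c + 4 * d) d = ?\<sigma> * shimura_symbol c d"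
    unfolding shimura_symbol_def by (cases "d < 0") auto
  moreover have "theta_factor 4 1 z = csqrt (4 * z + 1)"
    by (simp add: theta_factor_def eps_def shimura_symbol_def)
  ultimately show ?thesis
    using csqrt_denominator_shift[OF assms(2) theta_row_nonzero[OF assms(1)]]
    by (simp add: theta_factor_def)
qed

text \<open>Negating the row changes \<open>eps\<close>, the symbol and the branch of the root by
  fourth roots of unity whose product is 1. For \<open>c = 0\<close> the row is (0, 1) or (0, -1),
  and both factors are 1.\<close>

lemma theta_factor_uminus:
  assumes "theta_row c d" "Im z > 0"
  shows "theta_factor (- c) (- d) z = theta_factor c d z"
proof (cases "c = 0")
  case True
  then have "d = 1 \<or> d = -1" using assms(1) by (auto simp: theta_row_def)
  then show ?thesis using True by auto
next
  case False
  have odd: "odd d" by (rule theta_row_odd[OF assms(1)])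
  have d4: "d mod 4 = 1 \<or> d mod 4 = 3" using odd by (rule odd_mod_4)
  have "shimura_symbol (- c) (- d) = chi4 (- d) * shimura_symbol c (- d)"
    using shimura_symbol_mult[of "-d" "-1" c] shimura_symbol_minus_one[of "-d"] odd False by simp
  also have "shimura_symbol c (- d) = (if c < 0 then - 1 else 1) * shimura_symbol c d"
    using odd by (auto simp: shimura_symbol_def)
  finally have sh: "shimura_symbol (- c) (- d) = chi4 (- d) * ((if c < 0 then - 1 else 1) * shimura_symbol c d)" .
  have "csqrt (- (of_int c * z + of_int d)) = (if c < 0 then \<i> else - \<i>) * csqrt (of_int c * z + of_int d)"
    using False assms(2) csqrt_uminus_upper[of "of_int c * z + of_int d"]
      csqrt_uminus_lower[of "of_int c * z + of_int d"]
    by (auto simp: mult_less_0_iff)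
  then have sq: "csqrt (of_int (- c) * z + of_int (- d)) = (if c < 0 then \<i> else - \<i>) * csqrt (of_int c * z + of_int d)"
    by (simp add: algebra_simps)
  have "(-d) mod 4 = 1 \<longleftrightarrow> d mod 4 = 3" "(-d) mod 4 = 3 \<longleftrightarrow> d mod 4 = 1" by presburger+
  then show ?thesis unfolding theta_factor_def sh sq
    using d4 by (auto simp: eps_def cong_def chi4_def)
qed

text \<open>Fixing the right matrix and quantifying over all rows on its left makes the cocycle law
  a property of a single matrix, which can then be propagated along a word in generators.\<close>

definition theta_cocycle_at :: "int \<Rightarrow> int \<Rightarrow> int \<Rightarrow> int \<Rightarrow> bool" where
  "theta_cocycle_at a b c d \<longleftrightarrow> (\<forall>c\<^sub>0 d\<^sub>0 z. theta_row c\<^sub>0 d\<^sub>0 \<longrightarrow> Im z > 0 \<longrightarrow>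
     theta_factor (c\<^sub>0 * a + d\<^sub>0 * c) (c\<^sub>0 * b + d\<^sub>0 * d) z
       = theta_factor c\<^sub>0 d\<^sub>0 (moebius a b c d z) * theta_factor c d z)"

lemma theta_cocycle_at_translation: "theta_cocycle_at 1 b 0 1"
  using theta_factor_shift by (auto simp: theta_cocycle_at_def moebius_def add.commute)

lemma theta_cocycle_at_neg_translation: "theta_cocycle_at (-1) b 0 (-1)"
  unfolding theta_cocycle_at_def
proof (intro allI impI)
  fix c d z assume *: "theta_row c d" "Im z > 0"
  have row: "theta_row c (d + c * (-b))"
    using theta_row_mult[OF *(1), of 0 1 1 "-b"] by (simp add: theta_row_def add.commute)
  have "theta_factor (c * - 1 + d * 0) (c * b + d * - 1) z = theta_factor (- c) (- (d + c * (-b))) z"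
    by (simp add: algebra_simps)
  also have "\<dots> = theta_factor c (d + c * (-b)) z"
    using row *(2) by (rule theta_factor_uminus)
  also have "\<dots> = theta_factor c d (moebius (of_int (-1)) (of_int b) (of_int 0) (of_int (-1)) z)"
    using theta_factor_shift[OF *(1), of "-b" z] by (simp add: moebius_def algebra_simps)
  finally show "theta_factor (c * - 1 + d * 0) (c * b + d * - 1) z =
    theta_factor c d (moebius (of_int (-1)) (of_int b) (of_int 0) (of_int (-1)) z) * theta_factor 0 (-1) z"
    by simp
qed

lemma theta_cocycle_at_lower: "theta_cocycle_at 1 0 4 1"
  using theta_factor_lower by (auto simp: theta_cocycle_at_def mult.commute)

text \<open>With \<open>w\<close> the image of \<open>z\<close>, \<open>theta_factor_lower\<close>
  at \<open>w\<close> applies to the rows (c - 4d, d) and (-4, 1); eliminating the common factor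
  \<open>theta_factor 4 1 w\<close> gives the law.\<close>

lemma theta_cocycle_at_lower_inverse: "theta_cocycle_at 1 0 (-4) 1"
  unfolding theta_cocycle_at_def
proof (intro allI impI)
  fix c d z assume *: "theta_row c d" "Im z > 0"
  define w where "w = moebius 1 0 (-4) 1 z"
  have w: "Im w > 0" unfolding w_def using *(2) by (intro Im_moebius_pos) auto
  have "of_real (-4) * z + of_real 1 \<noteq> (0::complex)"
    using *(2) by (intro moebius_denominator_nonzero) auto
  from moebius_compose[OF this, of 1 0 4 1 1 0] have z: "moebius 1 0 4 1 w = z"
    by (simp add: w_def moebius_def)
  have row: "theta_row (c - 4 * d) d"
    using theta_row_mult[OF *(1), of "-4" 1 1 0] by (simp add: theta_row_def mult.commute)
  have "theta_factor c d w = theta_factor (c - 4 * d) d z * theta_factor 4 1 w"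
    using theta_factor_lower[OF row w] z by simp
  moreover have "1 = theta_factor (-4) 1 z * theta_factor 4 1 w"
    using theta_factor_lower[of "-4" 1 w] w z by (simp add: theta_row_def)
  ultimately have "theta_factor (c - 4 * d) d z = theta_factor c d w * theta_factor (-4) 1 z"
    by (metis mult.assoc mult.commute mult.right_neutral)
  then show "theta_factor (c * 1 + d * - 4) (c * 0 + d * 1) z =
    theta_factor c d (moebius (of_int 1) (of_int 0) (of_int (-4)) (of_int 1) z) * theta_factor (-4) 1 z"
    by (simp add: w_def mult.commute)
qed

lemma moebius_compose_int:
  fixes a b c d a' b' c' d' :: int
  assumes "Im z > 0" "c' \<noteq> 0 \<or> d' \<noteq> 0"
  shows "moebius a b c d (moebius a' b' c' d' z)
    = moebius (of_int (a * a' + b * c')) (of_int (a * b' + b * d'))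
        (of_int (c * a' + d * c')) (of_int (c * b' + d * d')) z"
proof -
  have "of_real (of_int c') * z + of_real (of_int d') \<noteq> (0::complex)"
    using assms by (intro moebius_denominator_nonzero) auto
  from moebius_compose[OF this] show ?thesis by simp
qed

text \<open>Evaluate at the point \<open>z\<close> that the right matrix sends to \<open>w\<close>,
  expand the product in two ways, and cancel the nonzero theta factor of the right matrix. This is
  the step by which the Euclidean descent returns from the shorter row to the longer one.\<close>

lemma theta_cocycle_at_cancel:
  assumes \<beta>\<gamma>: "theta_cocycle_at (a * a' + b * c') (a * b' + b * d') (c * a' + d * c') (c * b' + d * d')"
    and \<gamma>: "theta_cocycle_at a' b' c' d'" "4 dvd c'" "a' * d' - b' * c' = 1"
    and \<beta>: "4 dvd c" "a * d - b * c = 1"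
  shows "theta_cocycle_at a b c d"
  unfolding theta_cocycle_at_def
proof (intro allI impI)
  fix c\<^sub>0 d\<^sub>0 w assume row: "theta_row c\<^sub>0 d\<^sub>0" and w: "Im w > 0"
  define z where "z = moebius d' (-b') (-c') a' w"
  have z: "Im z > 0" unfolding z_def
    using Im_moebius_pos_det_1[OF w, of d' a' "-b'" "-c'"] \<gamma>(3) by (simp add: mult.commute)
  have "- c' \<noteq> 0 \<or> a' \<noteq> 0" using \<gamma>(3) by auto
  from moebius_compose_int[OF w this, of a' b' c' d' d' "-b'"] \<gamma>(3)
  have "moebius a' b' c' d' z = moebius (of_int 1) (of_int 0) (of_int 0) (of_int 1) w"
    by (simp add: z_def algebra_simps)
  then have wz: "w = moebius a' b' c' d' z" by (simp add: moebius_def)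
  have \<gamma>row: "theta_row c' d'" using \<gamma>(2,3) by (rule theta_row_det)
  have \<beta>row: "theta_row c d" using \<beta> by (rule theta_row_det)
  have row': "theta_row (c\<^sub>0 * a + d\<^sub>0 * c) (c\<^sub>0 * b + d\<^sub>0 * d)"
    using row \<beta>row \<beta>(2) by (rule theta_row_mult)
  have "theta_factor (c\<^sub>0 * a + d\<^sub>0 * c) (c\<^sub>0 * b + d\<^sub>0 * d) w * theta_factor c' d' z
    = theta_factor ((c\<^sub>0 * a + d\<^sub>0 * c) * a' + (c\<^sub>0 * b + d\<^sub>0 * d) * c')
        ((c\<^sub>0 * a + d\<^sub>0 * c) * b' + (c\<^sub>0 * b + d\<^sub>0 * d) * d') z"
    using \<gamma>(1) row' z wz by (simp add: theta_cocycle_at_def)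
  also have "\<dots> = theta_factor (c\<^sub>0 * (a * a' + b * c') + d\<^sub>0 * (c * a' + d * c'))
        (c\<^sub>0 * (a * b' + b * d') + d\<^sub>0 * (c * b' + d * d')) z"
    by (simp add: algebra_simps)
  also have "\<dots> = theta_factor c\<^sub>0 d\<^sub>0 (moebius a b c d w) * theta_factor (c * a' + d * c') (c * b' + d * d') z"
    using \<beta>\<gamma> row z theta_row_nonzero[OF \<gamma>row]
    unfolding theta_cocycle_at_def wz by (simp add: moebius_compose_int)
  also have "theta_factor (c * a' + d * c') (c * b' + d * d') z = theta_factor c d w * theta_factor c' d' z"
    using \<gamma>(1) \<beta>row z wz by (simp add: theta_cocycle_at_def)
  finally show "theta_factor (c\<^sub>0 * a + d\<^sub>0 * c) (c\<^sub>0 * b + d\<^sub>0 * d) w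
    = theta_factor c\<^sub>0 d\<^sub>0 (moebius a b c d w) * theta_factor c d w"
    using theta_factor_nonzero[OF z \<gamma>row] by simp
qed

text \<open>Right multiplication by \<open>(1 e; 0 1)\<close> and \<open>(1 0; 4e 1)\<close>, with \<open>e = \<plusminus>1\<close>, runs the Euclidean
  algorithm on \<open>(c, d)\<close>.  It never gets stuck with \<open>\<bar>c\<bar> = 2\<bar>d\<bar>\<close>, as \<open>c\<close> is divisible by \<open>4\<close> and
  \<open>d\<close> is odd.\<close>

lemma theta_cocycle_at_all:
  assumes "4 dvd c" "a * d - b * c = 1"
  shows "theta_cocycle_at a b c d"
  using assms
proof (induction "nat (\<bar>c\<bar> + \<bar>d\<bar>)" arbitrary: a b c d rule: less_induct)
  case less
  have row: "theta_row c d" using less.prems by (rule theta_row_det)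
  have odd: "odd d" using row by (rule theta_row_odd)
  consider "c = 0" | "c \<noteq> 0" "\<bar>c\<bar> < 2 * \<bar>d\<bar>" | "\<bar>c\<bar> > 2 * \<bar>d\<bar>"
  proof -
    have "\<bar>c\<bar> \<noteq> 2 * \<bar>d\<bar>"
    proof
      assume "\<bar>c\<bar> = 2 * \<bar>d\<bar>"
      then have "c = 2 * d \<or> c = - (2 * d)" by linarith
      then show False using less.prems(1) odd by presburger
    qed
    then show thesis using that by linarith
  qed
  then show ?case
  proof cases
    case 1
    then have "a * d = 1" using less.prems by simp
    then have "a = 1 \<and> d = 1 \<or> a = -1 \<and> d = -1" by (simp add: zmult_eq_1_iff)
    then show ?thesis
      using 1 theta_cocycle_at_translation theta_cocycle_at_neg_translation by auto
  next
    case 2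
    define e where "e = (if c * d > 0 then - 1 else 1 :: int)"
    have "\<bar>d + e * c\<bar> < \<bar>d\<bar>"
      using 2 unfolding e_def zero_less_mult_iff by (auto simp: abs_if split: if_splits)
    then have "theta_cocycle_at (a * 1 + b * 0) (a * e + b * 1) (c * 1 + d * 0) (c * e + d * 1)"
      using less.prems by (intro less.hyps) (auto simp: algebra_simps)
    then show ?thesis
      by (rule theta_cocycle_at_cancel) (use less.prems theta_cocycle_at_translation in auto)
  next
    case 3
    define e where "e = (if c * d > 0 then - 4 else 4 :: int)"
    have "d \<noteq> 0" using odd by auto
    then have "\<bar>c + e * d\<bar> < \<bar>c\<bar>"
      using 3 unfolding e_def zero_less_mult_iff by (auto simp: abs_if split: if_splits)
    then have "theta_cocycle_at (a * 1 + b * e) (a * 0 + b * 1) (c * 1 + d * e) (c * 0 + d * 1)"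
      using less.prems by (intro less.hyps) (auto simp: algebra_simps e_def)
    then show ?thesis
      by (rule theta_cocycle_at_cancel)
        (use less.prems theta_cocycle_at_lower theta_cocycle_at_lower_inverse in \<open>auto simp: e_def\<close>)
  qed
qed

theorem theta_factor_cocycle:
  assumes "theta_row c d" "4 dvd c'" "a' * d' - b' * c' = 1" "Im z > 0"
  shows "theta_factor (c * a' + d * c') (c * b' + d * d') z
    = theta_factor c d (moebius a' b' c' d' z) * theta_factor c' d' z"
  using theta_cocycle_at_all[OF assms(2,3)] assms(1,4) by (simp add: theta_cocycle_at_def)

section \<open>Behaviour at the cusps\<close>

lemma cuspidal_at_infinity_cong:
  assumes "\<And>z. Im z > 0 \<Longrightarrow> g z = g' z" "cuspidal_at_infinity g"
  shows "cuspidal_at_infinity g'"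
proof -
  obtain h a where "h > 0" "a 0 = 0"
    "\<forall>z\<in>uhp. (\<lambda>n. a n * exp (2 * of_real pi * \<i> * of_nat n * z / of_nat h)) sums g z"
    using assms(2) unfolding cuspidal_at_infinity_def by blast
  then show ?thesis using assms(1) unfolding cuspidal_at_infinity_def
    by (intro exI[of _ h] conjI exI[of _ a]) auto
qed

lemma cuspidal_at_infinity_affine:
  assumes g: "cuspidal_at_infinity g" and "A > 0" "D > 0"
  shows "cuspidal_at_infinity (\<lambda>z. g ((of_nat A * z + of_int B) / of_nat D))"
proof -
  obtain h a where ha: "h > 0" "a 0 = 0"
    "\<And>z. Im z > 0 \<Longrightarrow> (\<lambda>n. a n * exp (2 * of_real pi * \<i> * of_nat n * z / of_nat h)) sums g z"
    using g unfolding cuspidal_at_infinity_def by blast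
  \<comment> \<open>The substitution turns width \<open>h\<close> into \<open>h * D\<close> and
    moves the \<open>n\<close>-th term to index \<open>A * n\<close>; the translation by
    \<open>B\<close> contributes a root of unity to the coefficient.\<close>
  define a' where "a' n = (if A dvd n then a (n div A) *
    exp (2 * of_real pi * \<i> * of_nat (n div A) * of_int B / of_nat (h * D)) else 0)" for n
  have "(\<lambda>n. a' n * exp (2 * of_real pi * \<i> * of_nat n * z / of_nat (h * D)))
      sums g ((of_nat A * z + of_int B) / of_nat D)" if z: "Im z > 0" for z
  proof -
    define w where "w = (of_nat A * z + of_int B) / (of_nat D :: complex)"
    have "Im w = real A * Im z / real D"
      unfolding w_def by (simp add: Im_divide_of_nat)
    then have "Im w > 0" using z assms by simp
    then have "(\<lambda>n. a n * exp (2 * of_real pi * \<i> * of_nat n * w / of_nat h)) sums g w"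
      by (rule ha(3))
    moreover have "a n * exp (2 * of_real pi * \<i> * of_nat n * w / of_nat h)
      = a' (A * n) * exp (2 * of_real pi * \<i> * of_nat (A * n) * z / of_nat (h * D))" for n
    proof -
      have "2 * of_real pi * \<i> * of_nat n * w / of_nat h
        = 2 * of_real pi * \<i> * of_nat n * of_int B / of_nat (h * D)
          + 2 * of_real pi * \<i> * of_nat (A * n) * z / of_nat (h * D)"
        using ha(1) assms(3) by (simp add: w_def field_simps)
      then show ?thesis using assms(2) by (simp add: a'_def exp_add)
    qed
    ultimately have "(\<lambda>n. a' (A * n) * exp (2 * of_real pi * \<i> * of_nat (A * n) * z / of_nat (h * D)))
      sums g w" by simp
    moreover have "strict_mono (\<lambda>n. A * n)" using assms(2) by (simp add: strict_mono_def)
    moreover have "a' n = 0" if "n \<notin> range (\<lambda>n. A * n)" for n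
      using that by (auto simp: a'_def dvd_def)
    ultimately show ?thesis unfolding w_def
      by (subst (asm) sums_mono_reindex[of "\<lambda>n. A * n"]) auto
  qed
  moreover have "a' 0 = 0" using ha(2) by (simp add: a'_def)
  moreover have "h * D > 0" using ha(1) assms(3) by simp
  ultimately show ?thesis unfolding cuspidal_at_infinity_def by blast
qed

lemma cuspidal_at_infinity_cmult:
  assumes "cuspidal_at_infinity g"
  shows "cuspidal_at_infinity (\<lambda>z. t * g z)"
proof -
  obtain h a where ha: "h > 0" "a 0 = 0"
    "\<And>z. Im z > 0 \<Longrightarrow> (\<lambda>n. a n * exp (2 * of_real pi * \<i> * of_nat n * z / of_nat h)) sums g z"
    using assms unfolding cuspidal_at_infinity_def by blast
  have "\<forall>z\<in>uhp. (\<lambda>n. (t * a n) * exp (2 * of_real pi * \<i> * of_nat n * z / of_nat h)) sums (t * g z)"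
    using sums_mult[OF ha(3), of _ t] by (simp add: mult.assoc)
  then show ?thesis using ha(1,2) unfolding cuspidal_at_infinity_def
    by (intro exI[of _ h] conjI exI[of _ "\<lambda>n. t * a n"]) auto
qed

text \<open>Spreading the coefficients over the multiples of \<open>l\<close> allows two expansions
  of different widths to be brought to a common width and added.\<close>

lemma cuspidal_at_infinity_refine:
  assumes h: "h > 0" "a 0 = 0"
    "\<And>z. Im z > 0 \<Longrightarrow> (\<lambda>n. a n * exp (2 * of_real pi * \<i> * of_nat n * z / of_nat h)) sums g z"
    and l: "l > (0 :: nat)"
  shows "\<exists>b. b 0 = 0 \<and>
    (\<forall>z\<in>uhp. (\<lambda>n. b n * exp (2 * of_real pi * \<i> * of_nat n * z / of_nat (h * l))) sums g z)"
proof -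
  define b where "b n = (if l dvd n then a (n div l) else 0)" for n
  have "(\<lambda>n. b n * exp (2 * of_real pi * \<i> * of_nat n * z / of_nat (h * l))) sums g z" if z: "Im z > 0" for z
  proof -
    have "(\<lambda>n. b (l * n) * exp (2 * of_real pi * \<i> * of_nat (l * n) * z / of_nat (h * l))) sums g z"
      using h(3)[OF z] l h(1) by (simp add: b_def field_simps)
    moreover have "strict_mono (\<lambda>n. l * n)" using l by (simp add: strict_mono_def)
    moreover have "b n = 0" if "n \<notin> range (\<lambda>n. l * n)" for n
      using that by (auto simp: b_def dvd_def)
    ultimately show ?thesis
      by (subst (asm) sums_mono_reindex[of "\<lambda>n. l * n"]) auto
  qed
  moreover have "b 0 = 0" using h(2) by (simp add: b_def)
  ultimately show ?thesis by auto
qed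

lemma cuspidal_at_infinity_add:
  assumes "cuspidal_at_infinity g" "cuspidal_at_infinity g'"
  shows "cuspidal_at_infinity (\<lambda>z. g z + g' z)"
proof -
  obtain h a where ha: "h > 0" "a 0 = 0"
    "\<And>z. Im z > 0 \<Longrightarrow> (\<lambda>n. a n * exp (2 * of_real pi * \<i> * of_nat n * z / of_nat h)) sums g z"
    using assms(1) unfolding cuspidal_at_infinity_def by blast
  obtain h' a' where ha': "h' > 0" "a' 0 = 0"
    "\<And>z. Im z > 0 \<Longrightarrow> (\<lambda>n. a' n * exp (2 * of_real pi * \<i> * of_nat n * z / of_nat h')) sums g' z"
    using assms(2) unfolding cuspidal_at_infinity_def by blast
  obtain b where b: "b 0 = 0"
    "\<And>z. Im z > 0 \<Longrightarrow> (\<lambda>n. b n * exp (2 * of_real pi * \<i> * of_nat n * z / of_nat (h * h'))) sums g z"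
    using cuspidal_at_infinity_refine[OF ha ha'(1)] by auto
  obtain b' where b': "b' 0 = 0"
    "\<And>z. Im z > 0 \<Longrightarrow> (\<lambda>n. b' n * exp (2 * of_real pi * \<i> * of_nat n * z / of_nat (h' * h))) sums g' z"
    using cuspidal_at_infinity_refine[OF ha' ha(1)] by auto
  have "\<forall>z\<in>uhp. (\<lambda>n. (b n + b' n) * exp (2 * of_real pi * \<i> * of_nat n * z / of_nat (h * h'))) sums (g z + g' z)"
    using sums_add[OF b(2) b'(2)] by (simp add: distrib_right mult.commute[of h'])
  then show ?thesis using ha(1) ha'(1) b(1) b'(1) unfolding cuspidal_at_infinity_def
    by (intro exI[of _ "h * h'"] conjI exI[of _ "\<lambda>n. b n + b' n"]) auto
qed

lemma connected_upper_half_plane: "connected uhp"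
  by (intro convex_connected) (simp add: convex_halfspace_Im_gt)

text \<open>Automorphy factors are compared up to a constant only, so that the branch of \<open>csqrt\<close> of a
  product or a composition never has to be computed.\<close>

lemma continuous_square_roots_proportional:
  fixes u v :: "complex \<Rightarrow> complex"
  assumes "continuous_on uhp u" "continuous_on uhp v"
    and "\<And>z. Im z > 0 \<Longrightarrow> u z ^ 2 = t * v z ^ 2" "\<And>z. Im z > 0 \<Longrightarrow> v z \<noteq> 0"
  obtains s where "s ^ 2 = t" "\<And>z. Im z > 0 \<Longrightarrow> u z = s * v z"
proof -
  have sq: "(u z / v z) ^ 2 = t" if "Im z > 0" for z
    using assms(3,4)[OF that] by (simp add: power_divide)
  have "continuous_on uhp (\<lambda>z. u z / v z)"
    using assms by (intro continuous_on_divide) auto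
  moreover have "u z / v z \<in> {csqrt t, - csqrt t}" if "Im z > 0" for z
    using sq[OF that] power2_csqrt[of t] by (metis insertCI power2_eq_iff)
  then have "(\<lambda>z. u z / v z) ` uhp \<subseteq> {csqrt t, - csqrt t}" by auto
  then have "finite ((\<lambda>z. u z / v z) ` uhp)" by (rule finite_subset) simp
  ultimately have "(\<lambda>z. u z / v z) constant_on uhp"
    using connected_upper_half_plane continuous_finite_range_constant by blast
  then obtain s where s: "\<And>z. Im z > 0 \<Longrightarrow> u z / v z = s"
    unfolding constant_on_def by auto
  show thesis
  proof
    show "s ^ 2 = t" using sq[of \<i>] s[of \<i>] by simp
    show "u z = s * v z" if "Im z > 0" for z
      using s[OF that] assms(4)[OF that] by (simp add: field_simps)
  qed
qed

lemma holomorphic_csqrt_denominator: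
  "(\<lambda>z. csqrt (of_real c * z + of_real d)) holomorphic_on uhp"
proof (cases "c = 0")
  case False
  have "of_real c * z + of_real d \<notin> \<real>\<^sub>\<le>\<^sub>0" if "Im z > 0" for z
    using that False by (auto simp: complex_nonpos_Reals_iff)
  then show ?thesis by (intro holomorphic_on_csqrt' holomorphic_intros) auto
qed simp

lemma holomorphic_moebius:
  assumes "a * d - b * c > 0"
  shows "moebius a b c d holomorphic_on uhp"
proof -
  have "of_real c * z + of_real d \<noteq> (0::complex)" if "Im z > 0" for z
    using that assms by (intro moebius_denominator_nonzero) auto
  then show ?thesis unfolding moebius_def by (intro holomorphic_intros) auto
qed

text \<open>The part of the definition of a cusp form that does not mention a level. It survives
  translation by m/p, which modularity of level \<open>4 * M\<close> does not.\<close>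

definition cuspidal_everywhere :: "nat \<Rightarrow> (complex \<Rightarrow> complex) \<Rightarrow> bool" where
  "cuspidal_everywhere k f \<longleftrightarrow> f holomorphic_on uhp \<and>
     (\<forall>a b c d :: int. a * d - b * c = 1 \<longrightarrow>
        cuspidal_at_infinity (slash k a b c d (\<lambda>z. csqrt (of_int c * z + of_int d)) f))"

lemma cusp_forms_iff:
  "f \<in> cusp_forms k N \<longleftrightarrow> cuspidal_everywhere k f \<and>
     (\<forall>a b c d :: int. a * d - b * c = 1 \<and> int N dvd c \<longrightarrow>
        (\<forall>z\<in>uhp. f (moebius a b c d z) = theta_factor c d z ^ (2 * k + 1) * f z))"
  unfolding cusp_forms_def cuspidal_everywhere_def by blast

lemma cuspidal_everywhere_cong:
  assumes "\<And>z. Im z > 0 \<Longrightarrow> f z = g z" "cuspidal_everywhere k f"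
  shows "cuspidal_everywhere k g"
  unfolding cuspidal_everywhere_def
proof (intro conjI allI impI)
  show "g holomorphic_on uhp"
    using assms holomorphic_cong[of uhp uhp f g] by (auto simp: cuspidal_everywhere_def)
next
  fix a b c d :: int assume det: "a * d - b * c = 1"
  show "cuspidal_at_infinity (slash k a b c d (\<lambda>z. csqrt (of_int c * z + of_int d)) g)"
  proof (rule cuspidal_at_infinity_cong)
    show "cuspidal_at_infinity (slash k a b c d (\<lambda>z. csqrt (of_int c * z + of_int d)) f)"
      using assms(2) det by (simp add: cuspidal_everywhere_def)
  qed (use assms(1) Im_moebius_pos_det_1[OF _ det] in \<open>simp add: slash_def\<close>)
qed

lemma cuspidal_everywhere_add:
  assumes "cuspidal_everywhere k f" "cuspidal_everywhere k g"
  shows "cuspidal_everywhere k (\<lambda>z. f z + g z)"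
proof -
  have "slash k a b c d \<phi> (\<lambda>z. f z + g z) = (\<lambda>z. slash k a b c d \<phi> f z + slash k a b c d \<phi> g z)"
    for a b c d \<phi> by (simp add: slash_def add_divide_distrib fun_eq_iff)
  then show ?thesis using assms unfolding cuspidal_everywhere_def
    by (auto intro!: holomorphic_intros cuspidal_at_infinity_add)
qed

lemma cuspidal_everywhere_cmult:
  assumes "cuspidal_everywhere k f"
  shows "cuspidal_everywhere k (\<lambda>z. t * f z)"
proof -
  have "slash k a b c d \<phi> (\<lambda>z. t * f z) = (\<lambda>z. t * slash k a b c d \<phi> f z)"
    for a b c d \<phi> by (simp add: slash_def fun_eq_iff)
  then show ?thesis using assms unfolding cuspidal_everywhere_def
    by (auto intro!: holomorphic_intros cuspidal_at_infinity_cmult)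
qed

lemma cuspidal_everywhere_sum:
  assumes "finite I" "I \<noteq> {}" "\<And>i. i \<in> I \<Longrightarrow> cuspidal_everywhere k (f i)"
  shows "cuspidal_everywhere k (\<lambda>z. \<Sum>i\<in>I. f i z)"
  using assms by (induction I rule: finite_ne_induct) (auto intro: cuspidal_everywhere_add)

text \<open>The first column divided by its gcd is completed to a matrix of determinant 1 by Bezout
  coefficients; multiplying by the inverse of that matrix leaves an upper triangular one.\<close>

lemma int_matrix_upper_triangular:
  fixes A B C D :: int
  assumes det: "A * D - B * C > 0"
  obtains a b c d x y z where "a * d - b * c = 1" "x > 0" "z > 0"
    "A = a * x" "C = c * x" "B = a * y + b * z" "D = c * y + d * z"
proof -
  define x where "x = gcd A C"
  have "A \<noteq> 0 \<or> C \<noteq> 0" using det by auto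
  then have x: "x > 0" by (auto simp: x_def)
  obtain a where a: "A = a * x" using gcd_dvd1[of A C] by (auto simp: x_def dvd_def mult.commute)
  obtain c where c: "C = c * x" using gcd_dvd2[of A C] by (auto simp: x_def dvd_def mult.commute)
  obtain u v where "u * A + v * C = x" using bezout_int[of A C] by (auto simp: x_def)
  then have "(u * a + v * c) * x = 1 * x" using a c by (simp add: algebra_simps)
  then have uv: "u * a + v * c = 1" using x by simp
  define z where "z = a * D - c * B"
  have "x * z = A * D - B * C" unfolding z_def by (simp add: a c algebra_simps)
  then have z: "z > 0" using det x by (metis zero_less_mult_pos)
  define y where "y = u * B + v * D"
  have "a * y + (- v) * z = B * (u * a + v * c)" "c * y + u * z = D * (u * a + v * c)"
    by (simp_all add: y_def z_def algebra_simps)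
  then have "B = a * y + (- v) * z" "D = c * y + u * z" using uv by simp_all
  moreover have "a * u - (- v) * c = 1" using uv by (simp add: algebra_simps)
  ultimately show thesis using that a c x z by blast
qed

text \<open>By the triangular decomposition the slash is, up to a constant, an affine substitution
  in the expansion of \<open>f\<close> at another cusp. The factor \<open>u\<close> is known only
  through its square, so it is compared with the standard root by continuity and not by computing
  branches.\<close>

lemma cuspidal_at_infinity_slash:
  fixes A B C D :: int
  assumes f: "cuspidal_everywhere k f" and det: "A * D - B * C > 0"
    and u: "continuous_on uhp u" "t \<noteq> 0" "\<And>z. Im z > 0 \<Longrightarrow> u z ^ 2 = t * (of_int C * z + of_int D)"
  shows "cuspidal_at_infinity (slash k A B C D u f)"
proof -
  obtain a b c d x y w where m: "a * d - b * c = 1" "x > 0" "w > 0"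
    "A = a * x" "C = c * x" "B = a * y + b * w" "D = c * y + d * w"
    using int_matrix_upper_triangular[OF det] .
  define g where "g = slash k a b c d (\<lambda>z. csqrt (of_int c * z + of_int d)) f"
  have g: "cuspidal_at_infinity g" using f m(1) by (simp add: g_def cuspidal_everywhere_def)
  define \<tau> :: "complex \<Rightarrow> complex" where "\<tau> z = (of_nat (nat x) * z + of_int y) / of_nat (nat w)" for z
  have \<tau>: "\<tau> z = moebius (of_int x) (of_int y) (of_int 0) (of_int w) z" for z
    using m by (simp add: \<tau>_def moebius_def)
  have Im\<tau>: "Im (\<tau> z) > 0" if "Im z > 0" for z
    unfolding \<tau> using that m by (intro Im_moebius_pos) auto
  have cusp: "cuspidal_at_infinity (\<lambda>z. g (\<tau> z))"
    unfolding \<tau>_def using g m by (intro cuspidal_at_infinity_affine) auto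
  define v where "v z = csqrt (of_int c * \<tau> z + of_int d)" for z
  have w0: "w \<noteq> 0" using m by simp
  have cont_\<tau>: "continuous_on uhp \<tau>" unfolding \<tau>_def by (intro continuous_intros) (use m in auto)
  have "continuous_on uhp (\<lambda>z. csqrt (of_int c * z + of_int d))"
    using holomorphic_on_imp_continuous_on[OF holomorphic_csqrt_denominator[of "of_int c" "of_int d"]]
    by simp
  from continuous_on_compose2[OF this cont_\<tau>] have "continuous_on uhp v"
    unfolding v_def using Im\<tau> by auto
  moreover have vsq: "v z ^ 2 = (of_int C * z + of_int D) / of_int w" for z
    using w0 m unfolding v_def \<tau>_def by (simp add: field_simps)
  have "u z ^ 2 = (t * of_int w) * v z ^ 2" if "Im z > 0" for z
    using u(3)[OF that] w0 by (simp add: vsq)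
  moreover have "v z \<noteq> 0" if "Im z > 0" for z
  proof -
    have "of_real (of_int c) * \<tau> z + of_real (of_int d) \<noteq> 0"
      using Im\<tau>[OF that] m(1) by (intro moebius_denominator_nonzero) auto
    then show ?thesis by (simp add: v_def)
  qed
  ultimately obtain s where s: "s ^ 2 = t * of_int w" "\<And>z. Im z > 0 \<Longrightarrow> u z = s * v z"
    using continuous_square_roots_proportional[OF u(1)] by metis
  show ?thesis
  proof (rule cuspidal_at_infinity_cong)
    show "cuspidal_at_infinity (\<lambda>z. inverse s ^ (2 * k + 1) * g (\<tau> z))"
      using cusp by (rule cuspidal_at_infinity_cmult)
  next
    fix z :: complex assume z: "Im z > 0"
    have "moebius a b c d (\<tau> z) = moebius A B C D z"
      unfolding \<tau> using moebius_compose_int[OF z, of 0 w a b c d x y] m by simp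
    then show "inverse s ^ (2 * k + 1) * g (\<tau> z) = slash k A B C D u f z"
      using s(2)[OF z]
      by (simp add: g_def slash_def v_def power_mult_distrib divide_inverse power_inverse mult_ac)
  qed
qed

text \<open>A further slash by a matrix of determinant 1 amounts to one slash by the product matrix:
  \<open>v\<close> is again a continuous root of a multiple of the new denominator, so the previous
  lemma applies at every cusp.\<close>

lemma cuspidal_everywhere_slash:
  fixes A B C D :: int
  assumes f: "cuspidal_everywhere k f" and det: "A * D - B * C > 0"
    and u: "u holomorphic_on uhp" "t \<noteq> 0" "\<And>z. Im z > 0 \<Longrightarrow> u z ^ 2 = t * (of_int C * z + of_int D)"
  shows "cuspidal_everywhere k (slash k A B C D u f)"
  unfolding cuspidal_everywhere_def
proof (intro conjI allI impI)
  have det': "real_of_int A * real_of_int D - real_of_int B * real_of_int C > 0"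
    using det by (simp flip: of_int_mult of_int_diff)
  have "u z \<noteq> 0" if "Im z > 0" for z
  proof
    assume "u z = 0"
    then have "of_real (of_int C) * z + of_real (of_int D) = 0"
      using u(3)[OF that] u(2) by simp
    moreover have "C \<noteq> 0 \<or> D \<noteq> 0" using det by auto
    ultimately show False using moebius_denominator_nonzero[OF that, of "of_int C" "of_int D"] by simp
  qed
  moreover have "(\<lambda>z. f (moebius A B C D z)) holomorphic_on uhp"
    using holomorphic_on_compose_gen[OF holomorphic_moebius[OF det'], of f uhp] f Im_moebius_pos[OF _ det']
    by (auto simp: cuspidal_everywhere_def o_def)
  ultimately show "slash k A B C D u f holomorphic_on uhp"
    unfolding slash_def using u(1) by (intro holomorphic_intros) auto
next
  fix a b c d :: int assume det1: "a * d - b * c = 1"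
  define \<psi> where "\<psi> z = csqrt (of_int c * z + of_int d)" for z
  define v where "v z = u (moebius a b c d z) * \<psi> z" for z
  have det1': "real_of_int a * real_of_int d - real_of_int b * real_of_int c > 0"
    using det1 by (simp flip: of_int_mult of_int_diff)
  have \<psi>: "continuous_on uhp \<psi>"
    using holomorphic_on_imp_continuous_on[OF holomorphic_csqrt_denominator[of "of_int c" "of_int d"]]
    by (simp add: \<psi>_def[abs_def])
  have "continuous_on uhp (\<lambda>z. u (moebius a b c d z))"
    using holomorphic_on_imp_continuous_on[OF u(1)]
      holomorphic_on_imp_continuous_on[OF holomorphic_moebius[OF det1']]
    by (rule continuous_on_compose2) (use Im_moebius_pos[OF _ det1'] in auto)
  then have "continuous_on uhp v" using \<psi> unfolding v_def by (intro continuous_on_mult)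
  moreover have "v z ^ 2 = t * (of_int (C * a + D * c) * z + of_int (C * b + D * d))" if z: "Im z > 0" for z
  proof -
    have "of_real (of_int c) * z + of_real (of_int d) \<noteq> (0::complex)"
      using z det1 by (intro moebius_denominator_nonzero) auto
    from moebius_denominator[OF this, of "of_int C" "of_int a" "of_int b" "of_int D"]
    show ?thesis
      using u(3)[OF Im_moebius_pos_det_1[OF z det1]]
      by (simp add: v_def \<psi>_def power_mult_distrib)
  qed
  moreover have "(A * a + B * c) * (C * b + D * d) - (A * b + B * d) * (C * a + D * c) > 0"
  proof -
    have "(A * a + B * c) * (C * b + D * d) - (A * b + B * d) * (C * a + D * c)
      = (A * D - B * C) * (a * d - b * c)" by (simp add: algebra_simps)
    then show ?thesis using det det1 by simp
  qed
  ultimately have "cuspidal_at_infinity (slash k (of_int (A * a + B * c)) (of_int (A * b + B * d))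
     (of_int (C * a + D * c)) (of_int (C * b + D * d)) v f)"
    using f u(2) by (intro cuspidal_at_infinity_slash) auto
  then show "cuspidal_at_infinity (slash k a b c d (\<lambda>z. csqrt (of_int c * z + of_int d)) (slash k A B C D u f))"
  proof (rule cuspidal_at_infinity_cong[rotated])
    fix z :: complex assume z: "Im z > 0"
    have "c \<noteq> 0 \<or> d \<noteq> 0" using det1 by auto
    from moebius_compose_int[OF z this, of A B C D a b]
    show "slash k (of_int (A * a + B * c)) (of_int (A * b + B * d))
     (of_int (C * a + D * c)) (of_int (C * b + D * d)) v f z
      = slash k a b c d (\<lambda>z. csqrt (of_int c * z + of_int d)) (slash k A B C D u f) z"
      by (simp add: slash_def v_def \<psi>_def power_mult_distrib mult_ac)
  qed
qed

section \<open>The operator \<open>Q\<close> and the trace\<close>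

text \<open>With Shimura's own factor, slashing is a right action of Gamma_0(4), by the cocycle law,
  and cusp forms of level \<open>N\<close> are fixed by Gamma_0(N).\<close>

definition theta_slash :: "nat \<Rightarrow> int \<Rightarrow> int \<Rightarrow> int \<Rightarrow> int \<Rightarrow> (complex \<Rightarrow> complex) \<Rightarrow> complex \<Rightarrow> complex" where
  "theta_slash k a b c d = slash k a b c d (theta_factor c d)"

lemma theta_slash_id [simp]: "theta_slash k 1 0 0 1 f z = f z"
  by (simp add: theta_slash_def slash_def moebius_def)

lemma theta_slash_comp:
  assumes "theta_row c d" "4 dvd c'" "a' * d' - b' * c' = 1" "Im z > 0"
  shows "theta_slash k a' b' c' d' (theta_slash k a b c d f) z
    = theta_slash k (a * a' + b * c') (a * b' + b * d') (c * a' + d * c') (c * b' + d * d') f z"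
proof -
  have "c' \<noteq> 0 \<or> d' \<noteq> 0" using assms(3) by auto
  from moebius_compose_int[OF assms(4) this, of a b c d a' b'] theta_factor_cocycle[OF assms]
  show ?thesis by (simp add: theta_slash_def slash_def power_mult_distrib mult.commute)
qed

lemma theta_slash_add: "theta_slash k a b c d (\<lambda>z. f z + g z) z = theta_slash k a b c d f z + theta_slash k a b c d g z"
  by (simp add: theta_slash_def slash_def add_divide_distrib)

lemma theta_slash_cusp_form:
  assumes "f \<in> cusp_forms k N" "4 dvd N" "int N dvd c" "a * d - b * c = 1" "Im z > 0"
  shows "theta_slash k a b c d f z = f z"
proof -
  have "4 dvd c" using assms(2,3) by (metis dvd_trans int_dvd_int_iff of_nat_numeral)
  then have "theta_factor c d z \<noteq> 0"
    using assms(4,5) by (intro theta_factor_nonzero theta_row_det)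
  moreover have "f (moebius a b c d z) = theta_factor c d z ^ (2 * k + 1) * f z"
    using assms unfolding cusp_forms_def by blast
  ultimately show ?thesis by (simp add: theta_slash_def slash_def)
qed

lemma cusp_formsI:
  assumes "cuspidal_everywhere k f" "4 dvd N"
    and "\<And>a b c d z. a * d - b * c = 1 \<Longrightarrow> int N dvd c \<Longrightarrow> Im z > 0 \<Longrightarrow> theta_slash k a b c d f z = f z"
  shows "f \<in> cusp_forms k N"
  unfolding cusp_forms_iff
proof (intro conjI allI impI ballI)
  fix a b c d :: int and z assume *: "a * d - b * c = 1 \<and> int N dvd c" and z: "z \<in> uhp"
  have "4 dvd c" using assms(2) * by (metis dvd_trans int_dvd_int_iff of_nat_numeral)
  then have "theta_factor c d z \<noteq> 0"
    using * z by (intro theta_factor_nonzero theta_row_det) auto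
  then show "f (moebius a b c d z) = theta_factor c d z ^ (2 * k + 1) * f z"
    using assms(3)[of a d b c z] * z by (simp add: theta_slash_def slash_def field_simps)
qed (rule assms(1))

lemma cusp_forms_level_mono:
  assumes "f \<in> cusp_forms k N" "N dvd N'"
  shows "f \<in> cusp_forms k N'"
proof -
  have "int N dvd int N'" using assms(2) by simp
  then show ?thesis using assms(1) unfolding cusp_forms_iff by (meson dvd_trans)
qed

lemma cusp_forms_cong:
  assumes "\<And>z. Im z > 0 \<Longrightarrow> f z = g z" "f \<in> cusp_forms k N"
  shows "g \<in> cusp_forms k N"
  using assms cuspidal_everywhere_cong[of f g k] Im_moebius_pos_det_1
  unfolding cusp_forms_iff by simp

lemma cusp_forms_add:
  assumes "f \<in> cusp_forms k N" "g \<in> cusp_forms k N"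
  shows "(\<lambda>z. f z + g z) \<in> cusp_forms k N"
  using assms cuspidal_everywhere_add unfolding cusp_forms_iff by (simp add: distrib_left)

lemma cusp_forms_cmult:
  assumes "f \<in> cusp_forms k N"
  shows "(\<lambda>z. t * f z) \<in> cusp_forms k N"
  using assms cuspidal_everywhere_cmult unfolding cusp_forms_iff by (simp add: mult.left_commute)

lemma cuspidal_everywhere_theta_slash:
  assumes "cuspidal_everywhere k f" "4 dvd c" "a * d - b * c = 1"
  shows "cuspidal_everywhere k (theta_slash k a b c d f)"
  unfolding theta_slash_def
proof (rule cuspidal_everywhere_slash)
  have row: "theta_row c d" using assms(2,3) by (rule theta_row_det)
  show "theta_factor c d holomorphic_on uhp"
    unfolding theta_factor_def[abs_def]
    using holomorphic_csqrt_denominator[of "of_int c" "of_int d"]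
    by (intro holomorphic_on_mult holomorphic_on_const) simp
  show "(inverse (eps d) * of_int (shimura_symbol c d))\<^sup>2 \<noteq> 0"
    using shimura_symbol_nonzero[OF theta_row_odd[OF row]] row by (simp add: eps_def theta_row_def)
  show "theta_factor c d z ^ 2 = (inverse (eps d) * of_int (shimura_symbol c d))\<^sup>2 * (of_int c * z + of_int d)" for z
    by (simp add: theta_factor_def power_mult_distrib)
qed (use assms in auto)

text \<open>The number \<open>c * d' - d * c'\<close> is the lower left entry of the first matrix
  times the inverse of the second. Its divisibility by \<open>N\<close> says that both matrices lie
  in one coset of Gamma_0(N), so the quotient is absorbed by \<open>f\<close>.\<close>

lemma theta_slash_eq:
  assumes f: "f \<in> cusp_forms k N" "4 dvd N"
    and "4 dvd c" "a * d - b * c = 1" "4 dvd c'" "a' * d' - b' * c' = 1"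
    and N: "int N dvd c * d' - d * c'" and z: "Im z > 0"
  shows "theta_slash k a b c d f z = theta_slash k a' b' c' d' f z"
proof -
  define A B C D where "A = a * d' - b * c'" and "B = b * a' - a * b'"
    and "C = c * d' - d * c'" and "D = d * a' - c * b'"
  have "A * D - B * C = (a * d - b * c) * (a' * d' - b' * c')"
    unfolding A_def B_def C_def D_def by (simp add: algebra_simps)
  then have det: "A * D - B * C = 1" using assms by simp
  have C4: "4 dvd C" using assms unfolding C_def by simp
  have "theta_slash k a' b' c' d' f z = theta_slash k a' b' c' d' (theta_slash k A B C D f) z"
    using theta_slash_cusp_form[OF f _ det, of "moebius a' b' c' d' z"] N z
      Im_moebius_pos_det_1[OF z assms(6)]
    by (simp add: theta_slash_def slash_def C_def)
  also have "\<dots> = theta_slash k (A * a' + B * c') (A * b' + B * d') (C * a' + D * c') (C * b' + D * d') f z"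
    using C4 det assms by (intro theta_slash_comp theta_row_det) auto
  also have "A * a' + B * c' = a * (a' * d' - b' * c')" by (simp add: A_def B_def algebra_simps)
  also have "A * b' + B * d' = b * (a' * d' - b' * c')" by (simp add: A_def B_def algebra_simps)
  also have "C * a' + D * c' = c * (a' * d' - b' * c')" by (simp add: C_def D_def algebra_simps)
  also have "C * b' + D * d' = d * (a' * d' - b' * c')" by (simp add: C_def D_def algebra_simps)
  finally show ?thesis using assms by simp
qed

text \<open>Such a row arises from (c, 1) by a translation, and there \<open>eps\<close> and the
  symbol are 1. This identifies the plain roots in \<open>Q_op\<close> with theta factors.\<close>

lemma theta_factor_one_mod:
  assumes "4 dvd c"
  shows "theta_factor c (1 + c * e) z = csqrt (of_int c * z + of_int (1 + c * e))"
proof -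
  have "theta_row c 1" using assms by (simp add: theta_row_def)
  then have "theta_factor c (1 + c * e) z = theta_factor c 1 (z + of_int e)"
    by (rule theta_factor_shift)
  then show ?thesis by (simp add: theta_factor_def eps_def shimura_symbol_def algebra_simps)
qed

section \<open>Cosets of Gamma_0(4M) in Gamma_0(4L), the trace and its level\<close>

locale exact_prime_level =
  fixes k M p :: nat and m n :: int
  assumes odd_M: "odd M" and M_pos: "M > 0" and prime_p: "prime p" and p_dvd_M: "p dvd M"
    and bezout: "int p * n - 4 * int (M div p) * m = 1"
begin

definition L :: int where "L = int (M div p)"

lemma M_eq: "int M = int p * L"
  using p_dvd_M by (simp add: L_def flip: of_nat_mult)

lemma bezout_L: "int p * n - 4 * L * m = 1"
  using bezout by (simp add: L_def)

lemma p_gt_2: "2 < p"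
proof -
  have "odd p" using odd_M p_dvd_M by auto
  then show ?thesis using prime_ge_2_nat[OF prime_p] by (cases "p = 2") auto
qed

lemma L_pos: "L > 0"
proof -
  have "L \<noteq> 0" using M_pos M_eq by auto
  moreover have "L \<ge> 0" by (simp add: L_def)
  ultimately show ?thesis by simp
qed

lemma prime_int_p: "prime (int p)"
  using prime_p by simp

lemma p_not_dvd_4L: "\<not> int p dvd 4 * L"
proof
  assume "int p dvd 4 * L"
  then have "int p dvd int p * n - 4 * L * m" by (rule dvd_diff[OF dvd_triv_left dvd_mult2])
  then show False using bezout_L p_gt_2 by simp
qed

lemma p_not_dvd_m: "\<not> int p dvd m"
proof
  assume "int p dvd m"
  then have "int p dvd int p * n - 4 * L * m" by (rule dvd_diff[OF dvd_triv_left dvd_mult])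
  then show False using bezout_L p_gt_2 by simp
qed

definition trace_reps :: "(int \<times> int \<times> int \<times> int) set" where
  "trace_reps = insert (1, 0, 0, 1)
     ((\<lambda>s. (1, m - s, 4 * L, n * int p - 4 * L * s)) ` {0..int p - 1})"

lemma trace_reps_props:
  assumes "(a, b, c, d) \<in> trace_reps"
  shows "a * d - b * c = 1" "4 * L dvd c"
proof -
  have "n * int p - 4 * L * s - (m - s) * (4 * L) = 1" for s
    using bezout_L by (simp add: algebra_simps)
  then show "a * d - b * c = 1" using assms by (auto simp: trace_reps_def)
qed (use assms in \<open>auto simp: trace_reps_def\<close>)

lemma dvd_4M_iff: "int (4 * M) dvd 4 * L * x \<longleftrightarrow> int p dvd x"
proof -
  have "int (4 * M) = 4 * L * int p" using M_eq by (simp add: mult_ac)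
  then show ?thesis using L_pos by (simp only: dvd_mult_cancel_left) simp
qed

text \<open>With \<open>c = 4 * L * x\<close>, the coset of the row (c, d) is the point (x : d) of
  the projective line over the field with \<open>p\<close> elements; the identity represents the
  point with \<open>x = 0\<close>.\<close>

lemma trace_reps_exist:
  assumes "4 * L dvd c"
  shows "\<exists>(a', b', c', d') \<in> trace_reps. int (4 * M) dvd c * d' - d * c'"
proof -
  obtain x where x: "c = 4 * L * x" using assms by (auto elim: dvdE)
  show ?thesis
  proof (cases "int p dvd x")
    case True
    then have "int (4 * M) dvd c * 1 - d * 0" using dvd_4M_iff[of x] x by simp
    then show ?thesis by (auto simp: trace_reps_def)
  next
    case False
    then have "\<not> int p dvd 4 * L * x"
      using p_not_dvd_4L prime_int_p prime_dvd_mult_iff by blast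
    then have "coprime (4 * L * x) (int p)"
      using prime_int_p prime_imp_coprime coprime_commute by blast
    then obtain y where y: "[4 * L * x * y = 1] (mod int p)"
      using cong_solve_coprime_int by blast
    \<comment> \<open>The term containing \<open>n * p\<close> vanishes modulo \<open>p\<close>, so
      the coset condition reads \<open>4 * L * x * s + d = 0\<close>, and \<open>y\<close> inverts
      \<open>4 * L * x\<close>.\<close>
    define s where "s = (- d * y) mod int p"
    have s: "s \<in> {0..int p - 1}" using p_gt_2 by (simp add: s_def)
    have "[4 * L * x * s = 4 * L * x * (- d * y)] (mod int p)"
      unfolding s_def by (intro cong_mult) (simp_all add: cong_def)
    also have "4 * L * x * (- d * y) = - d * (4 * L * x * y)" by (simp add: algebra_simps)
    also have "[\<dots> = - d * 1] (mod int p)" by (intro cong_mult y) simp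
    finally have "int p dvd 4 * L * x * s + d" by (simp add: cong_iff_dvd_diff)
    then have "int p dvd x * n * int p - (4 * L * x * s + d)" by (intro dvd_diff) auto
    then have "int (4 * M) dvd 4 * L * (x * n * int p - (4 * L * x * s + d))"
      by (simp only: dvd_4M_iff)
    also have "4 * L * (x * n * int p - (4 * L * x * s + d)) = c * (n * int p - 4 * L * s) - d * (4 * L)"
      by (simp add: x algebra_simps)
    finally show ?thesis using s unfolding trace_reps_def by blast
  qed
qed

lemma trace_reps_unique:
  assumes "(a, b, c, d) \<in> trace_reps" "(a', b', c', d') \<in> trace_reps" "int (4 * M) dvd c * d' - d * c'"
  shows "(a, b, c, d) = (a', b', c', d')"
proof -
  have ne: "\<not> int (4 * M) dvd 4 * L" "\<not> int (4 * M) dvd - (4 * L)"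
    using dvd_4M_iff[of 1] p_gt_2 by auto
  have inj: "s = t" if "int (4 * M) dvd 4 * L * (n * int p - 4 * L * t) - (n * int p - 4 * L * s) * (4 * L)"
    "s \<in> {0..int p - 1}" "t \<in> {0..int p - 1}" for s t
  proof -
    have "4 * L * (n * int p - 4 * L * t) - (n * int p - 4 * L * s) * (4 * L) = 4 * L * (4 * L * (s - t))"
      by (simp add: algebra_simps)
    then have "int p dvd 4 * L * (s - t)" using that(1) dvd_4M_iff by metis
    then have "int p dvd s - t" using p_not_dvd_4L prime_int_p prime_dvd_mult_iff by blast
    moreover have "\<bar>s - t\<bar> < int p" using that by auto
    ultimately show "s = t" using dvd_imp_le_int[of "s - t" "int p"] by fastforce
  qed
  have cases: "x = (1, 0, 0, 1) \<or> (\<exists>s\<in>{0..int p - 1}. x = (1, m - s, 4 * L, n * int p - 4 * L * s))"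
    if "x \<in> trace_reps" for x using that unfolding trace_reps_def by blast
  from cases[OF assms(1)] cases[OF assms(2)] show ?thesis
  proof (elim disjE bexE)
    fix s t
    assume "s \<in> {0..int p - 1}" "t \<in> {0..int p - 1}"
      and "(a, b, c, d) = (1, m - s, 4 * L, n * int p - 4 * L * s)"
      and "(a', b', c', d') = (1, m - t, 4 * L, n * int p - 4 * L * t)"
    then show ?thesis using inj[of t s] assms(3) by simp
  qed (use ne assms(3) in simp_all)
qed

definition trace :: "(complex \<Rightarrow> complex) \<Rightarrow> complex \<Rightarrow> complex" where
  "trace f z = (\<Sum>(a, b, c, d)\<in>trace_reps. theta_slash k a b c d f z)"

lemma finite_trace_reps: "finite trace_reps"
  by (simp add: trace_reps_def)

lemma sum_trace_reps:
  fixes G :: "int \<times> int \<times> int \<times> int \<Rightarrow> 'a :: comm_monoid_add"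
  shows "sum G trace_reps
    = G (1, 0, 0, 1) + (\<Sum>s\<in>{0..int p - 1}. G (1, m - s, 4 * L, n * int p - 4 * L * s))"
proof -
  have "inj_on (\<lambda>s. (1 :: int, m - s, 4 * L, n * int p - 4 * L * s)) {0..int p - 1}"
    by (auto simp: inj_on_def)
  moreover have "(1, 0, 0, 1) \<notin> (\<lambda>s. (1, m - s, 4 * L, n * int p - 4 * L * s)) ` {0..int p - 1}"
    using L_pos by auto
  ultimately show ?thesis
    unfolding trace_reps_def by (subst sum.insert) (simp_all only: finite_imageI finite_atLeastAtMost_int sum.reindex o_def)
qed

lemma trace_eq_Q_op:
  "trace f z = f z + Q_op k M p m n f z"
proof -
  have "trace f z = f z
    + (\<Sum>s\<in>{0..int p - 1}. theta_slash k 1 (m - s) (4 * L) (n * int p - 4 * L * s) f z)"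
    unfolding trace_def by (subst sum_trace_reps) simp
  also have "(\<Sum>s\<in>{0..int p - 1}. theta_slash k 1 (m - s) (4 * L) (n * int p - 4 * L * s) f z)
    = Q_op k M p m n f z"
    unfolding Q_op_def
  proof (rule sum.cong)
    fix s
    have "n * int p - 4 * L * s = 1 + 4 * L * (m - s)" using bezout_L by (simp add: algebra_simps)
    then have "theta_factor (4 * L) (n * int p - 4 * L * s)
      = (\<lambda>z. csqrt (of_int (4 * L) * z + of_int (n * int p - 4 * L * s)))"
      using theta_factor_one_mod[of "4 * L" "m - s"] by (simp add: fun_eq_iff)
    then show "theta_slash k 1 (m - s) (4 * L) (n * int p - 4 * L * s) f z =
      slash k 1 (of_int (m - s)) (of_int (4 * int (M div p))) (of_int (n * int p - 4 * int (M div p) * s))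
       (\<lambda>z. csqrt (of_int (4 * int (M div p)) * z + of_int (n * int p - 4 * int (M div p) * s))) f z"
      by (simp add: theta_slash_def L_def)
  qed simp
  finally show ?thesis .
qed

text \<open>Right multiplication by a matrix of Gamma_0(4L) permutes the cosets. Here
  \<open>\<beta> r\<close> is the multiplied representative, \<open>E\<close> says that two matrices
  share a coset, and \<open>\<pi>\<close> is the resulting permutation, injective on a finite set
  and hence bijective.\<close>

lemma trace_cusp_form:
  assumes f: "f \<in> cusp_forms k (4 * M)"
  shows "trace f \<in> cusp_forms k (4 * (M div p))"
proof (rule cusp_formsI)
  have "cuspidal_everywhere k (\<lambda>z. case r of (a, b, c, d) \<Rightarrow> theta_slash k a b c d f z)"
    if "r \<in> trace_reps" for r
  proof -
    obtain a b c d where r: "r = (a, b, c, d)" by (cases r) auto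
    have "cuspidal_everywhere k (theta_slash k a b c d f)"
      using f trace_reps_props[of a b c d] that r
      by (intro cuspidal_everywhere_theta_slash) (auto simp: cusp_forms_iff intro: dvd_mult_left)
    then show ?thesis by (simp add: r)
  qed
  then show "cuspidal_everywhere k (trace f)"
    unfolding trace_def[abs_def]
    by (intro cuspidal_everywhere_sum finite_trace_reps) (auto simp: trace_reps_def)
next
  fix a b c d z
  assume det: "a * d - b * c = 1" and c: "int (4 * (M div p)) dvd c" and z: "Im z > 0"
  have c4L: "4 * L dvd c" using c by (simp add: L_def)
  have c4: "4 dvd c" using c4L by (rule dvd_mult_left)
  define \<beta> where "\<beta> r = (case r of (a', b', c', d') \<Rightarrow>
    (a' * a + b' * c, a' * b + b' * d, c' * a + d' * c, c' * b + d' * d))" for r :: "int \<times> int \<times> int \<times> int"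
  define T where "T r = (case r of (a', b', c', d') \<Rightarrow> theta_slash k a' b' c' d' f z)" for r
  define E where "E r r' = (case (\<beta> r, r') of ((_, _, x, y), (_, _, x', y')) \<Rightarrow>
    int (4 * M) dvd x * y' - y * x')" for r r' :: "int \<times> int \<times> int \<times> int"
  have "\<forall>r\<in>trace_reps. \<exists>r'. r' \<in> trace_reps \<and> E r r'"
  proof
    fix r assume r: "r \<in> trace_reps"
    obtain a' b' c' d' where r_eq: "r = (a', b', c', d')" by (cases r) auto
    have "4 * L dvd c' * a + d' * c"
      using trace_reps_props(2)[of a' b' c' d'] r r_eq c4L by simp
    from trace_reps_exist[OF this, of "c' * b + d' * d"]
    obtain a'' b'' c'' d'' where "(a'', b'', c'', d'') \<in> trace_reps"
      "int (4 * M) dvd (c' * a + d' * c) * d'' - (c' * b + d' * d) * c''"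
      by blast
    then show "\<exists>r'. r' \<in> trace_reps \<and> E r r'"
      by (intro exI[of _ "(a'', b'', c'', d'')"]) (simp add: E_def \<beta>_def r_eq)
  qed
  from bchoice[OF this] obtain \<pi> where \<pi>: "\<And>r. r \<in> trace_reps \<Longrightarrow> \<pi> r \<in> trace_reps"
    "\<And>r. r \<in> trace_reps \<Longrightarrow> E r (\<pi> r)"
    by auto
  have "inj_on \<pi> trace_reps"
  proof (rule inj_onI)
    fix r r' assume r: "r \<in> trace_reps" "r' \<in> trace_reps" "\<pi> r = \<pi> r'"
    obtain a1 b1 c1 d1 where r1: "r = (a1, b1, c1, d1)" by (cases r) auto
    obtain a2 b2 c2 d2 where r2: "r' = (a2, b2, c2, d2)" by (cases r') auto
    obtain a3 b3 c3 d3 where r3: "\<pi> r = (a3, b3, c3, d3)" by (cases "\<pi> r") auto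
    define x1 y1 x2 y2 where "x1 = c1 * a + d1 * c" and "y1 = c1 * b + d1 * d"
      and "x2 = c2 * a + d2 * c" and "y2 = c2 * b + d2 * d"
    have 1: "int (4 * M) dvd x1 * d3 - y1 * c3" and 2: "int (4 * M) dvd x2 * d3 - y2 * c3"
      using \<pi>(2)[OF r(1)] \<pi>(2)[OF r(2)] r(3) r1 r2 r3
      by (simp_all add: E_def \<beta>_def x1_def y1_def x2_def y2_def)
    have det3: "a3 * d3 - b3 * c3 = 1"
      using trace_reps_props(1)[of a3 b3 c3 d3] \<pi>(1)[OF r(1)] r3 by simp
    have "x1 * y2 - y1 * x2 = (x1 * y2 - y1 * x2) * (a3 * d3 - b3 * c3)" using det3 by simp
    \<comment> \<open>Both rows are expanded in the rows of \<open>\<pi> r\<close>, a basis of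
      determinant 1. Their coefficients at its upper row are divisible by \<open>4 * M\<close>,
      hence so is their minor.\<close>
    also have "\<dots> = (x1 * d3 - y1 * c3) * (y2 * a3 - x2 * b3) - (x2 * d3 - y2 * c3) * (y1 * a3 - x1 * b3)"
      by (simp add: algebra_simps)
    finally have "int (4 * M) dvd x1 * y2 - y1 * x2"
      using 1 2 by (metis dvd_diff dvd_mult2)
    moreover have "x1 * y2 - y1 * x2 = (c1 * d2 - d1 * c2) * (a * d - b * c)"
      by (simp add: x1_def x2_def y1_def y2_def algebra_simps)
    ultimately show "r = r'"
      using trace_reps_unique[of a1 b1 c1 d1 a2 b2 c2 d2] r r1 r2 det by simp
  qed
  then have bij: "bij_betw \<pi> trace_reps trace_reps"
    using \<pi>(1) finite_trace_reps by (simp add: bij_betw_def endo_inj_surj image_subsetI)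
  have "theta_slash k a b c d (trace f) z
    = (\<Sum>(a', b', c', d')\<in>trace_reps. theta_slash k a b c d (theta_slash k a' b' c' d' f) z)"
    by (simp add: theta_slash_def slash_def trace_def sum_divide_distrib split_beta)
  also have "\<dots> = (\<Sum>r\<in>trace_reps. T (\<pi> r))"
  proof (rule sum.cong)
    fix r assume r: "r \<in> trace_reps"
    obtain a1 b1 c1 d1 where r1: "r = (a1, b1, c1, d1)" by (cases r) auto
    obtain a3 b3 c3 d3 where r3: "\<pi> r = (a3, b3, c3, d3)" by (cases "\<pi> r") auto
    have p1: "a1 * d1 - b1 * c1 = 1" "4 dvd c1"
      using trace_reps_props[of a1 b1 c1 d1] r r1 by (auto intro: dvd_mult_left)
    have p3: "a3 * d3 - b3 * c3 = 1" "4 dvd c3"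
      using trace_reps_props[of a3 b3 c3 d3] \<pi>(1)[OF r] r3 by (auto intro: dvd_mult_left)
    have "(a1 * a + b1 * c) * (c1 * b + d1 * d) - (a1 * b + b1 * d) * (c1 * a + d1 * c)
      = (a1 * d1 - b1 * c1) * (a * d - b * c)" by (simp add: algebra_simps)
    then have d1: "(a1 * a + b1 * c) * (c1 * b + d1 * d) - (a1 * b + b1 * d) * (c1 * a + d1 * c) = 1"
      using p1 det by simp
    have "theta_slash k a b c d (theta_slash k a1 b1 c1 d1 f) z
      = theta_slash k (a1 * a + b1 * c) (a1 * b + b1 * d) (c1 * a + d1 * c) (c1 * b + d1 * d) f z"
      using c4 det p1 z by (intro theta_slash_comp theta_row_det[of c1 a1 d1 b1])
    also have "\<dots> = theta_slash k a3 b3 c3 d3 f z"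
      using f _ _ d1 p3(2,1) _ z
    proof (rule theta_slash_eq)
      show "4 dvd c1 * a + d1 * c" using p1 c4 by simp
      show "int (4 * M) dvd (c1 * a + d1 * c) * d3 - (c1 * b + d1 * d) * c3"
        using \<pi>(2)[OF r] r3 r1 by (simp add: E_def \<beta>_def)
    qed simp
    finally show "(case r of (a', b', c', d') \<Rightarrow> theta_slash k a b c d (theta_slash k a' b' c' d' f) z)
      = T (\<pi> r)" using r3 by (simp add: r1 T_def)
  qed simp
  also have "\<dots> = (\<Sum>r\<in>trace_reps. T r)" using bij by (rule sum.reindex_bij_betw)
  also have "\<dots> = trace f z" by (simp add: trace_def T_def)
  finally show "theta_slash k a b c d (trace f) z = trace f z" .
qed simp

lemma Q_op_lower_level:
  assumes f: "f \<in> cusp_forms k (4 * (M div p))" and z: "Im z > 0"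
  shows "Q_op k M p m n f z = of_nat p * f z"
proof -
  have "trace f z = (\<Sum>r\<in>trace_reps. f z)"
    unfolding trace_def
  proof (rule sum.cong)
    fix r assume r: "r \<in> trace_reps"
    obtain a b c d where r1: "r = (a, b, c, d)" by (cases r) auto
    have "int (4 * (M div p)) dvd c" "a * d - b * c = 1"
      using trace_reps_props[of a b c d] r r1 by (simp_all add: L_def)
    then have "theta_slash k a b c d f z = f z" using f z by (intro theta_slash_cusp_form) auto
    then show "(case r of (a, b, c, d) \<Rightarrow> theta_slash k a b c d f z) = f z" by (simp add: r1)
  qed simp
  also have "\<dots> = f z + of_nat p * f z" by (subst sum_trace_reps) simp
  finally show ?thesis using trace_eq_Q_op[of f z] by simp
qed

lemma Q_op_cusp_form:
  assumes f: "f \<in> cusp_forms k (4 * M)"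
  shows "Q_op k M p m n f \<in> cusp_forms k (4 * M)"
proof (rule cusp_forms_cong)
  have "4 * (M div p) dvd 4 * M" using p_dvd_M by auto
  from cusp_forms_level_mono[OF trace_cusp_form[OF f] this]
  show "(\<lambda>z. trace f z + (-1) * f z) \<in> cusp_forms k (4 * M)"
    using f by (intro cusp_forms_add cusp_forms_cmult)
qed (simp add: trace_eq_Q_op)

lemma Q_op_quadratic:
  assumes f: "f \<in> cusp_forms k (4 * M)" and z: "Im z > 0"
  shows "Q_op k M p m n (\<lambda>w. Q_op k M p m n f w + f w) z = of_nat p * (Q_op k M p m n f z + f z)"
proof -
  have "(\<lambda>w. Q_op k M p m n f w + f w) = trace f" by (simp add: fun_eq_iff trace_eq_Q_op)
  then show ?thesis using Q_op_lower_level[OF trace_cusp_form[OF f] z] by (simp add: trace_eq_Q_op add.commute)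
qed

end

section \<open>The operator \<open>W\<close>\<close>

lemma sum_residues_affine:
  fixes r e b :: int
  assumes r: "r > 0" and e: "coprime e r" and H: "\<And>x y. [x = y] (mod r) \<Longrightarrow> H x = H y"
  shows "(\<Sum>s\<in>{0..r - 1}. H (e * s + b)) = (\<Sum>s\<in>{0..r - 1}. H s)"
proof -
  define \<pi> where "\<pi> s = (e * s + b) mod r" for s
  have "inj_on \<pi> {0..r - 1}"
  proof (rule inj_onI)
    fix s t assume *: "s \<in> {0..r - 1}" "t \<in> {0..r - 1}" "\<pi> s = \<pi> t"
    then have "[e * s + b = e * t + b] (mod r)" by (simp add: \<pi>_def cong_def)
    then have "[e * s = e * t] (mod r)" by (simp only: cong_add_rcancel)
    then have "[s = t] (mod r)" using e by (simp add: cong_mult_lcancel)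
    then show "s = t" using * r by (simp add: cong_def)
  qed
  moreover have "\<pi> ` {0..r - 1} \<subseteq> {0..r - 1}" using r by (auto simp: \<pi>_def)
  ultimately have "bij_betw \<pi> {0..r - 1} {0..r - 1}"
    by (simp add: bij_betw_def endo_inj_surj)
  then have "(\<Sum>s\<in>{0..r - 1}. H (\<pi> s)) = (\<Sum>s\<in>{0..r - 1}. H s)"
    by (rule sum.reindex_bij_betw)
  moreover have "H (\<pi> s) = H (e * s + b)" for s
    by (rule H) (simp add: \<pi>_def cong_def)
  ultimately show ?thesis by simp
qed

text \<open>Squaring maps the finite set of nonzero residues to itself and is not injective, since 1
  and \<open>p - 1\<close> have the same square; so it is not surjective.\<close>

lemma exists_nonresidue:
  assumes "prime p" "2 < p"
  obtains g where "Legendre g (int p) = -1"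
proof -
  define P where "P = {1..int p - 1}"
  define sq where "sq x = x\<^sup>2 mod int p" for x
  have nz: "sq x \<in> P" if "x \<in> P" for x
  proof -
    have "\<not> int p dvd x" using that by (auto simp: P_def dest: zdvd_imp_le)
    then have "\<not> int p dvd x\<^sup>2" using assms(1) prime_dvd_power[of "int p" x 2] by auto
    then have "sq x \<noteq> 0" by (auto simp: sq_def)
    moreover have "0 \<le> sq x" "sq x < int p" using assms(2) by (simp_all add: sq_def)
    ultimately show ?thesis by (simp add: P_def)
  qed
  have "(int p - 1)\<^sup>2 = 1 + int p * (int p - 2)" by (simp add: power2_eq_square algebra_simps)
  then have "sq (int p - 1) = sq 1" unfolding sq_def by (simp only: mod_mult_self2) simp
  then have "\<not> inj_on sq P"
    using assms(2) inj_onD[of sq P "int p - 1" 1] by (auto simp: P_def)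
  then have "sq ` P \<noteq> P" using finite_surj_inj[of P sq] by (auto simp: P_def)
  moreover have "sq ` P \<subseteq> P" using nz by auto
  ultimately obtain g where g: "g \<in> P" "g \<notin> sq ` P" by auto
  have "\<not> QuadRes (int p) g"
  proof
    assume "QuadRes (int p) g"
    then obtain y where y: "[y\<^sup>2 = g] (mod int p)" by (auto simp: QuadRes_def)
    have g_eq: "g = g mod int p" using g(1) by (simp add: P_def)
    have "sq (y mod int p) = g" using y g_eq by (simp add: sq_def cong_def power_mod)
    moreover have "y mod int p \<noteq> 0"
    proof
      assume "y mod int p = 0"
      then have "sq (y mod int p) = 0" by (simp add: sq_def)
      then show False using \<open>sq (y mod int p) = g\<close> g(1) by (simp add: P_def)
    qed
    moreover have "0 \<le> y mod int p" "y mod int p < int p" using assms(2) by simp_all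
    ultimately have "g \<in> sq ` P" 
      by (intro image_eqI[of _ _ "y mod int p"]) (auto simp: P_def)
    then show False using g(2) by simp
  qed
  moreover have "\<not> [g = 0] (mod int p)" using g(1) by (simp add: P_def cong_def)
  ultimately have "Legendre g (int p) = -1" by (simp add: Legendre_def)
  then show thesis by (rule that)
qed

text \<open>Multiplying the summation variable by a nonresidue permutes the residues and negates the
  sum.\<close>

lemma sum_Legendre:
  assumes "prime p" "2 < p"
  shows "(\<Sum>x\<in>{0..int p - 1}. Legendre x (int p)) = 0"
proof -
  obtain g where g: "Legendre g (int p) = -1" using exists_nonresidue[OF assms] .
  have "\<not> int p dvd g" using g by (auto simp: Legendre_def cong_0_iff)
  moreover have "prime (int p)" using assms(1) by simp
  ultimately have "coprime g (int p)" using prime_imp_coprime coprime_commute by blast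
  then have "(\<Sum>x\<in>{0..int p - 1}. Legendre (g * x + 0) (int p)) = (\<Sum>x\<in>{0..int p - 1}. Legendre x (int p))"
    using assms(2) by (intro sum_residues_affine) (auto intro: Legendre_cong)
  then show ?thesis using g by (simp add: Legendre_mult[OF assms] sum_negf)
qed

lemma Legendre_odd_power: "Legendre a p ^ (2 * k + 1) = Legendre a p"
  using Legendre_values[of a p] by (auto simp: power_mult)

section \<open>Translates by fractions u/p under lower triangular matrices, and the level of
  W\<close>

context exact_prime_level
begin

lemma Legendre_p_mult: "Legendre (a * b) (int p) = Legendre a (int p) * Legendre b (int p)"
  by (rule Legendre_mult[OF prime_p p_gt_2])

lemma Legendre_p_square: "\<not> int p dvd a \<Longrightarrow> Legendre (a * a) (int p) = 1"
  by (simp add: Legendre_p_mult Legendre_square cong_0_iff)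

lemma Legendre_p_cong: "int p dvd a - b \<Longrightarrow> Legendre a (int p) = Legendre b (int p)"
  by (rule Legendre_cong) (simp add: cong_iff_dvd_diff)

definition shifted :: "int \<Rightarrow> (complex \<Rightarrow> complex) \<Rightarrow> complex \<Rightarrow> complex" where
  "shifted u f z = f (z + of_int u / of_nat p)"

text \<open>The multiple \<open>4 * M\<close> is chosen so that \<open>lower\<close> fixes forms of
  level \<open>4 * M\<close> and turns addition of indices into composition; on translates of such
  forms only the index modulo \<open>p\<close> matters.\<close>

definition lower :: "int \<Rightarrow> (complex \<Rightarrow> complex) \<Rightarrow> complex \<Rightarrow> complex" where
  "lower t = theta_slash k 1 0 (4 * int M * t) 1"

text \<open>Split (pc'/d) into (p/d) and (c'/d). The second factor has period \<open>c'\<close>, the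
  reciprocity sign of the first has period 4, and what remains is a Legendre symbol modulo
  \<open>p\<close>. For \<open>c' = 0\<close> one only needs that \<open>d\<close> is prime to
  \<open>p\<close>.\<close>

lemma shimura_symbol_p_mult_shift:
  assumes det: "a * d - b * (int p * c') = 1" and c': "4 dvd c'"
  shows "shimura_symbol (int p * c') (d - v * c')
    = Legendre ((d - v * c') * d) (int p) * shimura_symbol (int p * c') d"
proof (cases "c' = 0")
  case True
  then have "\<not> int p dvd d" using det p_gt_2 by (auto dest: dvd_mult[of _ _ a])
  then show ?thesis using True Legendre_p_square by simp
next
  case False
  have row: "theta_row (int p * c') d" using c' det by (intro theta_row_det) auto
  have odd: "odd d" by (rule theta_row_odd[OF row])
  have mod4: "(d - v * c') mod 4 = d mod 4"
  proof -
    obtain x where "c' = 4 * x" using c' by (auto elim: dvdE)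
    then have "d - v * c' = d + 4 * (- (v * x))" by simp
    then show ?thesis by (simp only: mod_mult_self2)
  qed
  have odd': "odd (d - v * c')" using odd c' by (auto elim!: dvdE)
  have pd: "\<not> int p dvd d"
  proof
    assume "int p dvd d"
    then have "int p dvd a * d - b * (int p * c')" by simp
    then show False using det p_gt_2 by simp
  qed
  have split: "shimura_symbol (int p * c') x = Legendre x (int p) * qr_sign (int p) x * shimura_symbol c' x"
    if "odd x" for x
    using shimura_symbol_mult[OF that, of "int p" c'] shimura_symbol_prime[OF that prime_p p_gt_2]
      False p_gt_2 by simp
  have "shimura_symbol c' (d - v * c') = shimura_symbol c' d"
    using odd' c' by (intro shimura_symbol_cong) (auto simp: cong_iff_dvd_diff)
  moreover have "qr_sign (int p) (d - v * c') = qr_sign (int p) d"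
    using mod4 by (simp add: qr_sign_def chi4_def)
  moreover have "Legendre (d - v * c') (int p)
    = Legendre ((d - v * c') * d) (int p) * Legendre d (int p)"
    using Legendre_p_square[OF pd] by (simp add: Legendre_p_mult)
  ultimately show ?thesis unfolding split[OF odd] split[OF odd'] by simp
qed

text \<open>\<open>(1 u/p; 0 1) (a b; c d) = \<gamma> (1 v/p; 0 1)\<close> with an integral matrix \<open>\<gamma>\<close> whose lower row is
  \<open>(c, d - v c/p)\<close>; the Legendre symbol compares the theta multipliers of \<open>\<gamma>\<close> and \<open>(a b; c d)\<close>.\<close>

lemma theta_slash_shifted:
  assumes f: "f \<in> cusp_forms k (4 * M)" and det: "a * d - b * c = 1"
    and c: "c = int p * c'" "4 * L dvd c'"
    and cond: "int p dvd u * d - v * a - u * v * c'" and z: "Im z > 0"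
  shows "theta_slash k a b c d (shifted u f) z
    = of_int (Legendre ((d - v * c') * d) (int p)) * shifted v f z"
proof -
  obtain e where e: "u * d - v * a - u * v * c' = int p * e" using cond by (auto elim: dvdE)
  have c4: "4 dvd c'" using c(2) by (rule dvd_mult_left)
  have M4: "int (4 * M) dvd c" using c(2) unfolding c(1) by (auto simp: M_eq mult_ac elim!: dvdE)
  have "(a + u * c') * (d - v * c') - (b + e) * c
    = a * d - b * c + c' * (u * d - v * a - u * v * c' - int p * e)"
    by (simp add: c(1) algebra_simps)
  then have det': "(a + u * c') * (d - v * c') - (b + e) * c = 1" using e det by simp
  define w where "w = z + of_int v / of_nat p"
  have w: "Im w > 0" using z by (simp add: w_def)
  have nz: "of_int c * z + of_int d \<noteq> (0::complex)"
  proof -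
    have "c \<noteq> 0 \<or> d \<noteq> 0" using det by auto
    then show ?thesis using moebius_denominator_nonzero[OF z, of "of_int c" "of_int d"] by simp
  qed
  have p0: "of_nat p \<noteq> (0::complex)" using p_gt_2 by simp
  have den: "of_int c * w + of_int (d - v * c') = of_int c * z + of_int d"
    using p0 by (simp add: w_def c(1) field_simps)
  have num: "of_int (a + u * c') * w + of_int (b + e)
    = of_int a * z + of_int b + of_int u / of_nat p * (of_int c * z + of_int d)"
  proof -
    have "complex_of_int (u * d - v * a - u * v * c') = of_int (int p * e)" by (simp only: e)
    then have "of_int e = (of_int u * of_int d - of_int v * of_int a - of_int u * of_int v * of_int c') / (of_nat p :: complex)"
      using p0 by (simp add: field_simps)
    then show ?thesis using p0 by (simp add: w_def c(1) field_simps)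
  qed
  have "moebius (of_int (a + u * c')) (of_int (b + e)) (of_int c) (of_int (d - v * c')) w
    = (of_int (a + u * c') * w + of_int (b + e)) / (of_int c * w + of_int (d - v * c'))"
    by (simp add: moebius_def)
  also have "\<dots> = moebius a b c d z + of_int u / of_nat p"
    unfolding num den using nz by (simp add: moebius_def add_divide_distrib)
  finally have "f (moebius a b c d z + of_int u / of_nat p)
    = f (moebius (of_int (a + u * c')) (of_int (b + e)) (of_int c) (of_int (d - v * c')) w)" by simp
  also have "\<dots> = theta_factor c (d - v * c') w ^ (2 * k + 1) * f w"
    using f det' M4 w unfolding cusp_forms_def by blast
  also have "theta_factor c (d - v * c') w
    = of_int (Legendre ((d - v * c') * d) (int p)) * theta_factor c d z"
  proof -
    have "eps (d - v * c') = eps d" using c4 by (intro eps_cong) (simp add: cong_iff_dvd_diff)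
    moreover have "shimura_symbol c (d - v * c') = Legendre ((d - v * c') * d) (int p) * shimura_symbol c d"
      using shimura_symbol_p_mult_shift[OF _ c4, of a d b v] det c(1) by simp
    ultimately show ?thesis unfolding theta_factor_def den by simp
  qed
  finally have "f (moebius a b c d z + of_int u / of_nat p)
    = of_int (Legendre ((d - v * c') * d) (int p)) * theta_factor c d z ^ (2 * k + 1) * f w"
    by (simp only: power_mult_distrib Legendre_odd_power flip: of_int_power)
  moreover have "theta_factor c d z \<noteq> 0"
    using z theta_row_det[OF _ det] c4 c(1) by (intro theta_factor_nonzero) auto
  ultimately show ?thesis by (simp add: theta_slash_def slash_def shifted_def w_def)
qed

lemma lower_cong:
  assumes "\<And>z. Im z > 0 \<Longrightarrow> g z = g' z" "Im z > 0"
  shows "lower t g z = lower t g' z"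
  using assms(1)[OF Im_moebius_pos_det_1[OF assms(2), of 1 1 0 "4 * int M * t"]]
  by (simp add: lower_def theta_slash_def slash_def)

lemma lower_cmult: "lower t (\<lambda>z. x * g z) z = x * lower t g z"
  by (simp add: lower_def theta_slash_def slash_def)

lemma lower_add: "lower t (\<lambda>z. g z + g' z) z = lower t g z + lower t g' z"
  by (simp add: lower_def theta_slash_add)

lemma lower_sum: "lower t (\<lambda>z. \<Sum>i\<in>I. g i z) z = (\<Sum>i\<in>I. lower t (g i) z)"
  by (simp add: lower_def theta_slash_def slash_def sum_divide_distrib)

lemma theta_slash_lower:
  assumes "4 dvd c" "a * d - b * c = 1" "Im z > 0"
  shows "theta_slash k a b c d (lower t g) z
    = theta_slash k a b (4 * int M * t * a + c) (4 * int M * t * b + d) g z"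
  using theta_slash_comp[of "4 * int M * t" 1 c a d b z k 1 0 g] assms
  by (simp add: lower_def theta_row_def)

lemma lower_theta_slash:
  assumes "4 dvd c" "a * d - b * c = 1" "Im z > 0"
  shows "lower t (theta_slash k a b c d g) z
    = theta_slash k (a + b * (4 * int M * t)) b (c + d * (4 * int M * t)) d g z"
  using theta_slash_comp[of c d "4 * int M * t" 1 1 0 z k a b g] assms theta_row_det[OF assms(1,2)]
  by (simp add: lower_def)

lemma lower_lower:
  assumes "Im z > 0"
  shows "lower s (lower t g) z = lower (s + t) g z"
  using theta_slash_lower[of "4 * int M * s" 1 1 0 z t g] assms
  by (simp add: lower_def distrib_left add.commute)

lemma lower_cusp_form:
  assumes "f \<in> cusp_forms k (4 * M)" "Im z > 0"
  shows "lower t f z = f z"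
  unfolding lower_def using assms by (intro theta_slash_cusp_form) auto

lemma lower_shifted:
  assumes f: "f \<in> cusp_forms k (4 * M)" and "int p dvd u - v - u * v * (4 * L * t)" and z: "Im z > 0"
  shows "lower t (shifted u f) z = of_int (Legendre (1 - v * (4 * L * t)) (int p)) * shifted v f z"
  unfolding lower_def
  using theta_slash_shifted[OF f, of 1 1 0 "4 * int M * t" "4 * L * t" u v z] assms
  by (simp add: M_eq mult_ac)

text \<open>For an index divisible by \<open>p\<close>, \<open>lower_shifted\<close> applies with
  \<open>v = u\<close> and its Legendre symbol is that of 1, so the translate is fixed; the group
  law does the rest.\<close>

lemma lower_shifted_cong:
  assumes f: "f \<in> cusp_forms k (4 * M)" and st: "[s = t] (mod int p)" and z: "Im z > 0"
  shows "lower s (shifted u f) z = lower t (shifted u f) z"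
proof -
  have st': "int p dvd s - t" using st by (simp add: cong_iff_dvd_diff)
  have "lower (s - t) (shifted u f) w = shifted u f w" if w: "Im w > 0" for w
  proof -
    have "lower (s - t) (shifted u f) w
      = of_int (Legendre (1 - u * (4 * L * (s - t))) (int p)) * shifted u f w"
      using st' w by (intro lower_shifted[OF f]) auto
    also have "Legendre (1 - u * (4 * L * (s - t))) (int p) = Legendre 1 (int p)"
      using st' by (intro Legendre_p_cong) auto
    also have "\<dots> = 1" using p_gt_2 by (intro one_Legendre) simp
    finally show ?thesis by simp
  qed
  then have "lower t (lower (s - t) (shifted u f)) z = lower t (shifted u f) z"
    using z by (rule lower_cong)
  then show ?thesis using lower_lower[OF z] by simp
qed

text \<open>Dividing the given matrix on the right by (1 0; 4Mt 1) leaves (a' b; p c1 d). The choice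
  of \<open>t\<close> makes \<open>d - a' - m * c1\<close> divisible by \<open>p\<close>, which is
  the condition for this quotient to fix the translate by m/p.\<close>

lemma theta_slash_shifted_eq_lower:
  assumes f: "f \<in> cusp_forms k (4 * M)" and det: "a * d - b * c = 1"
    and c: "c = int p * c'" "4 * L dvd c'"
    and t: "[t = 1 - a * (a + m * c')] (mod int p)" and z: "Im z > 0"
  shows "theta_slash k a b c d (shifted m f) z = lower t (shifted m f) z"
proof -
  have c4: "4 dvd c" using c dvd_mult_left[of 4 L c'] by auto
  define a' c1 where "a' = a - b * (4 * int M * t)" and "c1 = c' - d * (4 * L * t)"
  have cc: "c - d * (4 * int M * t) = int p * c1" by (simp add: c1_def c(1) M_eq algebra_simps)
  have det': "a' * d - b * (int p * c1) = 1"
  proof -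
    have "a' * d - b * (c - d * (4 * int M * t)) = a * d - b * c"
      by (simp add: a'_def algebra_simps)
    then show ?thesis using cc det by simp
  qed
  have c1: "4 * L dvd c1" using c(2) by (simp add: c1_def)
  have *: "int p dvd d - a' - m * c1"
  proof -
    obtain j where j: "t - (1 - a * (a + m * c')) = int p * j"
      using t by (auto simp: cong_iff_dvd_diff elim: dvdE)
    \<comment> \<open>Replacing \<open>4 * L * m\<close> by -1 modulo \<open>p\<close> makes the
      condition linear in \<open>t\<close>; it is then solved with \<open>a * d = 1\<close> modulo
      \<open>p\<close>.\<close>
    have Lm: "4 * L * m = int p * n - 1" using bezout_L by simp
    have "d - a' - m * c1 = d - a + b * (4 * int M * t) - m * c' + d * t * (4 * L * m)"
      by (simp add: a'_def c1_def algebra_simps)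
    also have "\<dots> = d - a - m * c' - d * t + int p * (b * (4 * L * t) + d * t * n)"
      unfolding Lm M_eq by (simp add: algebra_simps)
    also have "d - a - m * c' - d * t = (a * d - 1) * (a + m * c') - d * (t - (1 - a * (a + m * c')))"
      by (simp add: algebra_simps)
    also have "\<dots> = int p * (b * c' * (a + m * c') - d * j)"
    proof -
      have "a * d - 1 = b * (int p * c')" using det by (simp flip: c(1))
      then show ?thesis unfolding j by (simp add: algebra_simps)
    qed
    finally show ?thesis by simp
  qed
  have inv: "theta_slash k a' b (int p * c1) d (shifted m f) w = shifted m f w" if w: "Im w > 0" for w
  proof -
    have "int p dvd m * (d - a' - m * c1)" using * by simp
    then have "int p dvd m * d - m * a' - m * m * c1" by (simp add: algebra_simps)
    from theta_slash_shifted[OF f det' refl c1 this w]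
    have "theta_slash k a' b (int p * c1) d (shifted m f) w
      = of_int (Legendre ((d - m * c1) * d) (int p)) * shifted m f w" .
    also have "Legendre ((d - m * c1) * d) (int p) = Legendre 1 (int p)"
    proof (rule Legendre_p_cong)
      have "(d - m * c1) * d - 1 = (d - a' - m * c1) * d + (a' * d - 1)" by (simp add: algebra_simps)
      also have "a' * d - 1 = int p * (b * c1)" using det' by (simp add: mult_ac)
      finally show "int p dvd (d - m * c1) * d - 1" using * by simp
    qed
    also have "\<dots> = 1" using p_gt_2 by (intro one_Legendre) simp
    finally show ?thesis by simp
  qed
  have "4 dvd int p * c1" using c1 dvd_mult_left[of 4 L c1] by auto
  from lower_theta_slash[OF this det' z, of t "shifted m f"]
  have "lower t (theta_slash k a' b (int p * c1) d (shifted m f)) z = theta_slash k a b c d (shifted m f) z"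
    by (simp add: a'_def flip: cc)
  moreover have "lower t (theta_slash k a' b (int p * c1) d (shifted m f)) z = lower t (shifted m f) z"
    using inv z by (rule lower_cong)
  ultimately show ?thesis by simp
qed

definition W_const :: complex where
  "W_const = cnj (eps (int p)) / of_real (sqrt (real p))
    * of_int (Legendre (-1) (int p)) * of_int (Legendre L (int p))"

text \<open>The matrix in the definition of \<open>W_op\<close> is \<open>p\<close> times (1 m/p; 0
  1)(1 0; 4M(1-s) 1), because \<open>p^2 n = p + 4 M m\<close>.\<close>

lemma W_op_term:
  "slash k (of_int ((int p)\<^sup>2 * n - 4 * int M * m * s)) (of_int m)
     (of_int (4 * int p * int M * (1 - s))) (of_int (int p))
     (\<lambda>z. csqrt (of_int (4 * int M * (1 - s)) * z + 1)) f z = lower (1 - s) (shifted m f) z"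
  if z: "Im z > 0"
proof -
  define t where "t = 1 - s"
  have p0: "of_nat p \<noteq> (0::complex)" using p_gt_2 by simp
  have pn: "(int p)\<^sup>2 * n = int p + 4 * int M * m"
  proof -
    have "(int p)\<^sup>2 * n = int p * (int p * n - 4 * L * m) + 4 * (int p * L) * m"
      by (simp add: power2_eq_square algebra_simps)
    then show ?thesis by (simp add: bezout_L M_eq)
  qed
  have nz: "of_int (4 * int M * t) * z + 1 \<noteq> (0::complex)"
    using moebius_denominator_nonzero[OF z, of "of_int (4 * int M * t)" 1] by simp
  have "(int p)\<^sup>2 * n - 4 * int M * m * s = int p + 4 * int M * t * m"
    unfolding pn t_def by (simp add: algebra_simps)
  then have "moebius (of_int ((int p)\<^sup>2 * n - 4 * int M * m * s)) (of_int m)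
     (of_int (4 * int p * int M * t)) (of_int (int p)) z
    = (of_int (int p + 4 * int M * t * m) * z + of_int m) / (of_nat p * (of_int (4 * int M * t) * z + 1))"
    by (simp add: moebius_def algebra_simps)
  also have "\<dots> = z / (of_int (4 * int M * t) * z + 1) + of_int m / of_nat p"
    using p0 nz by (simp add: divide_simps) (simp add: algebra_simps)
  also have "z / (of_int (4 * int M * t) * z + 1) = moebius 1 0 (of_int (4 * int M * t)) 1 z"
    by (simp add: moebius_def)
  finally have mo: "moebius (of_int ((int p)\<^sup>2 * n - 4 * int M * m * s)) (of_int m)
     (of_int (4 * int p * int M * t)) (of_int (int p)) z
     = moebius 1 0 (of_int (4 * int M * t)) 1 z + of_int m / of_nat p" .
  have "theta_factor (4 * int M * t) 1 z = csqrt (of_int (4 * int M * t) * z + 1)"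
    by (simp add: theta_factor_def eps_def shimura_symbol_def)
  then show ?thesis using mo
    by (simp add: slash_def lower_def theta_slash_def shifted_def t_def)
qed

lemma W_op_eq:
  assumes f: "f \<in> cusp_forms k (4 * M)" and z: "Im z > 0"
  shows "W_op k M p m n f z = W_const * (\<Sum>t\<in>{0..int p - 1}. lower t (shifted m f) z)"
proof -
  have "W_op k M p m n f z = W_const * (\<Sum>s\<in>{0..int p - 1}. lower (-1 * s + 1) (shifted m f) z)"
    unfolding W_op_def W_op_term[OF z] by (simp add: W_const_def L_def)
  also have "(\<Sum>s\<in>{0..int p - 1}. lower (-1 * s + 1) (shifted m f) z)
    = (\<Sum>s\<in>{0..int p - 1}. lower s (shifted m f) z)"
    using p_gt_2 z by (intro sum_residues_affine lower_shifted_cong[OF f]) auto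
  finally show ?thesis .
qed

lemma W_op_cuspidal:
  assumes f: "cuspidal_everywhere k f"
  shows "cuspidal_everywhere k (W_op k M p m n f)"
proof -
  have p0: "p > 0" using p_gt_2 by simp
  have "cuspidal_everywhere k (slash k (of_int ((int p)\<^sup>2 * n - 4 * int M * m * s)) (of_int m)
     (of_int (4 * int p * int M * (1 - s))) (of_int (int p))
     (\<lambda>z. csqrt (of_int (4 * int M * (1 - s)) * z + 1)) f)" for s
  \<comment> \<open>The determinant is \<open>p^2\<close>, so its power -1/2 gives the constant
    1/p.\<close>
  proof (rule cuspidal_everywhere_slash[OF f, where t = "1 / of_nat p"])
    have "((int p)\<^sup>2 * n - 4 * int M * m * s) * int p - m * (4 * int p * int M * (1 - s))
      = (int p)\<^sup>2 * (int p * n - 4 * L * m)"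
      by (simp add: M_eq power2_eq_square algebra_simps)
    then show "((int p)\<^sup>2 * n - 4 * int M * m * s) * int p - m * (4 * int p * int M * (1 - s)) > 0"
      using p0 by (simp add: bezout_L)
    show "(\<lambda>z. csqrt (of_int (4 * int M * (1 - s)) * z + 1)) holomorphic_on uhp"
      using holomorphic_csqrt_denominator[of "of_int (4 * int M * (1 - s))" 1] by simp
    show "(csqrt (of_int (4 * int M * (1 - s)) * z + 1))\<^sup>2
      = 1 / of_nat p * (of_int (4 * int p * int M * (1 - s)) * z + of_int (int p))" for z
      using p0 by (simp add: field_simps)
  qed (use p0 in simp)
  then have "cuspidal_everywhere k (\<lambda>z. W_const * (\<Sum>s\<in>{0..int p - 1}. 
    slash k (of_int ((int p)\<^sup>2 * n - 4 * int M * m * s)) (of_int m)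
     (of_int (4 * int p * int M * (1 - s))) (of_int (int p))
     (\<lambda>z. csqrt (of_int (4 * int M * (1 - s)) * z + 1)) f z))"
    using p0 by (intro cuspidal_everywhere_cmult cuspidal_everywhere_sum) auto
  then show ?thesis
    by (rule cuspidal_everywhere_cong[rotated]) (simp only: W_op_def W_const_def L_def)
qed

text \<open>A matrix of Gamma_0(4M) sends the summand with index \<open>t\<close> to the one with
  index \<open>a^2 t + e\<close>. As \<open>a\<close> is prime to \<open>p\<close>, this permutes
  the indices modulo \<open>p\<close>.\<close>

lemma W_op_cusp_form:
  assumes f: "f \<in> cusp_forms k (4 * M)"
  shows "W_op k M p m n f \<in> cusp_forms k (4 * M)"
proof (rule cusp_formsI)
  show "cuspidal_everywhere k (W_op k M p m n f)"
    using f by (intro W_op_cuspidal) (simp add: cusp_forms_iff)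
next
  fix a b c d z
  assume det: "a * d - b * c = 1" and c: "int (4 * M) dvd c" and z: "Im z > 0"
  obtain x where x: "c = 4 * (int p * L) * x" using c by (auto simp: M_eq elim: dvdE)
  define c' where "c' = 4 * L * x"
  have c': "c = int p * c'" by (simp add: x c'_def)
  have c4: "4 dvd c" by (simp add: x)
  have pa: "\<not> int p dvd a"
  proof
    assume "int p dvd a"
    then have "int p dvd a * d - b * c" by (simp add: c')
    then show False using det p_gt_2 by simp
  qed
  then have "coprime a (int p)" using prime_int_p prime_imp_coprime coprime_commute by blast
  then have cop: "coprime (a\<^sup>2) (int p)" by simp
  define e where "e = 1 - a * (a + m * c')"
  have term_eq: "theta_slash k a b c d (lower t (shifted m f)) z = lower (a\<^sup>2 * t + e) (shifted m f) z" for t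
  proof -
    have "theta_slash k a b c d (lower t (shifted m f)) z
      = theta_slash k a b (4 * int M * t * a + c) (4 * int M * t * b + d) (shifted m f) z"
      using c4 det z by (rule theta_slash_lower)
    also have "\<dots> = lower (a\<^sup>2 * t + e) (shifted m f) z"
    proof (rule theta_slash_shifted_eq_lower[OF f _ _ _ _ z])
      show "a * (4 * int M * t * b + d) - b * (4 * int M * t * a + c) = 1"
        using det by (simp add: algebra_simps)
      show "4 * int M * t * a + c = int p * (4 * L * t * a + c')"
        by (simp add: c' M_eq algebra_simps)
      show "4 * L dvd 4 * L * t * a + c'" by (simp add: c'_def)
      have "a\<^sup>2 * t + e - (1 - a * (a + m * (4 * L * t * a + c'))) = a\<^sup>2 * t * (1 + 4 * L * m)"
        by (simp add: e_def power2_eq_square algebra_simps)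
      also have "1 + 4 * L * m = int p * n" using bezout_L by simp
      finally show "[a\<^sup>2 * t + e = 1 - a * (a + m * (4 * L * t * a + c'))] (mod int p)"
        by (simp add: cong_iff_dvd_diff)
    qed
    finally show ?thesis .
  qed
  have "theta_slash k a b c d (W_op k M p m n f) z
    = theta_slash k a b c d (\<lambda>z. W_const * (\<Sum>t\<in>{0..int p - 1}. lower t (shifted m f) z)) z"
    using W_op_eq[OF f Im_moebius_pos_det_1[OF z det]] by (simp add: theta_slash_def slash_def)
  also have "\<dots> = W_const * (\<Sum>t\<in>{0..int p - 1}. theta_slash k a b c d (lower t (shifted m f)) z)"
    by (simp only: theta_slash_def slash_def sum_divide_distrib sum_distrib_left times_divide_eq_right)
  also have "\<dots> = W_const * (\<Sum>t\<in>{0..int p - 1}. lower (a\<^sup>2 * t + e) (shifted m f) z)"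
    by (simp add: term_eq)
  also have "(\<Sum>t\<in>{0..int p - 1}. lower (a\<^sup>2 * t + e) (shifted m f) z)
    = (\<Sum>t\<in>{0..int p - 1}. lower t (shifted m f) z)"
    using p_gt_2 cop z by (intro sum_residues_affine lower_shifted_cong[OF f]) auto
  finally show "theta_slash k a b c d (W_op k M p m n f) z = W_op k M p m n f z"
    using W_op_eq[OF f z] by simp
qed simp

end

section \<open>Fourier expansions and the operator \<open>U\<close>\<close>

lemma upper_half_plane_exp_surj:
  assumes "x \<noteq> 0" "norm x < 1"
  obtains z where "Im z > 0" "\<And>n. exp (2 * of_real pi * \<i> * of_nat n * z) = x ^ n"
proof
  define z where "z = Ln x / (2 * of_real pi * \<i>)"
  have "ln (norm x) < 0" using assms by simp
  moreover have "Im z = - ln (norm x) / (2 * pi)"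
    using assms(1) by (simp add: z_def Im_divide power2_eq_square)
  ultimately show "Im z > 0" by (simp add: divide_neg_pos)
  have "exp (2 * of_real pi * \<i> * of_nat n * z) = exp (of_nat n * Ln x)" for n
    by (simp add: z_def)
  then show "exp (2 * of_real pi * \<i> * of_nat n * z) = x ^ n" for n
    using assms(1) by (simp add: exp_of_nat_mult)
qed

text \<open>The point 0 is excluded, since exp never takes this value. A limit recovers
  \<open>c 0 = 0\<close>, and then a nonzero coefficient would force the zero function to be nonzero
  near 0.\<close>

lemma power_series_zero_coeffs:
  fixes c :: "nat \<Rightarrow> complex"
  assumes "\<And>x. x \<noteq> 0 \<Longrightarrow> norm x < 1 \<Longrightarrow> (\<lambda>n. c n * x ^ n) sums 0"
  shows "c n = 0"
proof (rule ccontr)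
  assume n: "c n \<noteq> 0"
  have "((\<lambda>x. 0) \<longlongrightarrow> c 0) (at (0 :: complex))"
    using assms by (intro powser_limit_0_strong[of 1 c]) auto
  then have c0: "c 0 = 0" using tendsto_const tendsto_unique trivial_limit_at by blast
  have sums: "(\<lambda>n. c n * x ^ n) sums 0" if "norm x < 1" for x
  proof (cases "x = 0")
    case True
    then show ?thesis using powser_sums_zero[of c] c0 by simp
  qed (use that assms in auto)
  have "n \<noteq> 0" using n c0 by (cases n) auto
  show False
  proof (rule powser_0_nonzero[of 1 0 c "\<lambda>_. 0" n])
    fix s :: real assume s: "0 < s" "\<And>z :: complex. z \<in> cball 0 s - {0} \<Longrightarrow> (0 :: complex) \<noteq> 0"
    show False using s(2)[of "of_real s"] s(1) by simp
  qed (use sums n \<open>n \<noteq> 0\<close> in auto)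
qed

lemma fourier_expansion_unique:
  fixes a b :: "nat \<Rightarrow> complex"
  assumes "\<And>z. Im z > 0 \<Longrightarrow> (\<lambda>n. a n * exp (2 * of_real pi * \<i> * of_nat n * z)) sums g z"
    and "\<And>z. Im z > 0 \<Longrightarrow> (\<lambda>n. b n * exp (2 * of_real pi * \<i> * of_nat n * z)) sums g z"
  shows "a = b"
proof
  fix n
  have "(\<lambda>n. (a n - b n) * x ^ n) sums 0" if x: "x \<noteq> 0" "norm x < 1" for x
  proof -
    obtain z where z: "Im z > 0" "\<And>n. exp (2 * of_real pi * \<i> * of_nat n * z) = x ^ n"
      using upper_half_plane_exp_surj[OF x] by blast
    show ?thesis
      using sums_diff[OF assms(1)[OF z(1)] assms(2)[OF z(1)]] by (simp add: z(2) left_diff_distrib)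
  qed
  then show "a n = b n" using power_series_zero_coeffs[of "\<lambda>n. a n - b n" n] by simp
qed

text \<open>Translation by 1 multiplies the \<open>n\<close>-th coefficient by
  \<open>\<zeta> n\<close>; by uniqueness it must be 0 unless \<open>\<zeta> n = 1\<close>, that is,
  unless \<open>h\<close> divides \<open>n\<close>.\<close>

lemma cuspidal_periodic_fourier_expansion:
  assumes g: "cuspidal_at_infinity g" and per: "\<And>z. Im z > 0 \<Longrightarrow> g (z + 1) = g z"
  shows "\<exists>b. \<forall>z\<in>uhp. (\<lambda>n. b n * exp (2 * of_real pi * \<i> * of_nat n * z)) sums g z"
proof -
  obtain h a where ha: "h > 0" "a 0 = 0"
    "\<And>z. Im z > 0 \<Longrightarrow> (\<lambda>n. a n * exp (2 * of_real pi * \<i> * of_nat n * z / of_nat h)) sums g z"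
    using g unfolding cuspidal_at_infinity_def by blast
  define \<zeta> where "\<zeta> n = exp (2 * of_real pi * \<i> * of_nat n / of_nat h)" for n
  have h0: "of_nat h \<noteq> (0 :: complex)" using ha(1) by simp
  have "(\<lambda>n. a n * \<zeta> n) = a"
  proof (rule fourier_expansion_unique)
    fix z :: complex assume z: "Im z > 0"
    have hz: "Im (of_nat h * z) > 0" using z ha(1) by simp
    show "(\<lambda>n. a n * exp (2 * of_real pi * \<i> * of_nat n * z)) sums g (of_nat h * z)"
      using ha(3)[OF hz] h0 by (simp add: field_simps)
    have "(\<lambda>n. a n * exp (2 * of_real pi * \<i> * of_nat n * (of_nat h * z + 1) / of_nat h)) sums g (of_nat h * z + 1)"
      using hz by (intro ha(3)) simp
    moreover have "exp (2 * of_real pi * \<i> * of_nat n * (of_nat h * z + 1) / of_nat h)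
      = \<zeta> n * exp (2 * of_real pi * \<i> * of_nat n * z)" for n
      unfolding \<zeta>_def mult_exp_exp using h0 by (simp add: field_simps)
    ultimately show "(\<lambda>n. a n * \<zeta> n * exp (2 * of_real pi * \<i> * of_nat n * z)) sums g (of_nat h * z)"
      using per[OF hz] by (simp add: mult.assoc)
  qed
  then have a0: "a n = 0" if "\<not> h dvd n" for n
    using that complex_root_unity_eq_1[of h n] ha(1) fun_cong[of "\<lambda>n. a n * \<zeta> n" a n]
    by (auto simp: \<zeta>_def)
  have "(\<lambda>n. a (h * n) * exp (2 * of_real pi * \<i> * of_nat n * z)) sums g z" if z: "Im z > 0" for z
  proof -
    have "(\<lambda>n. a (h * n) * exp (2 * of_real pi * \<i> * of_nat (h * n) * z / of_nat h)) sums g z"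
      using ha(3)[OF z] sums_mono_reindex[of "\<lambda>n. h * n" "\<lambda>n. a n * exp (2 * of_real pi * \<i> * of_nat n * z / of_nat h)" "g z"]
        a0 ha(1) by (force simp: strict_mono_def dvd_def)
    then show ?thesis using h0 by (simp add: field_simps)
  qed
  then show ?thesis by (intro exI[of _ "\<lambda>n. a (h * n)"]) simp
qed

lemma cusp_form_translate:
  assumes "f \<in> cusp_forms k N" "Im z > 0"
  shows "f (z + of_int j) = f z"
proof -
  have "f (moebius (of_int 1) (of_int j) (of_int 0) (of_int 1) z) = theta_factor 0 1 z ^ (2 * k + 1) * f z"
  proof -
    have "f (moebius a b c d z) = theta_factor c d z ^ (2 * k + 1) * f z"
      if "a * d - b * c = 1" "int N dvd c" for a b c d :: int
      using assms that unfolding cusp_forms_def by blast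
    from this[of 1 1 j 0] show ?thesis by simp
  qed
  then show ?thesis by (simp add: moebius_def)
qed

lemma sum_roots_of_unity:
  assumes "r > 0"
  shows "(\<Sum>b<r. exp (2 * of_real pi * \<i> * of_nat n * of_nat b / of_nat r))
    = (if r dvd n then of_nat r else (0 :: complex))"
proof -
  define \<zeta> where "\<zeta> = exp (2 * of_real pi * \<i> * of_nat n / of_nat r :: complex)"
  have "exp (2 * of_real pi * \<i> * of_nat n * of_nat b / of_nat r) = \<zeta> ^ b" for b
    unfolding \<zeta>_def by (subst exp_of_nat_mult[symmetric]) (simp add: mult_ac)
  then have sum: "(\<Sum>b<r. exp (2 * of_real pi * \<i> * of_nat n * of_nat b / of_nat r)) = (\<Sum>b<r. \<zeta> ^ b)"
    by simp
  have \<zeta>1: "\<zeta> = 1 \<longleftrightarrow> r dvd n" unfolding \<zeta>_def using assms by (intro complex_root_unity_eq_1) simp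
  have "\<zeta> ^ r = exp (2 * of_real pi * \<i> * of_nat n)"
    unfolding \<zeta>_def using assms by (subst exp_of_nat_mult[symmetric]) simp
  also have "\<dots> = 1" using complex_root_unity_eq_1[of 1 n] by simp
  finally have "\<zeta> ^ r = 1" .
  then show ?thesis using \<zeta>1 unfolding sum by (auto simp: geometric_sum)
qed

text \<open>Once the description in \<open>fourier_coeffs\<close> is identified by uniqueness,
  averaging over translates selects the exponents divisible by \<open>r\<close> through the
  orthogonality of roots of unity.\<close>

lemma U_op_eq:
  assumes f: "f \<in> cusp_forms k N" and r: "r > 0" and z: "Im z > 0"
  shows "U_op r f z = (\<Sum>b<r. f ((z + of_nat b) / of_nat r)) / of_nat r"
proof -
  have "cuspidal_at_infinity (slash k a b c d (\<lambda>z. csqrt (of_int c * z + of_int d)) f)"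
    if "a * d - b * c = 1" for a b c d :: int
    using f that unfolding cusp_forms_def by blast
  from this[of 1 1 0 0] have "cuspidal_at_infinity (slash k 1 0 0 1 (\<lambda>z. 1) f)" by simp
  moreover have "slash k 1 0 0 1 (\<lambda>z. 1) f = f" by (simp add: slash_def moebius_def fun_eq_iff)
  ultimately have "cuspidal_at_infinity f" by simp
  moreover have "f (z + 1) = f z" if "Im z > 0" for z
    using cusp_form_translate[OF f that, of 1] by simp
  ultimately have "\<exists>a. \<forall>z\<in>uhp. (\<lambda>n. a n * exp (2 * of_real pi * \<i> * of_nat n * z)) sums f z"
    by (rule cuspidal_periodic_fourier_expansion)
  then obtain a :: "nat \<Rightarrow> complex" where a:
    "\<And>z. Im z > 0 \<Longrightarrow> (\<lambda>n. a n * exp (2 * of_real pi * \<i> * of_nat n * z)) sums f z"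
    by auto
  have "fourier_coeffs f = a" unfolding fourier_coeffs_def
  proof (rule the_equality)
    show "\<forall>z\<in>uhp. (\<lambda>n. a n * exp (2 * of_real pi * \<i> * of_nat n * z)) sums f z" using a by simp
    show "b = a" if "\<forall>z\<in>uhp. (\<lambda>n. b n * exp (2 * of_real pi * \<i> * of_nat n * z)) sums f z" for b
      using that a by (intro fourier_expansion_unique[of b f a]) auto
  qed
  have r0: "of_nat r \<noteq> (0 :: complex)" using r by simp
  have "(\<lambda>n. \<Sum>b<r. a n * exp (2 * of_real pi * \<i> * of_nat n * ((z + of_nat b) / of_nat r)))
      sums (\<Sum>b<r. f ((z + of_nat b) / of_nat r))"
    using z r by (intro sums_sum a) (simp add: Im_divide_of_nat)
  moreover have "(\<Sum>b<r. a n * exp (2 * of_real pi * \<i> * of_nat n * ((z + of_nat b) / of_nat r)))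
      = (if r dvd n then of_nat r * a n * exp (2 * of_real pi * \<i> * of_nat n * z / of_nat r) else 0)" for n
  proof -
    have "exp (2 * of_real pi * \<i> * of_nat n * ((z + of_nat b) / of_nat r))
      = exp (2 * of_real pi * \<i> * of_nat n * z / of_nat r)
        * exp (2 * of_real pi * \<i> * of_nat n * of_nat b / of_nat r)" for b
      unfolding mult_exp_exp by (simp add: ring_distribs add_divide_distrib)
    then have "(\<Sum>b<r. a n * exp (2 * of_real pi * \<i> * of_nat n * ((z + of_nat b) / of_nat r)))
      = a n * exp (2 * of_real pi * \<i> * of_nat n * z / of_nat r)
        * (\<Sum>b<r. exp (2 * of_real pi * \<i> * of_nat n * of_nat b / of_nat r))"
      by (simp only: sum_distrib_left mult.assoc)
    then show ?thesis unfolding sum_roots_of_unity[OF r] by simp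
  qed
  ultimately have "(\<lambda>n. if r dvd n then of_nat r * a n * exp (2 * of_real pi * \<i> * of_nat n * z / of_nat r) else 0)
      sums (\<Sum>b<r. f ((z + of_nat b) / of_nat r))" by simp
  then have "(\<lambda>n. of_nat r * a (r * n) * exp (2 * of_real pi * \<i> * of_nat (r * n) * z / of_nat r))
      sums (\<Sum>b<r. f ((z + of_nat b) / of_nat r))"
    using r sums_mono_reindex[of "\<lambda>n. r * n" "\<lambda>n. if r dvd n then of_nat r * a n * exp (2 * of_real pi * \<i> * of_nat n * z / of_nat r) else 0"]
    by (force simp: strict_mono_def dvd_def)
  then have "(\<lambda>n. of_nat r * a (r * n) * exp (2 * of_real pi * \<i> * of_nat (r * n) * z / of_nat r) / of_nat r)
      sums ((\<Sum>b<r. f ((z + of_nat b) / of_nat r)) / of_nat r)"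
    by (rule sums_divide)
  then have "(\<lambda>n. a (r * n) * exp (2 * of_real pi * \<i> * of_nat n * z))
      sums ((\<Sum>b<r. f ((z + of_nat b) / of_nat r)) / of_nat r)"
    using r0 by (simp add: field_simps)
  then show ?thesis unfolding U_op_def \<open>fourier_coeffs f = a\<close> by (rule sums_unique[symmetric])
qed

lemma sum_int_interval: "(\<Sum>b<r. g (int b)) = (\<Sum>b\<in>{0..int r - 1}. g b)"
  by (rule sum.reindex_bij_witness[of _ nat int]) auto

lemma sum_residues_multiple:
  fixes g :: "int \<Rightarrow> 'a :: comm_semiring_1"
  assumes r: "r > 0" and g: "\<And>x y. [x = y] (mod int r) \<Longrightarrow> g x = g y"
  shows "(\<Sum>b\<in>{0..int (q * r) - 1}. g b) = of_nat q * (\<Sum>b\<in>{0..int r - 1}. g b)"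
proof -
  have "(\<Sum>b\<in>{i * r..<i * r + r}. g (int b)) = (\<Sum>b<r. g (int b))" for i
  proof (rule sum.reindex_bij_witness[of _ "\<lambda>b. i * r + b" "\<lambda>b. b - i * r"])
    fix b assume b: "b \<in> {i * r..<i * r + r}"
    then show "g (int (b - i * r)) = g (int b)"
      by (intro g) (simp add: cong_iff_dvd_diff of_nat_diff)
  qed auto
  then have "(\<Sum>b<q * r. g (int b)) = of_nat q * (\<Sum>b<r. g (int b))"
    by (simp flip: sum.nat_group)
  then show ?thesis unfolding sum_int_interval .
qed

section \<open>Evaluation of the summands of W, the involution, and the relation with U\<close>

context exact_prime_level
begin

lemma shifted_dvd:
  assumes "f \<in> cusp_forms k (4 * M)" "int p dvd u" "Im z > 0"
  shows "shifted u f z = f z"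
proof -
  obtain j where "u = int p * j" using assms(2) by (auto elim: dvdE)
  then have "of_int u / of_nat p = (of_int j :: complex)" using p_gt_2 by simp
  then show ?thesis using cusp_form_translate[OF assms(1,3), of j] by (simp add: shifted_def)
qed

lemma p_not_dvd_residue:
  assumes "u \<in> {1..int p - 1}"
  shows "\<not> int p dvd u"
  using assms by (auto dest: zdvd_imp_le)

text \<open>From \<open>u * (1 - t) = m\<close> and \<open>4 * L * m = -1\<close> modulo
  \<open>p\<close> one gets \<open>m * (1 - u * 4 * L * t) = u\<close>. This is both the condition
  of \<open>lower_shifted\<close> and, up to the square of (m/p), the value of its symbol.\<close>

lemma lower_shifted_m:
  assumes f: "f \<in> cusp_forms k (4 * M)" and t: "int p dvd u * (1 - t) - m" and z: "Im z > 0"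
  shows "lower t (shifted m f) z = of_int (Legendre (m * u) (int p)) * shifted u f z"
proof -
  have Lm: "4 * L * m = int p * n - 1" using bezout_L by simp
  have "m - u - m * u * (4 * L * t) = - (u * (1 - t) - m) - u * t * (1 + 4 * L * m)"
    by (simp add: algebra_simps)
  also have "\<dots> = - (u * (1 - t) - m) - int p * (u * t * n)" unfolding Lm by simp
  finally have eq: "m - u - m * u * (4 * L * t) = - (u * (1 - t) - m) - int p * (u * t * n)" .
  have "int p dvd m - u - m * u * (4 * L * t)" unfolding eq
    using t by (intro dvd_diff) (simp_all only: dvd_minus_iff dvd_triv_left)
  from lower_shifted[OF f this z]
  have "lower t (shifted m f) z = of_int (Legendre (1 - u * (4 * L * t)) (int p)) * shifted u f z" .
  also have "Legendre (1 - u * (4 * L * t)) (int p) = Legendre (m * m) (int p) * Legendre (1 - u * (4 * L * t)) (int p)"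
    using Legendre_p_square[OF p_not_dvd_m] by simp
  also have "\<dots> = Legendre m (int p) * Legendre (m * (1 - u * (4 * L * t))) (int p)"
    by (simp add: Legendre_p_mult)
  also have "Legendre (m * (1 - u * (4 * L * t))) (int p) = Legendre u (int p)"
    using \<open>int p dvd m - u - m * u * (4 * L * t)\<close> by (intro Legendre_p_cong) (simp add: algebra_simps)
  finally show ?thesis by (simp add: Legendre_p_mult)
qed

lemma shifted_eq_lower:
  assumes f: "f \<in> cusp_forms k (4 * M)" and t: "int p dvd u * (1 - t) - m" and z: "Im z > 0"
  shows "shifted u f z = of_int (Legendre (m * u) (int p)) * lower t (shifted m f) z"
proof -
  have "\<not> int p dvd u"
  proof
    assume "int p dvd u"
    then have "int p dvd u * (1 - t) - (u * (1 - t) - m)" using t by (rule dvd_diff[OF dvd_mult2])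
    also have "u * (1 - t) - (u * (1 - t) - m) = m" by simp
    finally show False using p_not_dvd_m by simp
  qed
  then have "\<not> int p dvd m * u" using p_not_dvd_m prime_int_p prime_dvd_mult_iff by blast
  then have "Legendre (m * u) (int p) * Legendre (m * u) (int p) = 1"
    using Legendre_p_square Legendre_p_mult by metis
  then have "of_int (Legendre (m * u) (int p)) * of_int (Legendre (m * u) (int p)) = (1 :: complex)"
    by (simp flip: of_int_mult)
  then show ?thesis using lower_shifted_m[OF assms] by (simp flip: mult.assoc)
qed

lemma exists_lower_index:
  assumes "\<not> int p dvd u"
  obtains t where "t \<in> {0..int p - 1} - {1}" "int p dvd u * (1 - t) - m"
proof -
  have "coprime u (int p)" using assms prime_int_p prime_imp_coprime coprime_commute by blast
  then obtain y where y: "[u * y = 1] (mod int p)" using cong_solve_coprime_int by blast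
  define t where "t = (1 - m * y) mod int p"
  have t: "t \<in> {0..int p - 1}" using p_gt_2 by (simp add: t_def)
  have "[u * (1 - t) = u * (1 - (1 - m * y))] (mod int p)"
    unfolding t_def by (intro cong_mult cong_diff) (simp_all add: cong_def)
  also have "u * (1 - (1 - m * y)) = m * (u * y)" by (simp add: algebra_simps)
  also have "[\<dots> = m * 1] (mod int p)" by (intro cong_mult y) simp
  finally have *: "int p dvd u * (1 - t) - m" by (simp add: cong_iff_dvd_diff)
  moreover have "t \<noteq> 1" using * p_not_dvd_m by auto
  ultimately show thesis using that[of t] t by simp
qed

text \<open>The map is \<open>1 - m / u\<close> modulo \<open>p\<close>; it never takes the value 1
  because \<open>p\<close> does not divide \<open>m\<close>. Injectivity and equal cardinalities
  suffice.\<close>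

lemma lower_index_bij:
  "\<exists>\<tau>. bij_betw \<tau> {1..int p - 1} ({0..int p - 1} - {1})
    \<and> (\<forall>u\<in>{1..int p - 1}. int p dvd u * (1 - \<tau> u) - m)"
proof -
  have "\<forall>u\<in>{1..int p - 1}. \<exists>t. t \<in> {0..int p - 1} - {1} \<and> int p dvd u * (1 - t) - m"
    using exists_lower_index[OF p_not_dvd_residue] by blast
  from bchoice[OF this] obtain \<tau> where "\<forall>u\<in>{1..int p - 1}. \<tau> u \<in> {0..int p - 1} - {1} \<and> int p dvd u * (1 - \<tau> u) - m"
    by blast
  then have \<tau>: "\<And>u. u \<in> {1..int p - 1} \<Longrightarrow> \<tau> u \<in> {0..int p - 1} - {1}"
    "\<And>u. u \<in> {1..int p - 1} \<Longrightarrow> int p dvd u * (1 - \<tau> u) - m" by blast+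
  have "inj_on \<tau> {1..int p - 1}"
  proof (rule inj_onI)
    fix u v assume uv: "u \<in> {1..int p - 1}" "v \<in> {1..int p - 1}" "\<tau> u = \<tau> v"
    have "int p dvd (u * (1 - \<tau> u) - m) - (v * (1 - \<tau> v) - m)"
      using \<tau>(2)[OF uv(1)] \<tau>(2)[OF uv(2)] by (rule dvd_diff)
    then have "int p dvd (u - v) * (1 - \<tau> u)" using uv(3) by (simp add: algebra_simps)
    moreover have "\<not> int p dvd 1 - \<tau> u"
    proof
      assume "int p dvd 1 - \<tau> u"
      then have "int p dvd u * (1 - \<tau> u) - (u * (1 - \<tau> u) - m)"
        using \<tau>(2)[OF uv(1)] by (rule dvd_diff[OF dvd_mult])
      also have "u * (1 - \<tau> u) - (u * (1 - \<tau> u) - m) = m" by simp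
      finally show False using p_not_dvd_m by simp
    qed
    ultimately have "int p dvd u - v" using prime_int_p prime_dvd_mult_iff by blast
    moreover have "\<bar>u - v\<bar> < int p" using uv by auto
    ultimately show "u = v" using dvd_imp_le_int[of "u - v" "int p"] by fastforce
  qed
  moreover have "card ({0..int p - 1} - {1}) = card {1..int p - 1}"
    using p_gt_2 by (simp add: card_Diff_singleton_if)
  moreover have "\<tau> ` {1..int p - 1} \<subseteq> {0..int p - 1} - {1}" using \<tau>(1) by auto
  ultimately have "bij_betw \<tau> {1..int p - 1} ({0..int p - 1} - {1})"
    unfolding bij_betw_def by (intro conjI card_subset_eq) (simp_all add: card_image)
  then show ?thesis using \<tau>(2) by blast
qed

lemma sum_Legendre_m_mult: "(\<Sum>u\<in>{1..int p - 1}. Legendre (m * u) (int p)) = 0"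
proof -
  have "coprime m (int p)" using p_not_dvd_m prime_int_p prime_imp_coprime coprime_commute by blast
  then have "(\<Sum>u\<in>{0..int p - 1}. Legendre (m * u + 0) (int p)) = (\<Sum>u\<in>{0..int p - 1}. Legendre u (int p))"
    using p_gt_2 by (intro sum_residues_affine) (auto intro: Legendre_cong)
  moreover have "{0..int p - 1} = insert 0 {1..int p - 1}" using p_gt_2 by auto
  ultimately show ?thesis
    using sum_Legendre[OF prime_p p_gt_2] by (simp add: Legendre_def cong_def)
qed

text \<open>Since \<open>m / u = 1 - \<tau> u\<close>, the product \<open>u * (u + m)\<close> equals
  \<open>u^2 (2 - \<tau> u)\<close>. What remains is a complete character sum, which is 0, without
  its term (1/p) at \<open>t = 1\<close>.\<close>

lemma jacobsthal_sum: "(\<Sum>u\<in>{1..int p - 1}. Legendre (u * (u + m)) (int p)) = -1"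
proof -
  obtain \<tau> where \<tau>: "bij_betw \<tau> {1..int p - 1} ({0..int p - 1} - {1})"
    "\<And>u. u \<in> {1..int p - 1} \<Longrightarrow> int p dvd u * (1 - \<tau> u) - m"
    using lower_index_bij by blast
  have "Legendre (u * (u + m)) (int p) = Legendre (2 - \<tau> u) (int p)" if u: "u \<in> {1..int p - 1}" for u
  proof -
    have "u * (u + m) - u * u * (2 - \<tau> u) = - u * (u * (1 - \<tau> u) - m)" by (simp add: algebra_simps)
    then have "int p dvd u * (u + m) - u * u * (2 - \<tau> u)" using \<tau>(2)[OF u] by simp
    then have "Legendre (u * (u + m)) (int p) = Legendre (u * u * (2 - \<tau> u)) (int p)"
      by (rule Legendre_p_cong)
    also have "\<dots> = Legendre (u * u) (int p) * Legendre (2 - \<tau> u) (int p)"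
      by (rule Legendre_p_mult)
    finally show ?thesis
      using Legendre_p_square[OF p_not_dvd_residue[OF u]] by simp
  qed
  then have "(\<Sum>u\<in>{1..int p - 1}. Legendre (u * (u + m)) (int p))
    = (\<Sum>u\<in>{1..int p - 1}. Legendre (2 - \<tau> u) (int p))" by simp
  also have "\<dots> = (\<Sum>t\<in>{0..int p - 1} - {1}. Legendre (2 - t) (int p))"
    using \<tau>(1) by (rule sum.reindex_bij_betw)
  also have "\<dots> = (\<Sum>t\<in>{0..int p - 1}. Legendre (-1 * t + 2) (int p)) - Legendre 1 (int p)"
    using p_gt_2 by (simp add: sum_diff1)
  also have "(\<Sum>t\<in>{0..int p - 1}. Legendre (-1 * t + 2) (int p)) = (\<Sum>t\<in>{0..int p - 1}. Legendre t (int p))"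
    using p_gt_2 by (intro sum_residues_affine) (auto intro: Legendre_cong)
  also have "\<dots> - Legendre 1 (int p) = -1"
    using sum_Legendre[OF prime_p p_gt_2] p_gt_2 by (simp add: one_Legendre)
  finally show ?thesis .
qed

text \<open>All but one of the summands of \<open>W\<close> are translates, so that \<open>W\<close> is, up to a constant, the
  twist by the quadratic character modulo \<open>p\<close> plus one exceptional term.\<close>

lemma sum_lower_shifted_m:
  assumes f: "f \<in> cusp_forms k (4 * M)" and z: "Im z > 0"
  shows "(\<Sum>t\<in>{0..int p - 1}. lower t (shifted m f) z)
    = (\<Sum>u\<in>{1..int p - 1}. of_int (Legendre (m * u) (int p)) * shifted u f z) + lower 1 (shifted m f) z"
proof -
  obtain \<tau> where \<tau>: "bij_betw \<tau> {1..int p - 1} ({0..int p - 1} - {1})"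
    "\<And>u. u \<in> {1..int p - 1} \<Longrightarrow> int p dvd u * (1 - \<tau> u) - m"
    using lower_index_bij by blast
  have "(\<Sum>t\<in>{0..int p - 1}. lower t (shifted m f) z)
    = (\<Sum>t\<in>{0..int p - 1} - {1}. lower t (shifted m f) z) + lower 1 (shifted m f) z"
    using p_gt_2 by (simp add: sum_diff1)
  also have "(\<Sum>t\<in>{0..int p - 1} - {1}. lower t (shifted m f) z)
    = (\<Sum>u\<in>{1..int p - 1}. lower (\<tau> u) (shifted m f) z)"
    using \<tau>(1) by (rule sum.reindex_bij_betw[symmetric])
  also have "\<dots> = (\<Sum>u\<in>{1..int p - 1}. of_int (Legendre (m * u) (int p)) * shifted u f z)"
    using \<tau>(2) f z by (intro sum.cong lower_shifted_m) auto
  finally show ?thesis .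
qed

text \<open>For \<open>w\<close> prime to \<open>p\<close> the translate is, up to sign, an image of
  the translate by \<open>m\<close> under some \<open>lower v\<close>, which only shifts the
  summation index. For \<open>w\<close> divisible by \<open>p\<close> it is \<open>f\<close> itself,
  fixed by all \<open>p\<close> operators.\<close>

lemma sum_lower_shifted:
  assumes f: "f \<in> cusp_forms k (4 * M)" and z: "Im z > 0"
  shows "(\<Sum>t\<in>{0..int p - 1}. lower t (shifted w f) z)
    = of_int (Legendre (m * w) (int p)) * (\<Sum>t\<in>{0..int p - 1}. lower t (shifted m f) z)
      + (if int p dvd w then of_nat p * f z else 0)"
proof (cases "int p dvd w")
  case True
  have "lower t (shifted w f) z = f z" for t
    using lower_cong[OF shifted_dvd[OF f True] z, where t = t] lower_cusp_form[OF f z] by simp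
  moreover have "Legendre (m * w) (int p) = 0" using True by (simp add: Legendre_def cong_0_iff)
  ultimately show ?thesis using True by simp
next
  case False
  then obtain v where v: "int p dvd w * (1 - v) - m" using exists_lower_index by blast
  have "lower t (shifted w f) z = of_int (Legendre (m * w) (int p)) * lower (1 * t + v) (shifted m f) z" for t
    using lower_cong[OF shifted_eq_lower[OF f v] z, where t = t] lower_lower[OF z]
    by (simp add: lower_cmult)
  moreover have "(\<Sum>t\<in>{0..int p - 1}. lower (1 * t + v) (shifted m f) z)
    = (\<Sum>t\<in>{0..int p - 1}. lower t (shifted m f) z)"
    using p_gt_2 z by (intro sum_residues_affine lower_shifted_cong[OF f]) auto
  ultimately show ?thesis using False by (simp flip: sum_distrib_left)
qed

text \<open>The quotient of \<open>theta_factor (4 * L) p\<close> at \<open>p^2 z\<close> by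
  \<open>csqrt (4 * M * z + 1)\<close>: the denominator there is \<open>p (4 M z + 1)\<close>, and
  (4L/p) = (L/p).\<close>

definition K_const :: complex where
  "K_const = inverse (eps (int p)) * of_int (Legendre L (int p)) * of_real (sqrt (real p))"

lemma p_not_dvd_L: "\<not> int p dvd L"
  using p_not_dvd_4L by auto

lemma K_const_nonzero: "K_const \<noteq> 0"
  using p_not_dvd_L p_gt_2 by (simp add: K_const_def eps_def Legendre_def cong_0_iff)

text \<open>The product (n m; 4L p)(p^2 0; 0 1) is \<open>p\<close> times (1 m/p; 0 1)(1 0; 4M 1),
  by the Bezout relation.\<close>

lemma lower_1_shifted_m:
  assumes z: "Im z > 0"
  shows "lower 1 (shifted m f) z
    = K_const ^ (2 * k + 1) * theta_slash k n m (4 * L) (int p) f ((of_nat p)\<^sup>2 * z)"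
proof -
  have p0: "of_nat p \<noteq> (0 :: complex)" using p_gt_2 by simp
  have nz: "4 * of_nat M * z + 1 \<noteq> (0 :: complex)"
    using moebius_denominator_nonzero[OF z, of "4 * of_nat M" 1] by simp
  have Mc: "(of_nat M :: complex) = of_nat p * of_int L"
    using arg_cong[OF M_eq, of "of_int :: int \<Rightarrow> complex"] by simp
  have "(of_nat p)\<^sup>2 * of_int n = of_nat p + 4 * of_nat M * (of_int m :: complex)"
  proof -
    have "of_nat p * of_int n - 4 * of_int L * of_int m = (1 :: complex)"
      using arg_cong[OF bezout_L, of "of_int :: int \<Rightarrow> complex"] by simp
    then have "of_nat p * of_int n = 1 + 4 * of_int L * (of_int m :: complex)" by (simp add: algebra_simps)
    then have "of_nat p * (of_nat p * of_int n) = of_nat p * (1 + 4 * of_int L * (of_int m :: complex))" by simp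
    then show ?thesis by (simp add: Mc power2_eq_square algebra_simps)
  qed
  then have "moebius (of_int n) (of_int m) (of_int (4 * L)) (of_int (int p)) ((of_nat p)\<^sup>2 * z)
    = ((of_nat p + 4 * of_nat M * of_int m) * z + of_int m) / (of_nat p * (4 * of_nat M * z + 1))"
    by (simp add: moebius_def Mc power2_eq_square algebra_simps)
  also have "\<dots> = z / (4 * of_nat M * z + 1) + of_int m / of_nat p"
    using p0 nz by (simp add: divide_simps) (simp add: algebra_simps)
  finally have mo: "moebius (of_int n) (of_int m) (of_int (4 * L)) (of_int (int p)) ((of_nat p)\<^sup>2 * z)
    = z / (4 * of_nat M * z + 1) + of_int m / of_nat p" .
  have sq: "csqrt (of_int (4 * L) * ((of_nat p)\<^sup>2 * z) + of_int (int p))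
    = of_real (sqrt (real p)) * csqrt (4 * of_nat M * z + 1)"
  proof -
    have "of_int (4 * L) * ((of_nat p)\<^sup>2 * z) + of_int (int p) = of_real (real p) * (4 * of_nat M * z + 1)"
      by (simp add: Mc power2_eq_square algebra_simps)
    moreover have "csqrt (of_real (real p) * (4 * of_nat M * z + 1))
      = of_real (sqrt (real p)) * csqrt (4 * of_nat M * z + 1)"
    proof (rule csqrt_unique)
      show "(of_real (sqrt (real p)) * csqrt (4 * of_nat M * z + 1))\<^sup>2 = of_real (real p) * (4 * of_nat M * z + 1)"
        by (simp add: power_mult_distrib flip: of_real_power)
      show "0 < Re (of_real (sqrt (real p)) * csqrt (4 * of_nat M * z + 1)) \<or>
        Re (of_real (sqrt (real p)) * csqrt (4 * of_nat M * z + 1)) = 0 \<and>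
        0 \<le> Im (of_real (sqrt (real p)) * csqrt (4 * of_nat M * z + 1))"
        using csqrt_principal[of "4 * of_nat M * z + 1"] p_gt_2
        by (simp add: zero_less_mult_iff zero_le_mult_iff del: csqrt.simps)
    qed
    ultimately show ?thesis by simp
  qed
  have "shimura_symbol (4 * L) (int p) = Legendre (2 * 2 * L) (int p)"
    by (simp add: shimura_symbol_def jacobi_symbol_prime prime_p)
  also have "\<dots> = Legendre L (int p)"
  proof -
    have "\<not> int p dvd 2" using p_gt_2 by (auto dest: zdvd_imp_le)
    then show ?thesis using Legendre_p_square[of 2] Legendre_p_mult[of "2 * 2" L] by simp
  qed
  finally have "theta_factor (4 * L) (int p) ((of_nat p)\<^sup>2 * z) = K_const * csqrt (4 * of_nat M * z + 1)"
    unfolding theta_factor_def sq by (simp add: K_const_def)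
  then have "theta_slash k n m (4 * L) (int p) f ((of_nat p)\<^sup>2 * z)
    = f (z / (4 * of_nat M * z + 1) + of_int m / of_nat p)
      / (K_const * csqrt (4 * of_nat M * z + 1)) ^ (2 * k + 1)"
    unfolding theta_slash_def slash_def by (simp only: mo)
  moreover have "lower 1 (shifted m f) z = f (z / (4 * of_nat M * z + 1) + of_int m / of_nat p)
      / csqrt (4 * of_nat M * z + 1) ^ (2 * k + 1)"
    by (simp add: lower_def theta_slash_def slash_def shifted_def moebius_def theta_factor_def eps_def shimura_symbol_def)
  ultimately show ?thesis using K_const_nonzero by (simp only: power_mult_distrib) simp
qed

lemma theta_slash_translate:
  assumes z: "Im z > 0"
  shows "theta_slash k n m (4 * L) (int p) f (z + of_int j)
    = theta_slash k n (n * j + m) (4 * L) (4 * L * j + int p) f z"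
proof -
  have "theta_row (4 * L) (int p)" using bezout_L by (intro theta_row_det[of _ n _ m]) (auto simp: algebra_simps)
  from theta_slash_comp[OF this, of 0 1 1 j z k n m f] z
  have "theta_slash k 1 j 0 1 (theta_slash k n m (4 * L) (int p) f) z
    = theta_slash k n (n * j + m) (4 * L) (4 * L * j + int p) f z" by simp
  moreover have "theta_slash k 1 j 0 1 g z = g (z + of_int j)" for g
    by (simp add: theta_slash_def slash_def moebius_def)
  ultimately show ?thesis by simp
qed

lemma det_translate: "n * (4 * L * j + int p) - (n * j + m) * (4 * L) = 1"
  using bezout_L by (simp add: algebra_simps)

lemma theta_slash_translate_cong:
  assumes f: "f \<in> cusp_forms k (4 * M)" and z: "Im z > 0" and ij: "[i = j] (mod int p)"
  shows "theta_slash k n m (4 * L) (int p) f (z + of_int i) = theta_slash k n m (4 * L) (int p) f (z + of_int j)"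
  unfolding theta_slash_translate[OF z]
proof (rule theta_slash_eq[OF f])
  have "4 * L * (4 * L * j + int p) - (4 * L * i + int p) * (4 * L) = 4 * L * (4 * L * (j - i))"
    by (simp add: algebra_simps)
  moreover have "int p dvd 4 * L * (j - i)" using ij by (simp add: cong_iff_dvd_diff dvd_diff_commute)
  ultimately show "int (4 * M) dvd 4 * L * (4 * L * j + int p) - (4 * L * i + int p) * (4 * L)"
    by (simp only: dvd_4M_iff)
qed (use z det_translate in auto)

text \<open>The translate of (n m; 4L p) by \<open>j\<close> lies in the coset of the representative
  with \<open>s = - j\<close>: modulo \<open>p\<close> the lower right entries agree, as
  \<open>p\<close> and \<open>n * p\<close> vanish.\<close>

lemma sum_theta_slash_translate:
  assumes f: "f \<in> cusp_forms k (4 * M)" and z: "Im z > 0"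
  shows "(\<Sum>j\<in>{0..int p - 1}. theta_slash k n m (4 * L) (int p) f (z + of_int j)) = Q_op k M p m n f z"
proof -
  have "trace f z = f z + (\<Sum>s\<in>{0..int p - 1}. theta_slash k 1 (m - s) (4 * L) (n * int p - 4 * L * s) f z)"
    unfolding trace_def by (subst sum_trace_reps) simp
  then have "Q_op k M p m n f z = (\<Sum>s\<in>{0..int p - 1}. theta_slash k 1 (m - s) (4 * L) (n * int p - 4 * L * s) f z)"
    by (simp add: trace_eq_Q_op)
  also have "\<dots> = (\<Sum>s\<in>{0..int p - 1}. theta_slash k n m (4 * L) (int p) f (z + of_int (-1 * s + 0)))"
    unfolding theta_slash_translate[OF z]
  proof (intro sum.cong refl theta_slash_eq[OF f])
    fix s
    have "4 * L * (4 * L * (-1 * s + 0) + int p) - (n * int p - 4 * L * s) * (4 * L)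
      = 4 * L * (int p * (1 - n))" by (simp add: algebra_simps)
    then show "int (4 * M) dvd 4 * L * (4 * L * (-1 * s + 0) + int p) - (n * int p - 4 * L * s) * (4 * L)"
      by (simp only: dvd_4M_iff dvd_triv_left)
    show "1 * (n * int p - 4 * L * s) - (m - s) * (4 * L) = 1"
      using bezout_L by (simp add: algebra_simps)
    show "n * (4 * L * (-1 * s + 0) + int p) - (n * (-1 * s + 0) + m) * (4 * L) = 1"
      by (rule det_translate)
  qed (use z in auto)
  also have "\<dots> = (\<Sum>j\<in>{0..int p - 1}. theta_slash k n m (4 * L) (int p) f (z + of_int j))"
    using p_gt_2 by (intro sum_residues_affine theta_slash_translate_cong[OF f z]) auto
  finally show ?thesis by simp
qed

text \<open>A translation by j/p becomes one by \<open>p * j\<close> at \<open>p^2 z\<close>, which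
  does not change the coset of (n m; 4L p).\<close>

lemma lower_1_shifted_m_translate:
  assumes f: "f \<in> cusp_forms k (4 * M)" and z: "Im z > 0"
  shows "lower 1 (shifted m f) (z + of_int j / of_nat p) = lower 1 (shifted m f) z"
proof -
  have p0: "of_nat p \<noteq> (0 :: complex)" using p_gt_2 by simp
  have z1: "Im (z + of_int j / of_nat p) > 0" using z by simp
  have z2: "Im ((of_nat p)\<^sup>2 * z) > 0"
    using z p_gt_2 by (simp add: flip: of_nat_power)
  have "(of_nat p)\<^sup>2 * (z + of_int j / of_nat p) = (of_nat p)\<^sup>2 * z + of_int (int p * j)"
    using p0 by (simp add: power2_eq_square field_simps)
  then show ?thesis
    using theta_slash_translate_cong[OF f z2, of "int p * j" 0]
    by (simp add: lower_1_shifted_m[OF z] lower_1_shifted_m[OF z1] cong_0_iff)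
qed

lemma W_const_square: "W_const * W_const * (of_int (Legendre (-1) (int p)) * of_nat p) = 1"
proof -
  have "complex_of_real (sqrt (real p)) * of_real (sqrt (real p)) = of_nat p"
    by (simp flip: of_real_mult)
  moreover have "of_int (Legendre L (int p)) * of_int (Legendre L (int p)) = (1 :: complex)"
    using Legendre_p_square[OF p_not_dvd_L] by (simp add: Legendre_p_mult flip: of_int_mult)
  moreover have "Legendre (-1) (int p) = chi4 (int p)" using minus_one_Legendre prime_p p_gt_2 .
  moreover have "of_nat p \<noteq> (0 :: complex)" using p_gt_2 by simp
  ultimately show ?thesis
    by (auto simp: W_const_def eps_def chi4_def cong_def field_simps)
qed

text \<open>The two square roots of \<open>p\<close> and the two symbols (L/p) cancel. If
  \<open>p\<close> is 3 modulo 4, the two values -i of the conjugate and the inverse of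
  \<open>eps\<close> give -1, which the factor (-1/p) compensates.\<close>

lemma W_const_K_const: "W_const * K_const = 1"
proof -
  have "of_int (Legendre L (int p)) * of_int (Legendre L (int p)) = (1 :: complex)"
    using Legendre_p_square[OF p_not_dvd_L] by (simp add: Legendre_p_mult flip: of_int_mult)
  moreover have "Legendre (-1) (int p) = chi4 (int p)" using minus_one_Legendre prime_p p_gt_2 .
  moreover have "complex_of_real (sqrt (real p)) \<noteq> 0" using p_gt_2 by simp
  ultimately show ?thesis
    by (auto simp: W_const_def K_const_def eps_def chi4_def cong_def field_simps)
qed

lemma K_const_square: "K_const\<^sup>2 = of_nat p * of_int (Legendre (-1) (int p))"
proof -
  have "complex_of_real (sqrt (real p)) * of_real (sqrt (real p)) = of_nat p"
    by (simp flip: of_real_mult)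
  moreover have "of_int (Legendre L (int p)) * of_int (Legendre L (int p)) = (1 :: complex)"
    using Legendre_p_square[OF p_not_dvd_L] by (simp add: Legendre_p_mult flip: of_int_mult)
  moreover have "Legendre (-1) (int p) = chi4 (int p)" using minus_one_Legendre prime_p p_gt_2 .
  ultimately show ?thesis
    by (auto simp: K_const_def eps_def chi4_def cong_def power2_eq_square field_simps)
qed

lemma W_op_involution:
  assumes f: "f \<in> cusp_forms k (4 * M)" and z: "Im z > 0"
  shows "W_op k M p m n (W_op k M p m n f) z = f z"
proof -
  define \<psi> where "\<psi> u = complex_of_int (Legendre (m * u) (int p))" for u
  define A where "A z = (\<Sum>t\<in>{0..int p - 1}. lower t (shifted m f) z)" for z
  define R where "R = {0..int p - 1}"
  define P where "P = {1..int p - 1}"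
  \<comment> \<open>The twist terms move from \<open>u\<close> to \<open>u + m\<close>, while the
    exceptional term is unaffected by a translation by m/p.\<close>
  have shifted_W: "shifted m (W_op k M p m n f) w
    = W_const * ((\<Sum>u\<in>P. \<psi> u * shifted (u + m) f w) + lower 1 (shifted m f) w)" if w: "Im w > 0" for w
  proof -
    have w': "Im (w + of_int m / of_nat p) > 0" using w by simp
    have "shifted u f (w + of_int m / of_nat p) = shifted (u + m) f w" for u
      by (simp add: shifted_def add_divide_distrib add_ac)
    then show ?thesis
      using W_op_eq[OF f w'] sum_lower_shifted_m[OF f w'] lower_1_shifted_m_translate[OF f w, of m]
      by (simp add: shifted_def[of m "W_op k M p m n f"] \<psi>_def P_def)
  qed
  have "lower t (shifted m (W_op k M p m n f)) z
    = W_const * ((\<Sum>u\<in>P. \<psi> u * lower t (shifted (u + m) f) z) + lower (1 * t + 1) (shifted m f) z)" for t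
    using lower_cong[OF shifted_W z, where t = t] lower_lower[OF z]
    by (simp add: lower_cmult lower_add lower_sum)
  then have "W_op k M p m n (W_op k M p m n f) z
    = W_const * (\<Sum>t\<in>R. W_const * ((\<Sum>u\<in>P. \<psi> u * lower t (shifted (u + m) f) z) + lower (1 * t + 1) (shifted m f) z))"
    using W_op_eq[OF W_op_cusp_form[OF f] z] by (simp add: R_def)
  also have "\<dots> = W_const * W_const * ((\<Sum>t\<in>R. \<Sum>u\<in>P. \<psi> u * lower t (shifted (u + m) f) z)
      + (\<Sum>t\<in>R. lower (1 * t + 1) (shifted m f) z))"
    by (simp add: sum.distrib flip: sum_distrib_left)
  also have "(\<Sum>t\<in>R. lower (1 * t + 1) (shifted m f) z) = A z"
    unfolding R_def A_def using p_gt_2 z by (intro sum_residues_affine lower_shifted_cong[OF f]) auto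
  also have "(\<Sum>t\<in>R. \<Sum>u\<in>P. \<psi> u * lower t (shifted (u + m) f) z)
    = (\<Sum>u\<in>P. \<psi> u * (\<Sum>t\<in>R. lower t (shifted (u + m) f) z))"
    by (subst sum.swap) (simp add: sum_distrib_left)
  \<comment> \<open>Every twist term again produces \<open>A\<close>, and only the residue
    \<open>u = -m\<close> produces \<open>f\<close>. The total coefficient of \<open>A\<close> is
    the character sum -1, plus 1 from the exceptional terms.\<close>
  also have "\<dots> = (\<Sum>u\<in>P. \<psi> u * (\<psi> (u + m) * A z + (if int p dvd u + m then of_nat p * f z else 0)))"
  proof (intro sum.cong refl)
    fix u
    show "\<psi> u * (\<Sum>t\<in>R. lower t (shifted (u + m) f) z)
      = \<psi> u * (\<psi> (u + m) * A z + (if int p dvd u + m then of_nat p * f z else 0))"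
      using sum_lower_shifted[OF f z, of "u + m"] by (simp only: A_def \<psi>_def R_def)
  qed
  also have "\<dots> = (\<Sum>u\<in>P. \<psi> u * \<psi> (u + m)) * A z + (\<Sum>u\<in>P. if int p dvd u + m then \<psi> u * (of_nat p * f z) else 0)"
    unfolding sum_distrib_right sum.distrib[symmetric] by (intro sum.cong) (auto simp: algebra_simps)
  also have "(\<Sum>u\<in>P. \<psi> u * \<psi> (u + m)) = -1"
  proof -
    have "Legendre (m * u) (int p) * Legendre (m * (u + m)) (int p) = Legendre (u * (u + m)) (int p)" for u
    proof -
      have "Legendre (m * u) (int p) * Legendre (m * (u + m)) (int p) = Legendre (m * m) (int p) * Legendre (u * (u + m)) (int p)"
        by (simp add: Legendre_p_mult)
      then show ?thesis using Legendre_p_square[OF p_not_dvd_m] by simp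
    qed
    then have "(\<Sum>u\<in>P. \<psi> u * \<psi> (u + m)) = of_int (\<Sum>u\<in>P. Legendre (u * (u + m)) (int p))"
      by (simp add: \<psi>_def flip: of_int_mult)
    then show ?thesis using jacobsthal_sum by (simp add: P_def)
  qed
  also have "(\<Sum>u\<in>P. if int p dvd u + m then \<psi> u * (of_nat p * f z) else 0)
    = of_int (Legendre (-1) (int p)) * (of_nat p * f z)"
  proof -
    define u0 where "u0 = (- m) mod int p"
    have u0: "int p dvd u0 + m"
      unfolding u0_def by (metis cong_def cong_iff_dvd_diff diff_minus_eq_add mod_mod_trivial)
    have "u0 \<noteq> 0" using u0 p_not_dvd_m by auto
    moreover have "0 \<le> u0" "u0 < int p" using p_gt_2 by (simp_all add: u0_def)
    ultimately have u0P: "u0 \<in> P" by (simp add: P_def)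
    have "int p dvd u + m \<longleftrightarrow> u = u0" if u: "u \<in> P" for u
    proof
      assume "int p dvd u + m"
      then have "int p dvd (u + m) - (u0 + m)" using u0 by (rule dvd_diff)
      then have "int p dvd u - u0" by simp
      moreover have "\<bar>u - u0\<bar> < int p" using u u0P by (auto simp: P_def)
      ultimately show "u = u0" using dvd_imp_le_int[of "u - u0" "int p"] by fastforce
    qed (simp add: u0)
    then have "(\<Sum>u\<in>P. if int p dvd u + m then \<psi> u * (of_nat p * f z) else 0)
      = (\<Sum>u\<in>P. if u = u0 then \<psi> u * (of_nat p * f z) else 0)" by (intro sum.cong) auto
    also have "\<dots> = \<psi> u0 * (of_nat p * f z)" using u0P by (simp add: P_def)
    also have "\<psi> u0 = of_int (Legendre (m * m * -1) (int p))"
    proof -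
      have "m * u0 - m * m * -1 = m * (u0 + m)" by (simp add: algebra_simps)
      then show ?thesis unfolding \<psi>_def using u0 by (subst Legendre_p_cong[of "m * u0" "m * m * -1"]) auto
    qed
    also have "Legendre (m * m * -1) (int p) = Legendre (-1) (int p)"
      using Legendre_p_square[OF p_not_dvd_m] Legendre_p_mult[of "m * m" "-1"] by simp
    finally show ?thesis .
  qed
  also have "W_const * W_const * (- 1 * A z + of_int (Legendre (-1) (int p)) * (of_nat p * f z) + A z)
    = (W_const * W_const * (of_int (Legendre (-1) (int p)) * of_nat p)) * f z"
    by (simp add: algebra_simps)
  also have "\<dots> = f z" by (simp only: W_const_square mult_1)
  finally show ?thesis .
qed

text \<open>Averaging over \<open>b\<close> modulo \<open>p^2\<close> absorbs a translation by u/p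
  into \<open>b + p * u\<close>, so every twist term gives the same sum and the factor is a
  vanishing character sum. The exceptional term at \<open>w b\<close> is a function of
  \<open>z + b\<close> of period \<open>p\<close>, so its sum is \<open>p\<close> times that over
  one period, which is \<open>Q\<close>.\<close>

lemma U_op_W_op:
  assumes f: "f \<in> cusp_forms k (4 * M)" and z: "Im z > 0"
  shows "of_nat p * U_op (p\<^sup>2) (W_op k M p m n f) z
    = (of_nat p * of_int (Legendre (-1) (int p))) ^ k * Q_op k M p m n f z"
proof -
  have p0: "of_nat p \<noteq> (0 :: complex)" using p_gt_2 by simp
  have pp: "p * p > 0" using p_gt_2 by simp
  define w where "w b = (z + of_int b) / of_nat (p * p)" for b
  have Im_w: "Im (w b) > 0" for b using z pp by (simp add: w_def Im_divide_of_nat del: of_nat_mult)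
  define B where "B = {0..int (p * p) - 1}"
  define P where "P = {1..int p - 1}"
  have w_shift: "w b + of_int u / of_nat p = w (1 * b + int p * u)" for b u
    using p0 by (simp add: w_def field_simps)
  have f_w: "f (w x) = f (w y)" if "[x = y] (mod int (p * p))" for x y
  proof -
    have "int (p * p) dvd x - y" using that by (simp only: cong_iff_dvd_diff)
    then obtain j where "x - y = int (p * p) * j" by (rule dvdE)
    then have "x = y + int (p * p) * j" by simp
    then have "w x = w y + of_int j" using p0 by (simp add: w_def field_simps)
    then show ?thesis using cusp_form_translate[OF f Im_w] by simp
  qed
  have "of_nat (p * p) * U_op (p * p) (W_op k M p m n f) z = (\<Sum>b\<in>B. W_op k M p m n f (w b))"
    using U_op_eq[OF W_op_cusp_form[OF f] pp z] pp sum_int_interval[of "\<lambda>b. W_op k M p m n f (w b)" "p * p"]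
    by (simp add: w_def B_def)
  also have "\<dots> = (\<Sum>b\<in>B. W_const * ((\<Sum>u\<in>P. of_int (Legendre (m * u) (int p)) * f (w (1 * b + int p * u)))
      + lower 1 (shifted m f) (w b)))"
    using W_op_eq[OF f Im_w] sum_lower_shifted_m[OF f Im_w]
    by (simp add: shifted_def[of _ f "w _"] w_shift P_def)
  also have "\<dots> = W_const * ((\<Sum>b\<in>B. \<Sum>u\<in>P. of_int (Legendre (m * u) (int p)) * f (w (1 * b + int p * u)))
      + (\<Sum>b\<in>B. lower 1 (shifted m f) (w b)))"
    by (simp add: sum.distrib flip: sum_distrib_left)
  also have "(\<Sum>b\<in>B. \<Sum>u\<in>P. of_int (Legendre (m * u) (int p)) * f (w (1 * b + int p * u)))
    = (\<Sum>u\<in>P. of_int (Legendre (m * u) (int p)) * (\<Sum>b\<in>B. f (w (1 * b + int p * u))))"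
    by (subst sum.swap) (simp add: sum_distrib_left)
  also have "\<dots> = (\<Sum>u\<in>P. of_int (Legendre (m * u) (int p)) * (\<Sum>b\<in>B. f (w b)))"
  proof -
    have "(\<Sum>b\<in>B. f (w (1 * b + int p * u))) = (\<Sum>b\<in>B. f (w b))" for u
      unfolding B_def using pp f_w by (intro sum_residues_affine[of _ _ "\<lambda>b. f (w b)"]) auto
    then show ?thesis by simp
  qed
  also have "\<dots> = of_int (\<Sum>u\<in>P. Legendre (m * u) (int p)) * (\<Sum>b\<in>B. f (w b))"
    by (simp add: sum_distrib_right)
  also have "(\<Sum>u\<in>P. Legendre (m * u) (int p)) = 0" using sum_Legendre_m_mult by (simp add: P_def)
  also have "(\<Sum>b\<in>B. lower 1 (shifted m f) (w b))
    = (\<Sum>b\<in>B. K_const ^ (2 * k + 1) * theta_slash k n m (4 * L) (int p) f (z + of_int b))"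
    using p0 by (intro sum.cong refl) (simp add: lower_1_shifted_m[OF Im_w], simp add: w_def power2_eq_square)
  also have "\<dots> = K_const ^ (2 * k + 1) * (of_nat p * Q_op k M p m n f z)"
    unfolding B_def sum_distrib_left[symmetric] using p_gt_2
    by (subst sum_residues_multiple[OF _ theta_slash_translate_cong[OF f z]])
      (simp_all add: sum_theta_slash_translate[OF f z])
  also have "W_const * (of_int 0 * (\<Sum>b\<in>B. f (w b)) + K_const ^ (2 * k + 1) * (of_nat p * Q_op k M p m n f z))
    = (W_const * K_const) * (K_const\<^sup>2) ^ k * (of_nat p * Q_op k M p m n f z)"
  proof -
    have "K_const ^ (2 * k + 1) = (K_const\<^sup>2) ^ k * K_const"
      by (simp only: power_add power_mult power_one_right)
    then show ?thesis by (simp only: of_int_0 mult_zero_left add_0_left mult_ac)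
  qed
  also have "\<dots> = (of_nat p * of_int (Legendre (-1) (int p))) ^ k * (of_nat p * Q_op k M p m n f z)"
    by (simp only: W_const_K_const K_const_square mult_1)
  finally show ?thesis using p0 by (simp add: power2_eq_square)
qed

lemma Q_op_eq_U_op_W_op:
  assumes f: "f \<in> cusp_forms k (4 * M)" and z: "Im z > 0"
  shows "Q_op k M p m n f z = of_int (Legendre (-1) (int p)) ^ k * of_nat p powi (1 - int k)
    * U_op (p\<^sup>2) (W_op k M p m n f) z"
proof -
  have p0: "of_nat p \<noteq> (0 :: complex)" using p_gt_2 by simp
  define x where "x = complex_of_int (Legendre (-1) (int p))"
  have x: "x ^ k * x ^ k = 1"
    using minus_one_Legendre[OF prime_p p_gt_2] by (simp add: x_def chi4_def flip: power_mult_distrib)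
  \<comment> \<open>The exponent \<open>1 - k\<close> may be negative, hence the integer power and
    the need for a nonzero base.\<close>
  have "(of_nat p :: complex) powi (1 - int k) * of_nat p ^ k = of_nat p powi (1 - int k + int k)"
    using p0 by (subst power_int_add) auto
  then have pk: "(of_nat p :: complex) powi (1 - int k) * of_nat p ^ k = of_nat p" by simp
  have "of_nat p * (x ^ k * of_nat p powi (1 - int k) * U_op (p\<^sup>2) (W_op k M p m n f) z)
    = x ^ k * of_nat p powi (1 - int k) * (of_nat p * U_op (p\<^sup>2) (W_op k M p m n f) z)"
    by simp
  also have "\<dots> = (x ^ k * x ^ k) * (of_nat p powi (1 - int k) * of_nat p ^ k) * Q_op k M p m n f z"
    unfolding U_op_W_op[OF f z] by (simp add: x_def power_mult_distrib)
  also have "\<dots> = of_nat p * Q_op k M p m n f z" by (simp only: x pk mult_1)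
  finally show ?thesis using p0 by (simp add: x_def)
qed

end

theorem corollary4p3:
  fixes k M p :: nat and m n :: int
  assumes "k > 0" and "odd M" and "M > 0"
    and "prime p" and "p dvd M" and "\<not> p\<^sup>2 dvd M"
    and "int p * n - 4 * int (M div p) * m = 1"
  defines "S \<equiv> cusp_forms k (4 * M)"
    and "W \<equiv> W_op k M p m n"
    and "Q \<equiv> Q_op k M p m n"
  shows "(\<forall>f\<in>S. W f \<in> S) \<and> (\<forall>f\<in>S. Q f \<in> S)
    \<and> (\<forall>f\<in>S. \<forall>z\<in>uhp. W (W f) z = f z)
    \<and> (\<forall>f\<in>S. \<forall>z\<in>uhp. let g = (\<lambda>w. Q f w + f w) in Q g z - of_nat p * g z = 0)
    \<and> (\<forall>f\<in>S. \<forall>z\<in>uhp. Q f z =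
          of_int (Legendre (-1) (int p)) ^ k * of_nat p powi (1 - int k) * U_op (p\<^sup>2) (W f) z)
    \<and> (\<forall>f\<in>cusp_forms k (4 * (M div p)). \<forall>z\<in>uhp. Q f z = of_nat p * f z)"
proof -
  interpret exact_prime_level k M p m n
    using assms by unfold_locales auto
  show ?thesis
    unfolding S_def W_def Q_def Let_def
    using W_op_cusp_form Q_op_cusp_form W_op_involution Q_op_quadratic Q_op_eq_U_op_W_op Q_op_lower_level
    by simp
qed

end
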